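(* Let $M$ be a compact surface, possibly with boundary, endowed with a conformal class $c$ of Riemannian metrics. Suppose that $$\sup\{\lambda_1(\mu,c)\mu(M):\mu\text{ is a continuous Radon measure on }M\}>8\pi.$$ Then any $\lambda_1$-maximising sequence of continuous Radon probability measures, that is, any sequence $(\mu_n)$ of continuous Radon probability measures on $M$ such that $\lambda_1(\mu_n,c)$ converges to the supremum above, contains a subsequence that converges weakly to a continuous Radon measure $\mu$ at which this supremum is achieved.
   Context: Surfaces are smooth and connected. A conformal class $c$ consists of $C^\infty$-smooth Riemannian metrics on $M$ that are conformal to each other. Radon measures are non-negative. A Radon measure $\mu$ is called continuous if it has no atoms, i.e. $\mu(\{x\})=0$ for every $x\in M$. Weak convergence of measures means convergence of integrals of continuous functions on $M$. For a Radon measure $\mu$ on $M$ and an integer $k\geqslant 0$ the $k$th eigenvalue is defined by $$\lambda_k(\mu,c)=\inf_{\Lambda^{k+1}}\ \sup_{u\in\Lambda^{k+1}\setminus\{0\}}R_c(u,\mu),\qquad R_c(u,\mu)=\Big(\int_M|\nabla u|^2\,dVol_g\Big)\Big/\Big(\int_M u^2\,d\mu\Big),$$ where the infimum is over all $(k+1)$-dimensional subspaces $\Lambda^{k+1}\subset L_2(M,\mu)$ formed by $C^\infty$-smooth functions on $M$ (continuous up to the boundary if $\partial M\ne\varnothing$; no boundary condition is imposed), and the infimum of the empty set is $+\infty$. Here $g\in c$ is any reference metric; by conformal invariance of the Dirichlet energy the quotient does not depend on its choice. *)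

theory Defs
  imports "HOL-Analysis.Analysis" "HOL-Library.Function_Algebras"
begin

section \<open>Smooth maps\<close>

text \<open>\<open>Ck_on n W f\<close> is meant for open \<open>W\<close> only; see \<open>smooth_on\<close> for arbitrary sets.\<close>

fun Ck_on ::
  "nat \<Rightarrow> 'a::real_normed_vector set \<Rightarrow> ('a \<Rightarrow> 'b::real_normed_vector) \<Rightarrow> bool" where
  "Ck_on 0 W f \<longleftrightarrow> continuous_on W f"
| "Ck_on (Suc n) W f \<longleftrightarrow>
     (\<forall>x\<in>W. f differentiable (at x)) \<and>
     (\<forall>v. Ck_on n W (\<lambda>x. frechet_derivative f (at x) v))"

text \<open>On a set that is not open (a relatively open piece of a half-plane), a map is smooth if near
  every point it extends to a smooth map on an open set.\<close>

definition smooth_on ::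
  "'a::real_normed_vector set \<Rightarrow> ('a \<Rightarrow> 'b::real_normed_vector) \<Rightarrow> bool" where
  "smooth_on S f \<longleftrightarrow>
     (\<forall>x\<in>S. \<exists>W h. open W \<and> x \<in> W \<and> (\<forall>n. Ck_on n W h) \<and> (\<forall>y\<in>W \<inter> S. h y = f y))"

section \<open>Smooth surfaces with boundary\<close>

definition half_plane :: "(real^2) set" where
  "half_plane = {p. 0 \<le> p $ 1}"

type_synonym 'a chart = "'a set \<times> ('a \<Rightarrow> real^2)"

abbreviation chart_inv :: "'a chart \<Rightarrow> real^2 \<Rightarrow> 'a" where
  "chart_inv \<kappa> \<equiv> inv_into (fst \<kappa>) (snd \<kappa>)"

definition is_chart :: "'a::topological_space set \<Rightarrow> 'a chart \<Rightarrow> bool" where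
  "is_chart M \<kappa> \<longleftrightarrow>
     openin (top_of_set M) (fst \<kappa>) \<and>
     openin (top_of_set half_plane) (snd \<kappa> ` fst \<kappa>) \<and>
     homeomorphism (fst \<kappa>) (snd \<kappa> ` fst \<kappa>) (snd \<kappa>) (chart_inv \<kappa>)"

text \<open>The atlas need not be maximal. Every notion below is unchanged when compatible charts are added
  to it. The boundary of the surface may be empty.\<close>

definition smooth_surface :: "'a::topological_space set \<Rightarrow> 'a chart set \<Rightarrow> bool" where
  "smooth_surface M \<A> \<longleftrightarrow>
     M \<noteq> {} \<and> connected M \<and>
     Hausdorff_space (top_of_set M) \<and> second_countable (top_of_set M) \<and>
     (\<forall>\<kappa>\<in>\<A>. is_chart M \<kappa>) \<and> (\<Union>\<kappa>\<in>\<A>. fst \<kappa>) = M \<and>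
     (\<forall>\<kappa>\<in>\<A>. \<forall>\<kappa>'\<in>\<A>. smooth_on (snd \<kappa> ` (fst \<kappa> \<inter> fst \<kappa>')) (snd \<kappa>' \<circ> chart_inv \<kappa>))"

definition surface_interior :: "'a chart set \<Rightarrow> 'a set" where
  "surface_interior \<A> = {x. \<exists>\<kappa>\<in>\<A>. x \<in> fst \<kappa> \<and> 0 < snd \<kappa> x $ 1}"

text \<open>Smooth up to the boundary.\<close>

definition smooth_function :: "'a chart set \<Rightarrow> ('a \<Rightarrow> real) \<Rightarrow> bool" where
  "smooth_function \<A> u \<longleftrightarrow> (\<forall>\<kappa>\<in>\<A>. smooth_on (snd \<kappa> ` fst \<kappa>) (u \<circ> chart_inv \<kappa>))"

text \<open>Smooth in the interior and continuous up to the boundary; this is the class of test functions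
  for the eigenvalues.\<close>

definition test_function ::
  "'a::topological_space set \<Rightarrow> 'a chart set \<Rightarrow> ('a \<Rightarrow> real) \<Rightarrow> bool" where
  "test_function M \<A> u \<longleftrightarrow>
     continuous_on M u \<and>
     (\<forall>\<kappa>\<in>\<A>. smooth_on (snd \<kappa> ` (fst \<kappa> \<inter> surface_interior \<A>)) (u \<circ> chart_inv \<kappa>))"

section \<open>Riemannian metrics and conformal classes\<close>

text \<open>A metric is given by its matrix of components in every chart of the atlas, as a function of
  the coordinates; its values outside the image of the chart are irrelevant. On a relatively open
  subset of the half-plane the derivative within that set is unique, also at boundary points.\<close>

type_synonym 'a metric_comps = "'a chart \<Rightarrow> real^2 \<Rightarrow> real^2^2"

definition riemannian_metric :: "'a chart set \<Rightarrow> 'a metric_comps \<Rightarrow> bool" where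
  "riemannian_metric \<A> g \<longleftrightarrow>
     (\<forall>\<kappa>\<in>\<A>. smooth_on (snd \<kappa> ` fst \<kappa>) (g \<kappa>) \<and>
        (\<forall>p \<in> snd \<kappa> ` fst \<kappa>. transpose (g \<kappa> p) = g \<kappa> p \<and>
           (\<forall>v. v \<noteq> 0 \<longrightarrow> 0 < v \<bullet> (g \<kappa> p *v v)))) \<and>
     (\<forall>\<kappa>\<in>\<A>. \<forall>\<kappa>'\<in>\<A>. \<forall>x \<in> fst \<kappa> \<inter> fst \<kappa>'. \<forall>D.
        ((snd \<kappa>' \<circ> chart_inv \<kappa>) has_derivative D)
           (at (snd \<kappa> x) within snd \<kappa> ` (fst \<kappa> \<inter> fst \<kappa>')) \<longrightarrow>
        (\<forall>v w. v \<bullet> (g \<kappa> (snd \<kappa> x) *v w) = D v \<bullet> (g \<kappa>' (snd \<kappa>' x) *v D w)))"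

definition conformal_to :: "'a chart set \<Rightarrow> 'a metric_comps \<Rightarrow> 'a metric_comps \<Rightarrow> bool" where
  "conformal_to \<A> g h \<longleftrightarrow>
     (\<exists>\<rho>. smooth_function \<A> \<rho> \<and>
        (\<forall>\<kappa>\<in>\<A>. \<forall>x\<in>fst \<kappa>. 0 < \<rho> x \<and> h \<kappa> (snd \<kappa> x) = \<rho> x *\<^sub>R g \<kappa> (snd \<kappa> x)))"

definition conformal_class :: "'a chart set \<Rightarrow> 'a metric_comps set \<Rightarrow> bool" where
  "conformal_class \<A> c \<longleftrightarrow>
     (\<exists>g. riemannian_metric \<A> g \<and> c = {h. riemannian_metric \<A> h \<and> conformal_to \<A> g h})"

section \<open>Dirichlet energy\<close>

definition is_volume_measure ::
  "'a::topological_space set \<Rightarrow> 'a chart set \<Rightarrow> 'a metric_comps \<Rightarrow> 'a measure \<Rightarrow> bool" where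
  "is_volume_measure M \<A> g \<nu> \<longleftrightarrow>
     sets \<nu> = sets (restrict_space borel M) \<and>
     (\<forall>\<kappa>\<in>\<A>. \<forall>B\<in>sets \<nu>. B \<subseteq> fst \<kappa> \<longrightarrow>
        emeasure \<nu> B = (\<integral>\<^sup>+p\<in>snd \<kappa> ` B. ennreal (sqrt (det (g \<kappa> p))) \<partial>lborel))"

definition volume_measure ::
  "'a::topological_space set \<Rightarrow> 'a chart set \<Rightarrow> 'a metric_comps \<Rightarrow> 'a measure" where
  "volume_measure M \<A> g = (THE \<nu>. is_volume_measure M \<A> g \<nu>)"

definition euclidean_gradient :: "(real^2 \<Rightarrow> real) \<Rightarrow> real^2 \<Rightarrow> real^2" where
  "euclidean_gradient f p = (\<chi> i. frechet_derivative f (at p) (axis i 1))"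

text \<open>The squared length of the gradient at an interior point, \<open>g\<^sup>i\<^sup>j \<partial>\<^sub>i u \<partial>\<^sub>j u\<close>. It is the same in
  every chart around the point.\<close>

definition grad_norm_sq ::
  "'a chart set \<Rightarrow> 'a metric_comps \<Rightarrow> ('a \<Rightarrow> real) \<Rightarrow> 'a \<Rightarrow> real" where
  "grad_norm_sq \<A> g u x =
     (let \<kappa> = (SOME \<kappa>. \<kappa> \<in> \<A> \<and> x \<in> fst \<kappa>);
          d = euclidean_gradient (u \<circ> chart_inv \<kappa>) (snd \<kappa> x)
      in d \<bullet> (matrix_inv (g \<kappa> (snd \<kappa> x)) *v d))"

text \<open>The boundary is a null set for the volume measure, so it is left out of the integral.
  The energy of a test function may be infinite.\<close>

definition dirichlet_energy ::
  "'a::topological_space set \<Rightarrow> 'a chart set \<Rightarrow> 'a metric_comps \<Rightarrow> ('a \<Rightarrow> real) \<Rightarrow> ennreal" where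
  "dirichlet_energy M \<A> g u =
     (\<integral>\<^sup>+x\<in>surface_interior \<A>. ennreal (grad_norm_sq \<A> g u x) \<partial>volume_measure M \<A> g)"

section \<open>Radon measures and eigenvalues\<close>

definition radon_measure :: "'a::topological_space set \<Rightarrow> 'a measure \<Rightarrow> bool" where
  "radon_measure M \<mu> \<longleftrightarrow>
     sets \<mu> = sets (restrict_space borel M) \<and>
     (\<forall>K. compact K \<and> K \<subseteq> M \<longrightarrow> emeasure \<mu> K < \<infinity>) \<and>
     (\<forall>B\<in>sets \<mu>. emeasure \<mu> B = (SUP K\<in>{K. compact K \<and> K \<subseteq> B}. emeasure \<mu> K))"

definition continuous_radon_measure :: "'a::topological_space set \<Rightarrow> 'a measure \<Rightarrow> bool" where
  "continuous_radon_measure M \<mu> \<longleftrightarrow> radon_measure M \<mu> \<and> (\<forall>x\<in>M. emeasure \<mu> {x} = 0)"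

text \<open>\<open>R\<^sub>c(u, \<mu>)\<close>; by conformal invariance any reference metric in \<open>c\<close> may be used.\<close>

definition rayleigh_quotient ::
  "'a::topological_space set \<Rightarrow> 'a chart set \<Rightarrow> 'a metric_comps set \<Rightarrow> ('a \<Rightarrow> real) \<Rightarrow> 'a measure \<Rightarrow> ennreal"
  where
  "rayleigh_quotient M \<A> c u \<mu> =
     dirichlet_energy M \<A> (SOME g. g \<in> c) u / (\<integral>\<^sup>+x. ennreal ((u x)\<^sup>2) \<partial>\<mu>)"

global_interpretation fun_vs: vector_space "\<lambda>(r::real) (u::'a \<Rightarrow> real) x. r * u x"
  defines fun_subspace = fun_vs.subspace and fun_dim = fun_vs.dim
  by unfold_locales (auto simp: fun_eq_iff algebra_simps)

text \<open>An \<open>m\<close>-dimensional subspace of \<open>L\<^sub>2(M, \<mu>)\<close> formed by test functions. Elements of \<open>L\<^sub>2\<close> are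
  classes modulo \<open>\<mu>\<close>-null functions, so the last condition makes the dimension the one in
  \<open>L\<^sub>2(M, \<mu>)\<close>; it also makes the values of the functions outside \<open>M\<close> immaterial. For \<open>m > 0\<close>,
  having dimension \<open>m\<close> includes being finite-dimensional.\<close>

definition test_subspace ::
  "'a::topological_space set \<Rightarrow> 'a chart set \<Rightarrow> 'a measure \<Rightarrow> nat \<Rightarrow> ('a \<Rightarrow> real) set \<Rightarrow> bool" where
  "test_subspace M \<A> \<mu> m \<Lambda> \<longleftrightarrow>
     fun_subspace \<Lambda> \<and> fun_dim \<Lambda> = m \<and>
     (\<forall>u\<in>\<Lambda>. test_function M \<A> u \<and> integrable \<mu> (\<lambda>x. (u x)\<^sup>2) \<and>
        ((AE x in \<mu>. u x = 0) \<longrightarrow> u = 0))"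

definition eigenvalue ::
  "'a::topological_space set \<Rightarrow> 'a chart set \<Rightarrow> 'a metric_comps set \<Rightarrow> nat \<Rightarrow> 'a measure \<Rightarrow> ennreal"
  where
  "eigenvalue M \<A> c k \<mu> =
     (INF \<Lambda>\<in>{\<Lambda>. test_subspace M \<A> \<mu> (k + 1) \<Lambda>}.
        SUP u\<in>\<Lambda> - {0}. rayleigh_quotient M \<A> c u \<mu>)"

definition sup_first_eigenvalue ::
  "'a::topological_space set \<Rightarrow> 'a chart set \<Rightarrow> 'a metric_comps set \<Rightarrow> ennreal" where
  "sup_first_eigenvalue M \<A> c =
     (SUP \<mu>\<in>{\<mu>. continuous_radon_measure M \<mu>}. eigenvalue M \<A> c 1 \<mu> * emeasure \<mu> M)"

definition weakly_converges ::
  "'a::topological_space set \<Rightarrow> (nat \<Rightarrow> 'a measure) \<Rightarrow> 'a measure \<Rightarrow> bool" where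
  "weakly_converges M \<mu> \<mu>' \<longleftrightarrow>
     (\<forall>f. continuous_on M f \<longrightarrow>
        (\<lambda>n. integral\<^sup>L (\<mu> n) f) \<longlonglongrightarrow> integral\<^sup>L \<mu>' (f :: 'a \<Rightarrow> real))"

end

theory Submission
  imports Defs "HOL-Probability.Helly_Selection"
begin

text \<open>By weak compactness a subsequence of the maximising sequence converges to a Radon probability
  measure \<open>\<mu>'\<close>. If \<open>\<mu>'\<close> has no atoms, it is a maximiser: a finite-dimensional space of test functions
  for \<open>\<mu>'\<close> is one for the nearby measures with almost the same Rayleigh quotients, so \<open>\<lambda>\<^sub>1\<close> is upper
  semicontinuous.

  An atom of mass strictly between \<open>0\<close> and \<open>1\<close> forces \<open>\<lambda>\<^sub>1\<close> to tend to \<open>0\<close>, because logarithmic cutoff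
  functions around it have small Dirichlet energy and a variance bounded from below.

  If \<open>\<mu>'\<close> is a Dirac measure, the test functions are \<open>\<psi> \<sigma>\<^sub>i\<close>, where \<open>\<psi>\<close> is a logarithmic cutoff and
  \<open>\<sigma>\<close> is a conformal map from the plane to the unit sphere, normalised as in Hersch's lemma so that
  the \<open>\<psi> \<sigma>\<^sub>i\<close> have mean zero. Since \<open>\<bar>\<sigma>\<bar> = 1\<close>, their energies add up to the energy of \<open>\<psi>\<close> plus at most
  twice the area of the sphere, which gives \<open>\<lambda>\<^sub>1 \<le> 8 \<pi>\<close> in the limit. The metric enters only through
  Dirichlet energies near a point, so coordinates that are Euclidean at that point suffice instead
  of isothermal ones; boundary points need no separate treatment because energies are only
  estimated from above.\<close>

section \<open>Calculus of smooth functions\<close>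

text \<open>The constant \<open>8 * pi\<close> is twice the area of the unit sphere: in two
  dimensions the Dirichlet energy of an injective conformal map is twice the area of its image. The
  three inequalities for the \<psi> \<sigma>_i are added, so that |\<sigma>| = 1 is used in the
  denominators as well as in the energies and no factor is lost. The cutoff is almost free because a
  point has zero capacity in the plane: \<psi> is 1 there, and its energy can be made small without
  enlarging its support.

  The limit measure may be a Dirac measure, for which no normalisation of \<sigma> exists. It is
  therefore carried out for the members of the sequence, which have no atoms. The resulting \<sigma>
  varies with the index, but the bound on its energy does not. Hence the index can tend to infinity
  for fixed \<psi>, then the energy of \<psi> to 0, and at last the chart can be made more nearly
  Euclidean.

  Since the supremum is an extended number, the estimates are made with a real number strictly
  between \<open>8 * pi\<close> and the supremum.\<close>

lemma Ck_on_cong: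
  assumes "open W" "\<And>x. x \<in> W \<Longrightarrow> f x = g x"
  shows "Ck_on n W f \<longleftrightarrow> Ck_on n W g"
  using assms(2)
proof (induction n arbitrary: f g)
  case 0
  then show ?case using continuous_on_cong[of W W f g] by simp
next
  case (Suc n)
  have hd: "(f has_derivative D) (at x) \<longleftrightarrow> (g has_derivative D) (at x)" if "x \<in> W" for x D
  proof
    show "(g has_derivative D) (at x)" if "(f has_derivative D) (at x)"
      by (rule has_derivative_transform_within_open[OF that assms(1) \<open>x \<in> W\<close>]) (simp add: Suc.prems)
    show "(f has_derivative D) (at x)" if "(g has_derivative D) (at x)"
      by (rule has_derivative_transform_within_open[OF that assms(1) \<open>x \<in> W\<close>]) (simp add: Suc.prems)
  qed
  have d: "frechet_derivative f (at x) = frechet_derivative g (at x)" if "x \<in> W" for x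
    unfolding frechet_derivative_def by (simp add: hd[OF that])
  have "f differentiable (at x) \<longleftrightarrow> g differentiable (at x)" if "x \<in> W" for x
    unfolding differentiable_def by (simp add: hd[OF that])
  moreover have "Ck_on n W (\<lambda>x. frechet_derivative f (at x) v)
      \<longleftrightarrow> Ck_on n W (\<lambda>x. frechet_derivative g (at x) v)" for v
    by (rule Suc.IH) (simp add: d)
  ultimately show ?case by simp
qed

lemma Ck_on_subset: "Ck_on n W f \<Longrightarrow> W' \<subseteq> W \<Longrightarrow> Ck_on n W' f"
  by (induction n arbitrary: f) (auto intro: continuous_on_subset)

lemma differentiable_imp_Ck_on_0:
  "(\<And>x. x \<in> W \<Longrightarrow> f differentiable (at x)) \<Longrightarrow> Ck_on 0 W f"
  by (auto intro!: continuous_at_imp_continuous_on differentiable_imp_continuous_within)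

lemma Ck_on_SucD: "Ck_on (Suc n) W f \<Longrightarrow> Ck_on n W f"
proof (induction n arbitrary: f)
  case 0
  then show ?case using differentiable_imp_Ck_on_0[of W f] by simp
qed simp

lemma Ck_on_SucI:
  assumes "open W"
    and "\<And>x. x \<in> W \<Longrightarrow> (f has_derivative D x) (at x)"
    and "\<And>v. Ck_on n W (\<lambda>x. D x v)"
  shows "Ck_on (Suc n) W f"
proof -
  have "frechet_derivative f (at x) = D x" if "x \<in> W" for x
    using frechet_derivative_at[OF assms(2)[OF that]] by simp
  then have "Ck_on n W (\<lambda>x. frechet_derivative f (at x) v)" for v
    using assms(3)[of v] Ck_on_cong[OF assms(1), of "\<lambda>x. frechet_derivative f (at x) v" "\<lambda>x. D x v"] by simp
  then show ?thesis
    using assms(2) by (auto simp: differentiable_def)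
qed

lemma Ck_on_Suc_has_derivative:
  "Ck_on (Suc n) W f \<Longrightarrow> x \<in> W \<Longrightarrow> (f has_derivative frechet_derivative f (at x)) (at x)"
  by (simp add: frechet_derivative_works[symmetric])

text \<open>Serves for \<open>smooth_step\<close>: its derivatives stay in one explicit family of
  functions, so that no formula for the n-th derivative has to be found.\<close>

lemma Ck_on_coinduct:
  assumes "open W" "P f"
    and "\<And>f. P f \<Longrightarrow>
      \<exists>D. (\<forall>x\<in>W. (f has_derivative D x) (at x)) \<and> (\<forall>v. P (\<lambda>x. D x v))"
  shows "Ck_on n W f"
  using assms(2)
proof (induction n arbitrary: f)
  case 0
  then show ?case
    using assms(3)[OF 0] by (intro differentiable_imp_Ck_on_0) (auto simp: differentiable_def)
next
  case (Suc n)
  obtain D where D: "\<And>x. x \<in> W \<Longrightarrow> (f has_derivative D x) (at x)" "\<And>v. P (\<lambda>x. D x v)"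
    using assms(3)[OF Suc.prems] by blast
  show ?case
    by (rule Ck_on_SucI[OF assms(1) D(1) Suc.IH[OF D(2)]])
qed

lemma Ck_on_const: "Ck_on n W (\<lambda>x. c)"
  by (induction n arbitrary: c) auto

lemma Ck_on_bounded_linear:
  assumes "open W" "bounded_linear L" "Ck_on n W f"
  shows "Ck_on n W (\<lambda>x. L (f x))"
  using assms(3)
proof (induction n arbitrary: f)
  case 0
  then show ?case
    using assms(2) by (simp add: bounded_linear.continuous_on)
next
  case (Suc n)
  show ?case
  proof (rule Ck_on_SucI[OF assms(1)])
    show "((\<lambda>x. L (f x)) has_derivative (\<lambda>v. L (frechet_derivative f (at x) v))) (at x)"
      if "x \<in> W" for x
      by (rule bounded_linear.has_derivative[OF assms(2) Ck_on_Suc_has_derivative[OF Suc.prems that]])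
    show "Ck_on n W (\<lambda>x. L (frechet_derivative f (at x) v))" for v
      by (rule Suc.IH) (use Suc.prems in simp)
  qed
qed

lemma Ck_on_ident: "Ck_on n W (\<lambda>x. x)"
  by (cases n) (auto simp: Ck_on_const)

lemma Ck_on_add:
  assumes "open W" "Ck_on n W f" "Ck_on n W g"
  shows "Ck_on n W (\<lambda>x. f x + g x)"
  using assms(2,3)
proof (induction n arbitrary: f g)
  case 0
  then show ?case by (simp add: continuous_on_add)
next
  case (Suc n)
  show ?case
    by (rule Ck_on_SucI[OF assms(1)], rule has_derivative_add)
      (use Suc in \<open>auto intro: Ck_on_Suc_has_derivative\<close>)
qed

lemma Ck_on_mult:
  fixes f g :: "'a::real_normed_vector \<Rightarrow> real"
  assumes "open W" "Ck_on n W f" "Ck_on n W g"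
  shows "Ck_on n W (\<lambda>x. f x * g x)"
  using assms(2,3)
proof (induction n arbitrary: f g)
  case 0
  then show ?case by (simp add: continuous_on_mult)
next
  case (Suc n)
  have "Ck_on n W f" "Ck_on n W g"
    using Suc.prems by (auto intro: Ck_on_SucD simp del: Ck_on.simps)
  with Suc.IH Suc.prems show ?case
    by (intro Ck_on_SucI[OF assms(1), OF has_derivative_mult] Ck_on_add[OF assms(1)])
      (auto intro: Ck_on_Suc_has_derivative)
qed

lemma Ck_on_sum:
  assumes "open W" "finite I" "\<And>i. i \<in> I \<Longrightarrow> Ck_on n W (f i)"
  shows "Ck_on n W (\<lambda>x. \<Sum>i\<in>I. f i x)"
  using assms(2,3)
proof (induction I rule: finite_induct)
  case empty
  then show ?case by (simp add: Ck_on_const)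
next
  case (insert i I)
  then show ?case by (simp add: Ck_on_add[OF assms(1)])
qed

text \<open>The chain rule is expanded in a basis of the middle space. The derivative is then a
  finite sum of products of a component of the derivative of \<open>f\<close> with a partial
  derivative of \<open>F\<close> at \<open>f x\<close>. The induction is over all \<open>F\<close>,
  because the partial derivatives take its place.\<close>

lemma Ck_on_compose:
  fixes f :: "'a::real_normed_vector \<Rightarrow> 'b::euclidean_space" and F :: "'b \<Rightarrow> real"
  assumes "open W" "f ` W \<subseteq> V" "Ck_on n W f" "Ck_on n V F"
  shows "Ck_on n W (\<lambda>x. F (f x))"
  using assms(3,4)
proof (induction n arbitrary: F)
  case 0
  then show ?case
    using assms(2) continuous_on_compose2[of V F W f] by simp
next
  case (Suc n)
  show ?case
  proof (rule Ck_on_SucI[OF assms(1)])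
    fix x assume x: "x \<in> W"
    then have "f x \<in> V" using assms(2) by blast
    have F: "(F has_derivative frechet_derivative F (at (f x))) (at (f x))"
      by (rule Ck_on_Suc_has_derivative[OF Suc.prems(2) \<open>f x \<in> V\<close>])
    then have lin: "linear (frechet_derivative F (at (f x)))"
      by (simp add: has_derivative_linear)
    have "((\<lambda>x. F (f x)) has_derivative
        (\<lambda>v. frechet_derivative F (at (f x)) (frechet_derivative f (at x) v))) (at x)"
      using has_derivative_compose[OF Ck_on_Suc_has_derivative[OF Suc.prems(1) x] F] .
    also have "(\<lambda>v. frechet_derivative F (at (f x)) (frechet_derivative f (at x) v)) =
      (\<lambda>v. \<Sum>b\<in>Basis. (frechet_derivative f (at x) v \<bullet> b) * frechet_derivative F (at (f x)) b)"
    proof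
      fix v
      have "frechet_derivative F (at (f x)) (frechet_derivative f (at x) v) =
        frechet_derivative F (at (f x)) (\<Sum>b\<in>Basis. (frechet_derivative f (at x) v \<bullet> b) *\<^sub>R b)"
        by (simp add: euclidean_representation)
      also have "\<dots> = (\<Sum>b\<in>Basis. (frechet_derivative f (at x) v \<bullet> b) * frechet_derivative F (at (f x)) b)"
        by (simp add: linear_sum[OF lin] linear_cmul[OF lin])
      finally show "frechet_derivative F (at (f x)) (frechet_derivative f (at x) v) = \<dots>" .
    qed
    finally show "((\<lambda>x. F (f x)) has_derivative
      (\<lambda>v. \<Sum>b\<in>Basis. (frechet_derivative f (at x) v \<bullet> b) * frechet_derivative F (at (f x)) b)) (at x)" .
  next
    fix v
    show "Ck_on n W (\<lambda>x. \<Sum>b\<in>Basis. (frechet_derivative f (at x) v \<bullet> b) * frechet_derivative F (at (f x)) b)"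
    proof (intro Ck_on_sum Ck_on_mult assms(1) finite_Basis)
      fix b :: 'b
      show "Ck_on n W (\<lambda>x. frechet_derivative f (at x) v \<bullet> b)"
        by (rule Ck_on_bounded_linear[OF assms(1) bounded_linear_inner_left]) (use Suc.prems in simp)
      show "Ck_on n W (\<lambda>x. frechet_derivative F (at (f x)) b)"
        by (rule Suc.IH) (use Suc.prems Ck_on_SucD[OF Suc.prems(1)] in auto)
    qed
  qed
qed

text \<open>The derivative is a polynomial in the function itself, so the induction feeds on its own
  hypothesis.\<close>

lemma Ck_on_inverse: "Ck_on n {0<..} (inverse :: real \<Rightarrow> real)"
proof (induction n)
  case 0
  then show ?case by (auto intro!: continuous_intros)
next
  case (Suc n)
  show ?case
  proof (rule Ck_on_SucI)
    show "(inverse has_derivative (\<lambda>v. - (inverse x * inverse x) * v)) (at x)"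
      if "x \<in> {0<..}" for x :: real
      using that DERIV_inverse[of x UNIV] by (simp add: has_field_derivative_def power2_eq_square fun_Compl_def)
    show "Ck_on n {0<..} (\<lambda>x. - (inverse x * inverse x) * v)" for v :: real
      using Ck_on_mult[OF _ Ck_on_const[of n _ "- v"] Ck_on_mult[OF _ Suc Suc]]
      by (simp add: algebra_simps)
  qed simp
qed

lemma Ck_on_ln: "Ck_on n {0<..} (ln :: real \<Rightarrow> real)"
proof (rule Ck_on_SucD, rule Ck_on_SucI)
  show "(ln has_derivative (\<lambda>v. inverse x * v)) (at x)" if "x \<in> {0<..}" for x :: real
    using that DERIV_ln[of x] by (simp add: has_field_derivative_def)
  show "Ck_on n {0<..} (\<lambda>x. inverse x * v)" for v :: real
    by (intro Ck_on_mult Ck_on_inverse Ck_on_const) simp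
qed simp

section \<open>A smooth step function on the line\<close>

definition smooth_step :: "real \<Rightarrow> real" where
  "smooth_step t = (if t > 0 then exp (1 - 1 / t) else 0)"

lemma poly_exp_inverse_tendsto_0:
  "((\<lambda>t. poly p (1 / t) * exp (1 - 1 / t)) \<longlongrightarrow> 0) (at_right (0::real))"
proof -
  have "((\<lambda>x. poly p x / exp x) \<longlongrightarrow> 0) at_top"
  proof -
    have "((\<lambda>x. coeff p i * (x ^ i / exp x)) \<longlongrightarrow> coeff p i * 0) at_top" for i
      by (intro tendsto_intros tendsto_power_div_exp_0)
    then have "((\<lambda>x. \<Sum>i\<le>degree p. coeff p i * (x ^ i / exp x)) \<longlongrightarrow> (\<Sum>i\<le>degree p. coeff p i * 0)) at_top"
      by (intro tendsto_sum)
    then show ?thesis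
      by (simp add: poly_altdef sum_divide_distrib)
  qed
  then have "((\<lambda>x. exp 1 * (poly p x / exp x)) \<longlongrightarrow> exp 1 * 0) at_top"
    by (intro tendsto_intros)
  then have "((\<lambda>t. exp 1 * (poly p (inverse t) / exp (inverse t))) \<longlongrightarrow> 0) (at_right (0::real))"
    using filterlim_compose filterlim_inverse_at_top_right by fastforce
  then show ?thesis
    by (simp add: exp_diff divide_inverse mult.assoc mult.left_commute)
qed

lemma Ck_on_smooth_step: "Ck_on n UNIV smooth_step"
proof -
  define F where "F = (\<lambda>(p::real poly) t. if t > 0 then poly p (1 / t) * exp (1 - 1 / t) else 0)"
  \<comment> \<open>With x = 1 / t, the polynomial \<open>[:0, 0, 1:] * (p - pderiv p)\<close> is
    x^2 (p - p'): the derivative of the exponential contributes p / t^2, that of p (1 / t)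
    contributes - p' / t^2.\<close>
  have deriv: "(F p has_real_derivative F ([:0, 0, 1:] * (p - pderiv p)) t) (at t)" for p t
  proof -
    consider "t > 0" | "t < 0" | "t = 0" by linarith
    then show ?thesis
    proof cases
      case 1
      have "((\<lambda>t. poly p (1 / t) * exp (1 - 1 / t)) has_real_derivative
          F ([:0, 0, 1:] * (p - pderiv p)) t) (at t)"
        using 1 by (auto intro!: derivative_eq_intros DERIV_chain2[OF poly_DERIV]
            simp: F_def field_simps power2_eq_square)
      then show ?thesis
        by (rule has_field_derivative_transform_within_open[where S = "{0<..}"])
          (use 1 in \<open>auto simp: F_def\<close>)
    next
      case 2
      have "((\<lambda>t. 0) has_real_derivative F ([:0, 0, 1:] * (p - pderiv p)) t) (at t)"
        using 2 by (auto simp: F_def)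
      then show ?thesis
        by (rule has_field_derivative_transform_within_open[where S = "{..<0}"])
          (use 2 in \<open>auto simp: F_def\<close>)
    next
      case 3
      \<comment> \<open>Division by h multiplies the polynomial by x = 1 / h, so the difference
        quotient belongs to the same family and tends to 0.\<close>
      have "((\<lambda>h. F p h / h) \<longlongrightarrow> 0) (at_right 0)"
        by (rule tendsto_cong[THEN iffD1, OF _ poly_exp_inverse_tendsto_0[of "[:0, 1:] * p"]])
          (auto simp: F_def eventually_at_filter)
      moreover have "((\<lambda>h. F p h / h) \<longlongrightarrow> 0) (at_left 0)"
        by (rule tendsto_cong[THEN iffD1, OF _ tendsto_const])
          (auto simp: F_def eventually_at_filter)
      ultimately have "((\<lambda>h. F p h / h) \<longlongrightarrow> 0) (at 0)"
        by (simp add: filterlim_split_at)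
      then have "(\<lambda>h. (F p (0 + h) - F p 0) / h) \<midarrow>0\<rightarrow> 0"
        by (simp add: F_def)
      moreover have "F q 0 = 0" for q
        by (simp add: F_def)
      ultimately show ?thesis
        unfolding DERIV_def 3 by (simp only:)
    qed
  qed
  have "smooth_step = F 1" by (auto simp: smooth_step_def F_def fun_eq_iff)
  moreover have "Ck_on n UNIV (F 1)"
  proof (rule Ck_on_coinduct[where P = "\<lambda>f. \<exists>p. f = F p"])
    fix f assume "\<exists>p. f = F p"
    then obtain p where f: "f = F p" by blast
    have "\<forall>t\<in>UNIV. (f has_derivative (\<lambda>v. F ([:0, 0, 1:] * (p - pderiv p)) t * v)) (at t)"
      using deriv[of p] by (simp add: has_field_derivative_def f)
    moreover have "(\<lambda>t. F ([:0, 0, 1:] * (p - pderiv p)) t * v) = F (smult v ([:0, 0, 1:] * (p - pderiv p)))" for v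
      by (auto simp: F_def)
    ultimately show "\<exists>D. (\<forall>x\<in>UNIV. (f has_derivative D x) (at x)) \<and> (\<forall>v. \<exists>p. (\<lambda>x. D x v) = F p)"
      by (intro exI[of _ "\<lambda>t v. F ([:0, 0, 1:] * (p - pderiv p)) t * v"]) auto
  qed auto
  ultimately show ?thesis by simp
qed

lemma smooth_step_nonneg: "0 \<le> smooth_step t"
  by (simp add: smooth_step_def)

text \<open>The value at 1 is exactly 1. Beyond 1 the function still grows, towards
  \<open>exp 1\<close>; only arguments up to 1 occur in \<open>log_cutoff\<close>.\<close>

lemma smooth_step_le_1: "t \<le> 1 \<Longrightarrow> smooth_step t \<le> 1"
  by (simp add: smooth_step_def)

text \<open>The derivative is continuous and vanishes on the negative axis, so compactness of
  \<open>{0..1}\<close> bounds it. The constant \<open>C\<close> ends up in the energy of the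
  logarithmic cutoffs.\<close>

lemma smooth_step_has_derivative:
  obtains D C where "\<And>t. (smooth_step has_real_derivative D t) (at t)"
    "\<And>t. t \<le> 0 \<Longrightarrow> D t = 0" "\<And>t. t \<le> 1 \<Longrightarrow> \<bar>D t\<bar> \<le> C" "0 \<le> C"
proof -
  define D where "D = (\<lambda>t. frechet_derivative smooth_step (at t) 1)"
  have der: "(smooth_step has_real_derivative D t) (at t)" for t
  proof -
    have "(smooth_step has_derivative frechet_derivative smooth_step (at t)) (at t)"
      by (rule Ck_on_Suc_has_derivative[OF Ck_on_smooth_step[of 1, unfolded One_nat_def]]) simp
    then show ?thesis
      unfolding has_field_derivative_def D_def
      by (metis (no_types, lifting) ext has_derivative_linear linear_cmul mult.right_neutral mult.commute
          real_scaleR_def)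
  qed
  have cont: "continuous_on UNIV D"
    using Ck_on_smooth_step[of 1] unfolding D_def by simp
  have neg: "D t = 0" if "t < 0" for t
  proof -
    have "((\<lambda>t. 0) has_real_derivative D t) (at t)"
      using der[of t]
      by (rule has_field_derivative_transform_within_open[where S = "{..<0}"])
        (use that in \<open>auto simp: smooth_step_def\<close>)
    then show ?thesis using DERIV_unique DERIV_const by blast
  qed
  have zero: "D 0 = 0"
  proof (rule tendsto_unique[of "at_left (0::real)"])
    show "(D \<longlongrightarrow> D 0) (at_left 0)"
      using cont by (simp add: continuous_on_def filterlim_at_split)
    show "(D \<longlongrightarrow> 0) (at_left 0)"
      by (rule tendsto_cong[THEN iffD1, OF _ tendsto_const]) (auto simp: neg eventually_at_filter)
  qed simp
  have "compact (D ` {0..1})"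
    by (rule compact_continuous_image[OF continuous_on_subset[OF cont]]) auto
  then have "bounded (D ` {0..1})"
    by (rule compact_imp_bounded)
  then obtain C where C: "\<And>t. t \<in> {0..1} \<Longrightarrow> \<bar>D t\<bar> \<le> C"
    unfolding bounded_iff by (metis imageI real_norm_def)
  show ?thesis
  proof
    show D0: "D t = 0" if "t \<le> 0" for t using that neg zero by (cases "t = 0") auto
    show "0 \<le> max C 0" by simp
    show "\<bar>D t\<bar> \<le> max C 0" if "t \<le> 1" for t
      using that D0[of t] C[of t] by (cases "t \<le> 0") auto
  qed (fact der)
qed

section \<open>Charts and the volume measure\<close>

text \<open>As soon as one side is finite, the change of variables for absolutely integrable
  functions applies and gives the other side the same value. Otherwise both sides are infinite.
  Energies may be infinite, hence this form without an integrability assumption.\<close>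

lemma nn_integral_change_of_variables:
  fixes T :: "real^2 \<Rightarrow> real^2" and f :: "real^2 \<Rightarrow> real"
  assumes S: "S \<in> sets borel"
    and der: "\<And>x. x \<in> S \<Longrightarrow> (T has_derivative T' x) (at x within S)"
    and inj: "inj_on T S"
    and nonneg: "\<And>y. y \<in> T ` S \<Longrightarrow> 0 \<le> f y"
    and meas_f: "(\<lambda>y. f y * indicator (T ` S) y) \<in> borel_measurable borel"
    and meas_T: "(\<lambda>x. \<bar>det (matrix (T' x))\<bar> * f (T x) * indicator S x) \<in> borel_measurable borel"
  shows "(\<integral>\<^sup>+y\<in>T ` S. ennreal (f y) \<partial>lborel) =
    (\<integral>\<^sup>+x\<in>S. ennreal (\<bar>det (matrix (T' x))\<bar> * f (T x)) \<partial>lborel)"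
proof -
  let ?h = "\<lambda>x. \<bar>det (matrix (T' x))\<bar> * f (T x)"
  have "S \<in> sets lebesgue" using S by auto
  \<comment> \<open>The theorem used here is about vector-valued functions; real ones enter it as
    functions into \<open>real^1\<close>.\<close>
  from has_absolute_integral_change_of_variables[OF this der inj, of "\<lambda>x. vec (f x) :: real^1" "vec r" for r]
  have iff: "?h absolutely_integrable_on S \<and> (?h has_integral r) S \<longleftrightarrow>
      f absolutely_integrable_on (T ` S) \<and> (f has_integral r) (T ` S)" for r
    unfolding integrable_on_1_iff integral_on_1_eq absolutely_integrable_on_1_iff absolutely_integrable_on_def
    by (auto simp: o_def integral_vec1_eq has_integral_iff)
  have hnn: "0 \<le> ?h x" if "x \<in> S" for x using nonneg that by auto
  have has: "(k has_integral r) X"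
    if "(\<lambda>y. k y * indicator X y) \<in> borel_measurable borel" "\<And>y. y \<in> X \<Longrightarrow> 0 \<le> k y"
      "(\<integral>\<^sup>+y\<in>X. ennreal (k y) \<partial>lborel) = ennreal r" "0 \<le> r" for k :: "real^2 \<Rightarrow> real" and X r
  proof -
    have "((\<lambda>y. k y * indicator X y) has_integral r) UNIV"
    proof (rule nn_integral_has_integral)
      show "(\<integral>\<^sup>+y. ennreal (k y * indicator X y) \<partial>lborel) = ennreal r"
        using that(3) by (simp add: ennreal_mult'[of "k y" for y] ennreal_indicator[symmetric] ennreal_mult'')
    qed (use that in \<open>auto simp: indicator_def\<close>)
    moreover have "(\<lambda>y. k y * indicator X y) = (\<lambda>y. if y \<in> X then k y else 0)"
      by (auto simp: indicator_def)
    ultimately show ?thesis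
      using has_integral_restrict_UNIV[of X k r] by simp
  qed
  have abs: "k absolutely_integrable_on X" if "(k has_integral r) X" "\<And>y. y \<in> X \<Longrightarrow> 0 \<le> k y"
    for k :: "real^2 \<Rightarrow> real" and X r
    using that absolutely_integrable_on_iff_nonneg has_integral_integrable by blast
  show ?thesis (is "?A = ?B")
  proof (cases "?A = \<infinity> \<and> ?B = \<infinity>")
    case False
    then consider r where "?A = ennreal r" "0 \<le> r" | r where "?B = ennreal r" "0 \<le> r"
      by (cases ?A; cases ?B) auto
    then show ?thesis
    proof cases
      case 1
      have "(f has_integral r) (T ` S)" by (rule has[OF meas_f nonneg 1])
      then have "(?h has_integral r) S"
        using iff abs nonneg by blast
      then have "?B = ennreal r"
        using nn_integral_has_integral_lebesgue'[of S ?h r] hnn by simp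
      then show ?thesis using 1 by simp
    next
      case 2
      have "(?h has_integral r) S" by (rule has[OF meas_T hnn 2])
      then have "(f has_integral r) (T ` S)"
        using iff abs[of ?h r S] hnn by blast
      then have "?A = ennreal r"
        using nn_integral_has_integral_lebesgue'[of "T ` S" f r] nonneg by simp
      then show ?thesis using 2 by simp
    qed
  qed simp
qed

lemma det_pos_def_2:
  fixes G :: "real^2^2"
  assumes "transpose G = G" "\<And>v. v \<noteq> 0 \<Longrightarrow> 0 < v \<bullet> (G *v v)"
  shows "0 < G $ 1 $ 1" "0 < det G"
proof -
  have sym: "G $ 1 $ 2 = G $ 2 $ 1"
    using arg_cong[OF assms(1), of "\<lambda>G. G $ 1 $ 2"] by (simp add: transpose_def)
  have q: "v \<bullet> (G *v v) = G $ 1 $ 1 * (v $ 1)\<^sup>2 + 2 * G $ 1 $ 2 * v $ 1 * v $ 2 + G $ 2 $ 2 * (v $ 2)\<^sup>2" for v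
    by (simp add: inner_vec_def matrix_vector_mult_def sum_2 sym power2_eq_square algebra_simps)
  have "vector [1, 0] \<noteq> (0 :: real^2)" by (simp add: vec_eq_iff forall_2)
  from assms(2)[OF this] show a: "0 < G $ 1 $ 1" by (simp add: q)
  \<comment> \<open>On this vector the form takes the value
    \<open>G $ 1 $ 1 * det G\<close>.\<close>
  have "vector [- (G $ 1 $ 2), G $ 1 $ 1] \<noteq> (0 :: real^2)" using a by (simp add: vec_eq_iff forall_2)
  from assms(2)[OF this] have "0 < G $ 1 $ 1 * det G"
    by (simp add: q det_2 sym power2_eq_square algebra_simps)
  then show "0 < det G" using a zero_less_mult_pos by blast
qed

text \<open>The form determines its matrix, so \<open>G\<close> is the product of the transpose of
  \<open>matrix D\<close>, \<open>G'\<close> and \<open>matrix D\<close>. The square root of the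
  conclusion is the transformation rule of the area density.\<close>

lemma det_pullback:
  fixes G G' :: "real^2^2"
  assumes "linear D" "\<And>v w. v \<bullet> (G *v w) = D v \<bullet> (G' *v D w)"
  shows "det G = (det (matrix D))\<^sup>2 * det G'"
proof -
  have "v \<bullet> (G *v w) = v \<bullet> ((transpose (matrix D) ** G' ** matrix D) *v w)" for v w
  proof -
    have "v \<bullet> (G *v w) = (matrix D *v v) \<bullet> (G' *v (matrix D *v w))"
      using assms(2)[of v w] by (simp only: matrix_works[OF assms(1)[folded linear_matrix_vector_mul_eq]])
    also have "\<dots> = v \<bullet> ((transpose (matrix D) ** G' ** matrix D) *v w)"
      by (simp add: dot_lmul_matrix matrix_vector_mul_assoc[symmetric] flip: transpose_matrix_vector)
        (metis dot_lmul_matrix inner_commute transpose_matrix_vector)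
    finally show ?thesis .
  qed
  then have "G *v w = (transpose (matrix D) ** G' ** matrix D) *v w" for w
    by (metis vector_eq_ldot)
  then have "G = transpose (matrix D) ** G' ** matrix D"
    by (simp add: matrix_eq)
  then show ?thesis
    by (simp add: det_mul det_transpose power2_eq_square)
qed

lemma closed_half_plane: "closed half_plane"
  unfolding half_plane_def by (intro closed_Collect_le continuous_intros)

lemma half_plane_borel: "half_plane \<in> sets borel"
  by (simp add: closed_half_plane)

lemma openin_borel:
  assumes "openin (top_of_set X) V" "X \<in> sets borel"
  shows "V \<in> sets borel"
  using assms by (auto simp: openin_open)

lemma smooth_on_continuous_on:
  assumes "smooth_on S f"
  shows "continuous_on S f"
  unfolding continuous_on_eq_continuous_within
proof
  fix x assume x: "x \<in> S"
  then obtain W h where W: "open W" "x \<in> W" "\<And>n. Ck_on n W h" "\<And>y. y \<in> W \<inter> S \<Longrightarrow> h y = f y"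
    using assms unfolding smooth_on_def by meson
  have "continuous_on W h" using W(3)[of 0] by simp
  then have "isCont h x" using W(1,2) continuous_on_eq_continuous_at by blast
  then have "(h \<longlongrightarrow> f x) (at x within S)"
    using continuous_at_imp_continuous_within[of x h S] W(2,4) x by (auto simp: continuous_within)
  then have "(f \<longlongrightarrow> f x) (at x within S)"
    by (rule Lim_transform_within_openin[where S = "S \<inter> W"])
      (use W x in \<open>auto simp: openin_open_Int\<close>)
  then show "continuous (at x within S) f"
    by (simp add: continuous_within)
qed

section \<open>Compact Riemannian surfaces and their volume measure\<close>

locale riemannian_surface =
  fixes M :: "'a::topological_space set" and \<A> :: "'a chart set" and g :: "'a metric_comps"
  assumes smooth_surface: "smooth_surface M \<A>"
    and compact: "compact M"
    and riemannian_metric: "riemannian_metric \<A> g"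
begin

abbreviation "borel_M \<equiv> restrict_space borel M"

lemma is_chart: "\<kappa> \<in> \<A> \<Longrightarrow> is_chart M \<kappa>"
  using smooth_surface by (simp add: smooth_surface_def)

lemma chart_openin: "\<kappa> \<in> \<A> \<Longrightarrow> openin (top_of_set M) (fst \<kappa>)"
  using is_chart by (simp add: is_chart_def)

lemma chart_subset: "\<kappa> \<in> \<A> \<Longrightarrow> fst \<kappa> \<subseteq> M"
  using chart_openin openin_imp_subset by blast

lemma chart_homeo:
  "\<kappa> \<in> \<A> \<Longrightarrow> homeomorphism (fst \<kappa>) (snd \<kappa> ` fst \<kappa>) (snd \<kappa>) (chart_inv \<kappa>)"
  using is_chart by (simp add: is_chart_def)

lemma chart_inj: "\<kappa> \<in> \<A> \<Longrightarrow> inj_on (snd \<kappa>) (fst \<kappa>)"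
  by (meson chart_homeo homeomorphism_apply1 inj_on_inverseI)

lemma chart_inv_snd: "\<kappa> \<in> \<A> \<Longrightarrow> x \<in> fst \<kappa> \<Longrightarrow> chart_inv \<kappa> (snd \<kappa> x) = x"
  by (meson chart_homeo homeomorphism_apply1)

lemma chart_openin_half_plane:
  "\<kappa> \<in> \<A> \<Longrightarrow> openin (top_of_set half_plane) (snd \<kappa> ` fst \<kappa>)"
  using is_chart by (simp add: is_chart_def)

lemma openin_image_half_plane:
  assumes "\<kappa> \<in> \<A>" "openin (top_of_set M) V" "V \<subseteq> fst \<kappa>"
  shows "openin (top_of_set half_plane) (snd \<kappa> ` V)"
proof -
  have "openin (top_of_set (fst \<kappa>)) V"
    by (rule openin_subset_trans[OF assms(2,3) chart_subset[OF assms(1)]])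
  then have "openin (top_of_set (snd \<kappa> ` fst \<kappa>)) (snd \<kappa> ` V)"
    by (rule homeomorphism_imp_open_map[OF chart_homeo[OF assms(1)]])
  then show ?thesis
    by (rule openin_trans[OF _ chart_openin_half_plane[OF assms(1)]])
qed

lemma sets_borel_M_openin:
  assumes "openin (top_of_set M) V"
  shows "V \<in> sets borel_M"
proof -
  obtain T where "open T" "V = M \<inter> T" using assms unfolding openin_open by blast
  then show ?thesis unfolding sets_restrict_space using borel_open by blast
qed

lemma sets_borel_M_chart: "\<kappa> \<in> \<A> \<Longrightarrow> fst \<kappa> \<in> sets borel_M"
  by (rule sets_borel_M_openin[OF chart_openin])

lemma sets_image_chart:
  assumes "\<kappa> \<in> \<A>" "B \<in> sets borel_M" "B \<subseteq> fst \<kappa>"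
  shows "snd \<kappa> ` B \<in> sets borel"
proof -
  obtain B' where B': "B' \<in> sets borel" "B = M \<inter> B'"
    using assms(2) by (auto simp: sets_restrict_space)
  have "chart_inv \<kappa> \<in> measurable (restrict_space borel (snd \<kappa> ` fst \<kappa>)) borel"
    by (rule borel_measurable_continuous_on_restrict[OF homeomorphism_cont2[OF chart_homeo[OF assms(1)]]])
  from measurable_sets[OF this B'(1)]
  have "chart_inv \<kappa> -` B' \<inter> snd \<kappa> ` fst \<kappa> \<in> sets borel"
    using openin_borel[OF chart_openin_half_plane[OF assms(1)] half_plane_borel]
    by (simp add: space_restrict_space sets_restrict_space_iff)
  moreover have "chart_inv \<kappa> -` B' \<inter> snd \<kappa> ` fst \<kappa> = snd \<kappa> ` B"
    using assms(3) B'(2) chart_inv_snd[OF assms(1)] chart_subset[OF assms(1)] by fastforce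
  ultimately show ?thesis by simp
qed

lemma measurable_chart:
  assumes "\<kappa> \<in> \<A>"
  shows "snd \<kappa> \<in> measurable (restrict_space borel_M (fst \<kappa>)) borel"
proof -
  have "sets (restrict_space borel_M (fst \<kappa>)) = sets (restrict_space borel (fst \<kappa>))"
    using chart_subset[OF assms] by (simp add: sets_restrict_restrict_space Int_absorb1)
  then show ?thesis
    using borel_measurable_continuous_on_restrict[OF homeomorphism_cont1[OF chart_homeo[OF assms]]]
    by (simp cong: measurable_cong_sets)
qed

lemma sets_vimage_chart:
  assumes "\<kappa> \<in> \<A>" "C \<in> sets borel"
  shows "{x \<in> fst \<kappa>. snd \<kappa> x \<in> C} \<in> sets borel_M"
proof -
  have "snd \<kappa> -` C \<inter> space (restrict_space borel_M (fst \<kappa>)) \<in> sets (restrict_space borel_M (fst \<kappa>))"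
    by (rule measurable_sets[OF measurable_chart[OF assms(1)] assms(2)])
  moreover have "snd \<kappa> -` C \<inter> space (restrict_space borel_M (fst \<kappa>)) = {x \<in> fst \<kappa>. snd \<kappa> x \<in> C}"
    using chart_subset[OF assms(1)] by (auto simp: space_restrict_space)
  moreover have "fst \<kappa> \<inter> space borel_M \<in> sets borel_M"
    using sets_borel_M_chart[OF assms(1)] by blast
  ultimately show ?thesis
    by (simp add: sets_restrict_space_iff)
qed

definition area_density :: "'a chart \<Rightarrow> real^2 \<Rightarrow> real" where
  "area_density \<kappa> p = sqrt (det (g \<kappa> p))"

lemma metric_symmetric: "\<kappa> \<in> \<A> \<Longrightarrow> x \<in> fst \<kappa> \<Longrightarrow> transpose (g \<kappa> (snd \<kappa> x)) = g \<kappa> (snd \<kappa> x)"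
  using riemannian_metric by (simp add: riemannian_metric_def)

lemma metric_positive:
  "\<kappa> \<in> \<A> \<Longrightarrow> x \<in> fst \<kappa> \<Longrightarrow> v \<noteq> 0 \<Longrightarrow> 0 < v \<bullet> (g \<kappa> (snd \<kappa> x) *v v)"
  using riemannian_metric by (simp add: riemannian_metric_def)

lemma metric_transition:
  assumes "\<kappa> \<in> \<A>" "\<kappa>' \<in> \<A>" "x \<in> fst \<kappa> \<inter> fst \<kappa>'"
    "((snd \<kappa>' \<circ> chart_inv \<kappa>) has_derivative D) (at (snd \<kappa> x) within snd \<kappa> ` (fst \<kappa> \<inter> fst \<kappa>'))"
  shows "v \<bullet> (g \<kappa> (snd \<kappa> x) *v w) = D v \<bullet> (g \<kappa>' (snd \<kappa>' x) *v D w)"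
  using riemannian_metric assms unfolding riemannian_metric_def by blast

lemma continuous_on_metric: "\<kappa> \<in> \<A> \<Longrightarrow> continuous_on (snd \<kappa> ` fst \<kappa>) (g \<kappa>)"
  using riemannian_metric unfolding riemannian_metric_def by (intro smooth_on_continuous_on) blast

lemma continuous_on_metric_det:
  assumes "\<kappa> \<in> \<A>"
  shows "continuous_on (snd \<kappa> ` fst \<kappa>) (\<lambda>p. det (g \<kappa> p))"
proof -
  have "continuous_on (snd \<kappa> ` fst \<kappa>) (\<lambda>p. g \<kappa> p $ i $ j)" for i j
    by (rule continuous_on_component[OF continuous_on_component[OF continuous_on_metric[OF assms]]])
  then show ?thesis
    unfolding det_2 by (intro continuous_on_diff continuous_on_mult)
qed

lemma continuous_on_area_density: "\<kappa> \<in> \<A> \<Longrightarrow> continuous_on (snd \<kappa> ` fst \<kappa>) (area_density \<kappa>)"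
  unfolding area_density_def by (rule continuous_on_real_sqrt[OF continuous_on_metric_det])

lemma metric_det_pos: "\<kappa> \<in> \<A> \<Longrightarrow> x \<in> fst \<kappa> \<Longrightarrow> 0 < det (g \<kappa> (snd \<kappa> x))"
  by (rule det_pos_def_2(2)[OF metric_symmetric metric_positive])

lemma area_density_nonneg: "\<kappa> \<in> \<A> \<Longrightarrow> p \<in> snd \<kappa> ` fst \<kappa> \<Longrightarrow> 0 \<le> area_density \<kappa> p"
  unfolding area_density_def using metric_det_pos by (metis imageE less_imp_le real_sqrt_ge_0_iff)

lemma borel_measurable_area_density:
  assumes "\<kappa> \<in> \<A>" "S \<in> sets borel" "S \<subseteq> snd \<kappa> ` fst \<kappa>"
  shows "(\<lambda>p. area_density \<kappa> p * indicator S p) \<in> borel_measurable borel"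
  using borel_measurable_continuous_on_indicator[OF assms(2)
      continuous_on_subset[OF continuous_on_area_density[OF assms(1)] assms(3)]]
  by (simp add: mult.commute)

lemma transition_has_derivative:
  assumes "\<kappa> \<in> \<A>" "\<kappa>' \<in> \<A>" "x \<in> fst \<kappa> \<inter> fst \<kappa>'"
  obtains D where "((snd \<kappa>' \<circ> chart_inv \<kappa>) has_derivative D)
    (at (snd \<kappa> x) within snd \<kappa> ` (fst \<kappa> \<inter> fst \<kappa>'))"
proof -
  let ?S = "snd \<kappa> ` (fst \<kappa> \<inter> fst \<kappa>')" and ?T = "snd \<kappa>' \<circ> chart_inv \<kappa>"
  have "smooth_on ?S ?T" "snd \<kappa> x \<in> ?S"
    using smooth_surface assms by (auto simp: smooth_surface_def)
  then obtain W h where W: "open W" "snd \<kappa> x \<in> W" "\<And>n. Ck_on n W h" "\<And>y. y \<in> W \<inter> ?S \<Longrightarrow> h y = ?T y"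
    unfolding smooth_on_def by meson
  have "(h has_derivative frechet_derivative h (at (snd \<kappa> x))) (at (snd \<kappa> x))"
    by (rule Ck_on_Suc_has_derivative[OF W(3)[of "Suc 0"] W(2)])
  then have "(h has_derivative frechet_derivative h (at (snd \<kappa> x))) (at (snd \<kappa> x) within ?S)"
    by (rule has_derivative_at_withinI)
  then have "(?T has_derivative frechet_derivative h (at (snd \<kappa> x))) (at (snd \<kappa> x) within ?S)"
    by (rule has_derivative_transform_eventually)
      (use W \<open>snd \<kappa> x \<in> ?S\<close> in \<open>auto simp: eventually_at_topological\<close>)
  then show thesis by (rule that)
qed

text \<open>By \<open>det_pullback\<close> the Jacobian of the transition map is the quotient of the
  two densities. This is the compatibility that makes the volume well defined. Derivatives are taken
  within the image of the overlap, so that points on the edge of the half-plane are covered.\<close>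

lemma nn_integral_area_density_eq:
  assumes "\<kappa> \<in> \<A>" "\<kappa>' \<in> \<A>" "B \<in> sets borel_M" "B \<subseteq> fst \<kappa> \<inter> fst \<kappa>'"
  shows "(\<integral>\<^sup>+p\<in>snd \<kappa>' ` B. ennreal (area_density \<kappa>' p) \<partial>lborel) =
    (\<integral>\<^sup>+p\<in>snd \<kappa> ` B. ennreal (area_density \<kappa> p) \<partial>lborel)"
proof -
  let ?T = "snd \<kappa>' \<circ> chart_inv \<kappa>"
  have "\<exists>D. \<forall>p\<in>snd \<kappa> ` B. (?T has_derivative D p) (at p within snd \<kappa> ` (fst \<kappa> \<inter> fst \<kappa>'))"
  proof (rule bchoice, safe)
    fix x assume "x \<in> B"
    then show "\<exists>D. (?T has_derivative D) (at (snd \<kappa> x) within snd \<kappa> ` (fst \<kappa> \<inter> fst \<kappa>'))"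
      using transition_has_derivative[OF assms(1,2), of x] assms(4) by blast
  qed
  then obtain D where D: "\<And>x. x \<in> B \<Longrightarrow>
      (?T has_derivative D (snd \<kappa> x)) (at (snd \<kappa> x) within snd \<kappa> ` (fst \<kappa> \<inter> fst \<kappa>'))"
    by blast
  have T: "?T (snd \<kappa> x) = snd \<kappa>' x" if "x \<in> B" for x
    using that assms chart_inv_snd by auto
  then have img: "?T ` (snd \<kappa> ` B) = snd \<kappa>' ` B"
    by (force simp: image_iff)
  have dens: "\<bar>det (matrix (D p))\<bar> * area_density \<kappa>' (?T p) = area_density \<kappa> p" if "p \<in> snd \<kappa> ` B" for p
  proof -
    obtain x where x: "x \<in> B" "p = snd \<kappa> x" using \<open>p \<in> snd \<kappa> ` B\<close> by blast
    have "det (g \<kappa> (snd \<kappa> x)) = (det (matrix (D p)))\<^sup>2 * det (g \<kappa>' (snd \<kappa>' x))"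
      by (rule det_pullback[OF has_derivative_linear[OF D[OF x(1)], folded x(2)]])
        (use metric_transition[OF assms(1,2) _ D[OF x(1)]] x assms(4) in auto)
    then show ?thesis
      unfolding area_density_def by (simp only: x T real_sqrt_mult real_sqrt_abs)
  qed
  have imgs: "snd \<kappa> ` B \<in> sets borel" "snd \<kappa>' ` B \<in> sets borel"
    using assms by (auto intro!: sets_image_chart)
  have "(\<integral>\<^sup>+p\<in>?T ` (snd \<kappa> ` B). ennreal (area_density \<kappa>' p) \<partial>lborel) =
    (\<integral>\<^sup>+p\<in>snd \<kappa> ` B. ennreal (\<bar>det (matrix (D p))\<bar> * area_density \<kappa>' (?T p)) \<partial>lborel)"
  proof (rule nn_integral_change_of_variables[OF imgs(1)])
    show "(?T has_derivative D p) (at p within snd \<kappa> ` B)" if "p \<in> snd \<kappa> ` B" for p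
    proof -
      obtain x where x: "x \<in> B" "p = snd \<kappa> x" using \<open>p \<in> snd \<kappa> ` B\<close> by blast
      show ?thesis
        unfolding x(2) by (rule has_derivative_subset[OF D[OF x(1)] image_mono[OF assms(4)]])
    qed
    show "inj_on ?T (snd \<kappa> ` B)"
    proof (rule inj_onI, safe)
      fix x y assume "x \<in> B" "y \<in> B" "?T (snd \<kappa> x) = ?T (snd \<kappa> y)"
      then have "snd \<kappa>' x = snd \<kappa>' y" "x \<in> fst \<kappa>'" "y \<in> fst \<kappa>'"
        using T[of x] T[of y] assms(4) by auto
      then have "x = y"
        by (rule inj_onD[OF chart_inj[OF assms(2)]])
      then show "snd \<kappa> x = snd \<kappa> y" by simp
    qed
    show "0 \<le> area_density \<kappa>' p" if "p \<in> ?T ` snd \<kappa> ` B" for p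
      using area_density_nonneg[OF assms(2)] that assms(4) unfolding img by blast
    show "(\<lambda>p. area_density \<kappa>' p * indicator (?T ` snd \<kappa> ` B) p) \<in> borel_measurable borel"
      unfolding img
      by (rule borel_measurable_area_density[OF assms(2) imgs(2) image_mono]) (use assms(4) in blast)
    have "(\<lambda>p. \<bar>det (matrix (D p))\<bar> * area_density \<kappa>' (?T p) * indicator (snd \<kappa> ` B) p) =
        (\<lambda>p. area_density \<kappa> p * indicator (snd \<kappa> ` B) p)"
    proof
      fix p
      show "\<bar>det (matrix (D p))\<bar> * area_density \<kappa>' (?T p) * indicator (snd \<kappa> ` B) p =
          area_density \<kappa> p * indicator (snd \<kappa> ` B) p"
      proof (cases "p \<in> snd \<kappa> ` B")
        case True
        then show ?thesis by (simp only: dens)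
      next
        case False
        then have "indicator (snd \<kappa> ` B) p = (0 :: real)" by (rule indicator_simps(2))
        then show ?thesis by (simp only: mult_zero_right)
      qed
    qed
    then show "(\<lambda>p. \<bar>det (matrix (D p))\<bar> * area_density \<kappa>' (?T p) * indicator (snd \<kappa> ` B) p)
        \<in> borel_measurable borel"
      using borel_measurable_area_density[OF assms(1) imgs(1) image_mono] assms(4) by simp
  qed
  also have "\<dots> = (\<integral>\<^sup>+p\<in>snd \<kappa> ` B. ennreal (area_density \<kappa> p) \<partial>lborel)"
  proof (rule nn_integral_cong)
    show "ennreal (\<bar>det (matrix (D p))\<bar> * area_density \<kappa>' (?T p)) * indicator (snd \<kappa> ` B) p =
        ennreal (area_density \<kappa> p) * indicator (snd \<kappa> ` B) p" for p
    proof (cases "p \<in> snd \<kappa> ` B")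
      case True
      then show ?thesis by (simp only: dens)
    next
      case False
      then have "indicator (snd \<kappa> ` B) p = (0 :: ennreal)" by (rule indicator_simps(2))
      then show ?thesis by (simp only: mult_zero_right)
    qed
  qed
  finally show ?thesis
    unfolding img .
qed

definition area_measure :: "'a chart \<Rightarrow> (real^2) measure" where
  "area_measure \<kappa> = density lborel (\<lambda>p. ennreal (area_density \<kappa> p * indicator (snd \<kappa> ` fst \<kappa>) p))"

lemma sets_area_measure: "sets (area_measure \<kappa>) = sets borel"
  by (simp add: area_measure_def)

lemma borel_measurable_area_density_chart:
  "\<kappa> \<in> \<A> \<Longrightarrow> (\<lambda>p. ennreal (area_density \<kappa> p * indicator (snd \<kappa> ` fst \<kappa>) p)) \<in> borel_measurable lborel"
  using borel_measurable_area_density[OF _ sets_image_chart[OF _ sets_borel_M_chart order_refl] order_refl]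
  by (auto intro!: measurable_ennreal)

lemma emeasure_area_measure:
  assumes "\<kappa> \<in> \<A>" "C \<in> sets borel"
  shows "emeasure (area_measure \<kappa>) C = (\<integral>\<^sup>+p\<in>C \<inter> snd \<kappa> ` fst \<kappa>. ennreal (area_density \<kappa> p) \<partial>lborel)"
proof -
  have "emeasure (area_measure \<kappa>) C =
      (\<integral>\<^sup>+p\<in>C. ennreal (area_density \<kappa> p * indicator (snd \<kappa> ` fst \<kappa>) p) \<partial>lborel)"
    unfolding area_measure_def
    by (rule emeasure_density) (use borel_measurable_area_density_chart[OF assms(1)] assms(2) in simp_all)
  also have "\<dots> = (\<integral>\<^sup>+p\<in>C \<inter> snd \<kappa> ` fst \<kappa>. ennreal (area_density \<kappa> p) \<partial>lborel)"
    by (rule nn_integral_cong) (simp add: indicator_def)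
  finally show ?thesis .
qed

lemma emeasure_area_measure_image:
  assumes "\<kappa> \<in> \<A>" "B \<in> sets borel_M" "B \<subseteq> fst \<kappa>"
  shows "emeasure (area_measure \<kappa>) (snd \<kappa> ` B) = (\<integral>\<^sup>+p\<in>snd \<kappa> ` B. ennreal (area_density \<kappa> p) \<partial>lborel)"
proof -
  have "snd \<kappa> ` B \<inter> snd \<kappa> ` fst \<kappa> = snd \<kappa> ` B" using assms(3) by blast
  then show ?thesis
    using emeasure_area_measure[OF assms(1) sets_image_chart[OF assms]] by simp
qed

lemma finite_chart_cover:
  obtains F where "finite F" "F \<subseteq> \<A>" "M = (\<Union>\<kappa>\<in>F. fst \<kappa>)"
proof -
  have "\<forall>\<kappa>\<in>\<A>. \<exists>T. open T \<and> fst \<kappa> = M \<inter> T"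
    using chart_openin unfolding openin_open by blast
  then obtain T where T: "\<And>\<kappa>. \<kappa> \<in> \<A> \<Longrightarrow> open (T \<kappa>)" "\<And>\<kappa>. \<kappa> \<in> \<A> \<Longrightarrow> fst \<kappa> = M \<inter> T \<kappa>"
    by metis
  have cov: "(\<Union>\<kappa>\<in>\<A>. fst \<kappa>) = M" using smooth_surface by (simp add: smooth_surface_def)
  then have "M \<subseteq> (\<Union>\<kappa>\<in>\<A>. T \<kappa>)" using T(2) by blast
  then obtain F where F: "F \<subseteq> \<A>" "finite F" "M \<subseteq> (\<Union>\<kappa>\<in>F. T \<kappa>)"
    using compactE_image[OF compact, of \<A> T] T(1) by blast
  have "M = (\<Union>\<kappa>\<in>F. fst \<kappa>)"
  proof
    show "M \<subseteq> (\<Union>\<kappa>\<in>F. fst \<kappa>)"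
    proof
      fix x assume "x \<in> M"
      then obtain \<kappa> where "\<kappa> \<in> F" "x \<in> T \<kappa>" using F(3) by blast
      then show "x \<in> (\<Union>\<kappa>\<in>F. fst \<kappa>)" using T(2)[of \<kappa>] F(1) \<open>x \<in> M\<close> by blast
    qed
    show "(\<Union>\<kappa>\<in>F. fst \<kappa>) \<subseteq> M" using F(1) chart_subset by blast
  qed
  then show thesis using that F by blast
qed

lemma emeasure_eq_sum_pieces:
  fixes n :: nat
  assumes "sets \<nu> = sets borel_M" "\<And>i. i < n \<Longrightarrow> P i \<in> sets borel_M"
    and "disjoint_family_on P {..<n}" "M = (\<Union>i<n. P i)" "B \<in> sets borel_M"
  shows "emeasure \<nu> B = (\<Sum>i<n. emeasure \<nu> (B \<inter> P i))"
proof -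
  have "B \<subseteq> M" using assms(5) by (auto simp: sets_restrict_space)
  then have "B = (\<Union>i<n. B \<inter> P i)" using assms(4) by blast
  moreover have "(\<Sum>i<n. emeasure \<nu> (B \<inter> P i)) = emeasure \<nu> (\<Union>i<n. B \<inter> P i)"
  proof (rule sum_emeasure)
    show "disjoint_family_on (\<lambda>i. B \<inter> P i) {..<n}"
      by (rule disjoint_family_on_bisimulation[OF assms(3)]) blast
    show "(\<lambda>i. B \<inter> P i) ` {..<n} \<subseteq> sets \<nu>"
      unfolding assms(1) using assms(2,5) by blast
  qed simp
  ultimately show ?thesis by simp
qed

text \<open>\<open>volume_measure\<close> is a definite description and has no usable property
  before this. For existence, \<open>M\<close> is cut into finitely many disjoint Borel pieces, each
  inside one chart; the area measures of the pieces are carried to \<open>M\<close> and added.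
  Uniqueness holds because the values on subsets of the pieces are prescribed.\<close>

lemma ex1_volume_measure: "\<exists>!\<nu>. is_volume_measure M \<A> g \<nu>"
proof -
  obtain F where F: "finite F" "F \<subseteq> \<A>" "M = (\<Union>\<kappa>\<in>F. fst \<kappa>)"
    by (rule finite_chart_cover)
  obtain n :: nat and \<kappa> where \<kappa>: "F = \<kappa> ` {..<n}"
    using F(1) by (metis finite_imp_nat_seg_image_inj_on lessThan_def)
  define P where "P = (\<lambda>i. fst (\<kappa> i) - (\<Union>j<i. fst (\<kappa> j)))"
  have \<kappa>A: "\<kappa> i \<in> \<A>" if "i < n" for i using that F(2) \<kappa> by auto
  have P_sets: "P i \<in> sets borel_M" if "i < n" for i
  proof -
    have "(\<Union>j<i. fst (\<kappa> j)) \<in> sets borel_M"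
      using that sets_borel_M_chart \<kappa>A by (intro sets.finite_UN) auto
    then show ?thesis
      unfolding P_def by (rule sets.Diff[OF sets_borel_M_chart[OF \<kappa>A[OF that]]])
  qed
  have P_disj: "disjoint_family_on P {..<n}"
    unfolding disjoint_family_on_def
  proof (intro ballI impI)
    fix i j :: nat assume "i \<noteq> j"
    then show "P i \<inter> P j = {}"
      by (cases i j rule: linorder_cases) (auto simp: P_def)
  qed
  have P_un: "M = (\<Union>i<n. P i)"
  proof
    show "M \<subseteq> (\<Union>i<n. P i)"
    proof
      fix x assume "x \<in> M"
      then have ex: "\<exists>i. i < n \<and> x \<in> fst (\<kappa> i)" using F(3) \<kappa> by auto
      define i where "i = (LEAST i. i < n \<and> x \<in> fst (\<kappa> i))"
      have "i < n \<and> x \<in> fst (\<kappa> i)" unfolding i_def by (rule LeastI_ex[OF ex])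
      moreover have "x \<notin> fst (\<kappa> j)" if "j < i" for j
        using not_less_Least[OF that[unfolded i_def]] that calculation by auto
      ultimately show "x \<in> (\<Union>i<n. P i)" by (auto simp: P_def)
    qed
  qed (use F(3) \<kappa> in \<open>auto simp: P_def\<close>)
  define N where "N = (\<lambda>i. distr (restrict_space (area_measure (\<kappa> i)) (snd (\<kappa> i) ` P i)) borel_M (chart_inv (\<kappa> i)))"
  have P_sub: "P i \<subseteq> fst (\<kappa> i)" for i by (auto simp: P_def)
  have N: "emeasure (N i) B = emeasure (area_measure (\<kappa> i)) (snd (\<kappa> i) ` (B \<inter> P i))"
    if "i < n" "B \<in> sets borel_M" for i B
  proof -
    let ?S = "snd (\<kappa> i) ` P i"
    have S: "?S \<in> sets borel"
      by (rule sets_image_chart[OF \<kappa>A[OF that(1)] P_sets[OF that(1)] P_sub])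
    have inv: "chart_inv (\<kappa> i) (snd (\<kappa> i) x) = x" if "x \<in> P i" for x
      using chart_inv_snd[OF \<kappa>A[OF \<open>i < n\<close>]] that P_sub by blast
    have vim: "chart_inv (\<kappa> i) -` C \<inter> ?S = snd (\<kappa> i) ` (C \<inter> P i)" for C
    proof
      show "chart_inv (\<kappa> i) -` C \<inter> ?S \<subseteq> snd (\<kappa> i) ` (C \<inter> P i)"
      proof
        fix p assume "p \<in> chart_inv (\<kappa> i) -` C \<inter> ?S"
        then obtain x where x: "x \<in> P i" "p = snd (\<kappa> i) x" "chart_inv (\<kappa> i) p \<in> C" by blast
        then have "x \<in> C \<inter> P i" using inv[OF x(1)] by simp
        then show "p \<in> snd (\<kappa> i) ` (C \<inter> P i)" unfolding x(2) by (rule imageI)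
      qed
      show "snd (\<kappa> i) ` (C \<inter> P i) \<subseteq> chart_inv (\<kappa> i) -` C \<inter> ?S"
        using inv by auto
    qed
    have m: "chart_inv (\<kappa> i) \<in> measurable (restrict_space (area_measure (\<kappa> i)) ?S) borel_M"
    proof (rule measurableI)
      show "chart_inv (\<kappa> i) p \<in> space borel_M" if p: "p \<in> space (restrict_space (area_measure (\<kappa> i)) ?S)" for p
      proof -
        obtain x where "x \<in> P i" "p = snd (\<kappa> i) x"
          using p unfolding space_restrict_space by blast
        then show ?thesis
          using inv P_sub[of i] chart_subset[OF \<kappa>A[OF \<open>i < n\<close>]] by (auto simp: space_restrict_space)
      qed
      show "chart_inv (\<kappa> i) -` C \<inter> space (restrict_space (area_measure (\<kappa> i)) ?S)
          \<in> sets (restrict_space (area_measure (\<kappa> i)) ?S)" if "C \<in> sets borel_M" for C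
      proof -
        have "snd (\<kappa> i) ` (C \<inter> P i) \<in> sets borel"
          by (rule sets_image_chart[OF \<kappa>A[OF \<open>i < n\<close>] sets.Int[OF that P_sets[OF \<open>i < n\<close>]]])
            (use P_sub in blast)
        then show ?thesis
          using S by (simp add: space_restrict_space vim sets_restrict_space_iff image_mono sets_area_measure
              sets_eq_imp_space_eq[OF sets_area_measure])
      qed
    qed
    have "emeasure (N i) B = emeasure (restrict_space (area_measure (\<kappa> i)) ?S)
        (chart_inv (\<kappa> i) -` B \<inter> space (restrict_space (area_measure (\<kappa> i)) ?S))"
      unfolding N_def by (rule emeasure_distr[OF m that(2)])
    also have "chart_inv (\<kappa> i) -` B \<inter> space (restrict_space (area_measure (\<kappa> i)) ?S) = snd (\<kappa> i) ` (B \<inter> P i)"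
      by (simp add: space_restrict_space vim sets_eq_imp_space_eq[OF sets_area_measure])
    also have "emeasure (restrict_space (area_measure (\<kappa> i)) ?S) \<dots> = emeasure (area_measure (\<kappa> i)) (snd (\<kappa> i) ` (B \<inter> P i))"
      by (rule emeasure_restrict_space) (use S in \<open>auto simp: sets_area_measure sets_eq_imp_space_eq[OF sets_area_measure]\<close>)
    finally show ?thesis .
  qed
  have N_sets: "sets (N i) = sets borel_M" for i by (simp add: N_def)
  define \<nu> where "\<nu> = measure_of M (sets borel_M) (\<lambda>B. \<Sum>i<n. emeasure (N i) B)"
  have alg: "sigma_algebra M (sets borel_M)"
    using sets.sigma_algebra_axioms[of borel_M] by (simp add: space_restrict_space)
  have \<nu>_sets: "sets \<nu> = sets borel_M"
    unfolding \<nu>_def by (rule sigma_algebra.sets_measure_of_eq[OF alg])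
  have \<nu>: "emeasure \<nu> B = (\<Sum>i<n. emeasure (N i) B)" if "B \<in> sets borel_M" for B
  proof (rule emeasure_measure_of[OF \<nu>_def])
    show "sets borel_M \<subseteq> Pow M" by (auto simp: sets_restrict_space)
    show "B \<in> sets \<nu>" using that \<nu>_sets by simp
    show "positive (sets \<nu>) (\<lambda>B. \<Sum>i<n. emeasure (N i) B)" by (simp add: positive_def)
    show "countably_additive (sets \<nu>) (\<lambda>B. \<Sum>i<n. emeasure (N i) B)"
    proof (rule countably_additiveI)
      fix X :: "nat \<Rightarrow> 'a set" assume X: "range X \<subseteq> sets \<nu>" "disjoint_family X"
      have "(\<Sum>k. \<Sum>i<n. emeasure (N i) (X k)) = (\<Sum>i<n. \<Sum>k. emeasure (N i) (X k))"
        by (rule suminf_sum) auto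
      also have "\<dots> = (\<Sum>i<n. emeasure (N i) (\<Union>k. X k))"
        using X by (intro sum.cong suminf_emeasure) (auto simp: N_sets \<nu>_sets)
      finally show "(\<Sum>k. \<Sum>i<n. emeasure (N i) (X k)) = (\<Sum>i<n. emeasure (N i) (\<Union>k. X k))" .
    qed
  qed
  show ?thesis
  proof
    show "is_volume_measure M \<A> g \<nu>"
      unfolding is_volume_measure_def
    proof (intro conjI ballI impI)
      fix \<kappa>' B assume *: "\<kappa>' \<in> \<A>" "B \<in> sets \<nu>" "B \<subseteq> fst \<kappa>'"
      then have B: "B \<in> sets borel_M" by (simp add: \<nu>_sets)
      \<comment> \<open>The piece \<open>P i\<close> was measured in its own chart
        \<open>\<kappa> i\<close>. The part of \<open>B\<close> in it lies in both charts, so it may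
        be measured in \<open>\<kappa>'\<close> instead.\<close>
      have "(\<Sum>i<n. emeasure (N i) B) = (\<Sum>i<n. emeasure (area_measure \<kappa>') (snd \<kappa>' ` (B \<inter> P i)))"
      proof (rule sum.cong)
        fix i assume "i \<in> {..<n}"
        then have i: "i < n" by simp
        have BP: "B \<inter> P i \<in> sets borel_M" "B \<inter> P i \<subseteq> fst (\<kappa> i)" "B \<inter> P i \<subseteq> fst \<kappa>'"
          using sets.Int[OF B P_sets[OF i]] P_sub[of i] *(3) by blast+
        then show "emeasure (N i) B = emeasure (area_measure \<kappa>') (snd \<kappa>' ` (B \<inter> P i))"
          using N[OF i B] nn_integral_area_density_eq[OF \<kappa>A[OF i] *(1) BP(1)]
            emeasure_area_measure_image[OF \<kappa>A[OF i] BP(1,2)] emeasure_area_measure_image[OF *(1) BP(1,3)]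
          by simp
      qed simp
      also have "\<dots> = emeasure (area_measure \<kappa>') (\<Union>i<n. snd \<kappa>' ` (B \<inter> P i))"
      proof (rule sum_emeasure)
        show "disjoint_family_on (\<lambda>i. snd \<kappa>' ` (B \<inter> P i)) {..<n}"
          unfolding disjoint_family_on_def
        proof (intro ballI impI)
          fix i j assume "i \<in> {..<n}" "j \<in> {..<n}" "i \<noteq> j"
          then have "P i \<inter> P j = {}" by (rule disjoint_family_onD[OF P_disj])
          moreover have "snd \<kappa>' ` (B \<inter> P i) \<inter> snd \<kappa>' ` (B \<inter> P j) = snd \<kappa>' ` ((B \<inter> P i) \<inter> (B \<inter> P j))"
            by (rule inj_on_image_Int[OF chart_inj[OF *(1)], symmetric]) (use *(3) in auto)
          ultimately show "snd \<kappa>' ` (B \<inter> P i) \<inter> snd \<kappa>' ` (B \<inter> P j) = {}" by auto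
        qed
        show "(\<lambda>i. snd \<kappa>' ` (B \<inter> P i)) ` {..<n} \<subseteq> sets (area_measure \<kappa>')"
        proof safe
          fix i assume "i < n"
          show "snd \<kappa>' ` (B \<inter> P i) \<in> sets (area_measure \<kappa>')"
            unfolding sets_area_measure
            by (rule sets_image_chart[OF *(1) sets.Int[OF B P_sets[OF \<open>i < n\<close>]]]) (use *(3) in blast)
        qed
      qed simp
      also have "(\<Union>i<n. snd \<kappa>' ` (B \<inter> P i)) = snd \<kappa>' ` B"
      proof -
        have "(\<Union>i<n. snd \<kappa>' ` (B \<inter> P i)) = snd \<kappa>' ` (B \<inter> (\<Union>i<n. P i))" by blast
        also have "B \<inter> (\<Union>i<n. P i) = B"
          unfolding P_un[symmetric] using *(3) chart_subset[OF *(1)] by blast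
        finally show ?thesis .
      qed
      also have "emeasure (area_measure \<kappa>') (snd \<kappa>' ` B) = (\<integral>\<^sup>+p\<in>snd \<kappa>' ` B. ennreal (area_density \<kappa>' p) \<partial>lborel)"
        by (rule emeasure_area_measure_image[OF *(1) B *(3)])
      finally show "emeasure \<nu> B = (\<integral>\<^sup>+p\<in>snd \<kappa>' ` B. ennreal (sqrt (det (g \<kappa>' p))) \<partial>lborel)"
        using \<nu>[OF B] by (simp add: area_density_def)
    qed (rule \<nu>_sets)
  next
    fix \<nu>' assume "is_volume_measure M \<A> g \<nu>'"
    then have \<nu>'_sets: "sets \<nu>' = sets borel_M"
      and \<nu>': "\<And>\<kappa> B. \<kappa> \<in> \<A> \<Longrightarrow> B \<in> sets borel_M \<Longrightarrow> B \<subseteq> fst \<kappa> \<Longrightarrow>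
        emeasure \<nu>' B = (\<integral>\<^sup>+p\<in>snd \<kappa> ` B. ennreal (area_density \<kappa> p) \<partial>lborel)"
      unfolding is_volume_measure_def area_density_def by simp_all
    show "\<nu>' = \<nu>"
    proof (rule measure_eqI)
      fix B assume "B \<in> sets \<nu>'"
      then have B: "B \<in> sets borel_M" by (simp add: \<nu>'_sets)
      have "emeasure \<nu>' B = (\<Sum>i<n. emeasure \<nu>' (B \<inter> P i))"
        by (rule emeasure_eq_sum_pieces[OF \<nu>'_sets P_sets P_disj P_un B])
      also have "\<dots> = (\<Sum>i<n. emeasure (N i) B)"
      proof (rule sum.cong)
        fix i assume "i \<in> {..<n}"
        then have i: "i < n" by simp
        have BP: "B \<inter> P i \<in> sets borel_M" "B \<inter> P i \<subseteq> fst (\<kappa> i)"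
          using sets.Int[OF B P_sets[OF i]] P_sub[of i] by blast+
        then show "emeasure \<nu>' (B \<inter> P i) = emeasure (N i) B"
          using N[OF i B] \<nu>'[OF \<kappa>A[OF i] BP] emeasure_area_measure_image[OF \<kappa>A[OF i] BP] by simp
      qed simp
      finally show "emeasure \<nu>' B = emeasure \<nu> B" using \<nu>[OF B] by simp
    qed (simp add: \<nu>_sets \<nu>'_sets)
  qed
qed

abbreviation "vol \<equiv> volume_measure M \<A> g"

lemma is_volume_measure_vol: "is_volume_measure M \<A> g vol"
  unfolding volume_measure_def by (rule theI'[OF ex1_volume_measure])

lemma sets_vol: "sets vol = sets borel_M"
  using is_volume_measure_vol by (simp add: is_volume_measure_def)

lemma space_vol: "space vol = M"
  using sets_eq_imp_space_eq[OF sets_vol] by (simp add: space_restrict_space)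

lemma emeasure_vol:
  "\<kappa> \<in> \<A> \<Longrightarrow> B \<in> sets borel_M \<Longrightarrow> B \<subseteq> fst \<kappa> \<Longrightarrow>
    emeasure vol B = (\<integral>\<^sup>+p\<in>snd \<kappa> ` B. ennreal (area_density \<kappa> p) \<partial>lborel)"
  using is_volume_measure_vol sets_vol by (simp add: is_volume_measure_def area_density_def)

lemma borel_measurable_chart_indicator:
  fixes h :: "real^2 \<Rightarrow> ennreal"
  assumes "\<kappa> \<in> \<A>" "h \<in> borel_measurable borel"
  shows "(\<lambda>x. h (snd \<kappa> x) * indicator (fst \<kappa>) x) \<in> borel_measurable vol"
proof -
  have "(\<lambda>x. h (snd \<kappa> x)) \<in> borel_measurable (restrict_space vol (fst \<kappa>))"
    using measurable_compose[OF measurable_chart[OF assms(1)] assms(2)]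
    by (simp cong: measurable_cong_sets add: sets_restrict_space_cong[OF sets_vol])
  moreover have "fst \<kappa> \<inter> space vol \<in> sets vol"
    using sets_borel_M_chart[OF assms(1)] by (simp add: sets_vol[symmetric])
  ultimately show ?thesis
    by (simp add: borel_measurable_restrict_space_iff_ennreal)
qed

text \<open>The image of \<open>vol\<close> on the chart domain under the chart is
  \<open>area_measure \<kappa>\<close>, which has a density with respect to Lebesgue
  measure.\<close>

lemma nn_integral_vol_chart:
  fixes h :: "real^2 \<Rightarrow> ennreal"
  assumes "\<kappa> \<in> \<A>" "h \<in> borel_measurable borel"
  shows "(\<integral>\<^sup>+x. h (snd \<kappa> x) * indicator (fst \<kappa>) x \<partial>vol) =
    (\<integral>\<^sup>+p\<in>snd \<kappa> ` fst \<kappa>. h p * ennreal (area_density \<kappa> p) \<partial>lborel)"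
proof -
  let ?R = "restrict_space vol (fst \<kappa>)" and ?\<Omega> = "snd \<kappa> ` fst \<kappa>"
  have U: "fst \<kappa> \<in> sets borel_M" by (rule sets_borel_M_chart[OF assms(1)])
  have UM: "fst \<kappa> \<inter> space vol \<in> sets vol"
    using U by (simp add: sets_vol[symmetric])
  have m: "snd \<kappa> \<in> measurable ?R lborel"
    using measurable_chart[OF assms(1)]
    by (simp cong: measurable_cong_sets add: sets_restrict_space_cong[OF sets_vol])
  have eq: "distr ?R lborel (snd \<kappa>) = area_measure \<kappa>"
  proof (rule measure_eqI)
    fix C assume "C \<in> sets (distr ?R lborel (snd \<kappa>))"
    then have C: "C \<in> sets borel" by simp
    have "emeasure (distr ?R lborel (snd \<kappa>)) C = emeasure ?R (snd \<kappa> -` C \<inter> space ?R)"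
      using m C by (intro emeasure_distr) auto
    also have "\<dots> = emeasure vol (snd \<kappa> -` C \<inter> space ?R)"
      by (rule emeasure_restrict_space[OF UM]) (auto simp: space_restrict_space)
    also have "snd \<kappa> -` C \<inter> space ?R = {x \<in> fst \<kappa>. snd \<kappa> x \<in> C}"
      using chart_subset[OF assms(1)] by (auto simp: space_restrict_space space_vol)
    also have "emeasure vol \<dots> =
        (\<integral>\<^sup>+p\<in>snd \<kappa> ` {x \<in> fst \<kappa>. snd \<kappa> x \<in> C}. ennreal (area_density \<kappa> p) \<partial>lborel)"
      by (rule emeasure_vol[OF assms(1) sets_vimage_chart[OF assms(1) C]]) blast
    also have "snd \<kappa> ` {x \<in> fst \<kappa>. snd \<kappa> x \<in> C} = C \<inter> ?\<Omega>" by blast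
    also have "(\<integral>\<^sup>+p\<in>C \<inter> ?\<Omega>. ennreal (area_density \<kappa> p) \<partial>lborel) = emeasure (area_measure \<kappa>) C"
      by (rule emeasure_area_measure[OF assms(1) C, symmetric])
    finally show "emeasure (distr ?R lborel (snd \<kappa>)) C = emeasure (area_measure \<kappa>) C" .
  qed (simp add: sets_area_measure)
  have "(\<integral>\<^sup>+x. h (snd \<kappa> x) * indicator (fst \<kappa>) x \<partial>vol) = (\<integral>\<^sup>+x. h (snd \<kappa> x) \<partial>?R)"
    by (rule nn_integral_restrict_space[OF UM, symmetric])
  also have "\<dots> = (\<integral>\<^sup>+p. h p \<partial>distr ?R lborel (snd \<kappa>))"
    by (rule nn_integral_distr[symmetric]) (use m assms(2) in auto)
  also have "\<dots> = (\<integral>\<^sup>+p. ennreal (area_density \<kappa> p * indicator ?\<Omega> p) * h p \<partial>lborel)"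
    unfolding eq area_measure_def
    by (rule nn_integral_density) (use borel_measurable_area_density_chart[OF assms(1)] assms(2) in simp_all)
  also have "\<dots> = (\<integral>\<^sup>+p\<in>?\<Omega>. h p * ennreal (area_density \<kappa> p) \<partial>lborel)"
    by (rule nn_integral_cong) (simp add: indicator_def mult.commute)
  finally show ?thesis .
qed

end

section \<open>Gradients of functions given in a chart\<close>

lemma symmetric_matrix_inner:
  fixes G :: "real^'n^'n"
  assumes "transpose G = G"
  shows "v \<bullet> (G *v w) = w \<bullet> (G *v v)"
  by (metis assms dot_lmul_matrix inner_commute transpose_matrix_vector)

lemma linear_functional_as_inner:
  fixes F :: "real^'n \<Rightarrow> real"
  assumes "linear F"
  shows "F v = (\<chi> i. F (axis i 1)) \<bullet> v"
proof -
  have "F v = F (\<Sum>i\<in>UNIV. v $ i *s axis i 1)" by (simp add: basis_expansion)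
  also have "\<dots> = (\<Sum>i\<in>UNIV. v $ i * F (axis i 1))"
    by (simp add: linear_sum[OF assms] linear_cmul[OF assms] scalar_mult_eq_scaleR)
  finally show ?thesis by (simp add: inner_vec_def mult.commute)
qed

lemma matrix_inv_solves:
  fixes G :: "real^'n^'n"
  assumes "det G \<noteq> 0"
  shows "G *v (matrix_inv G *v d) = d"
proof -
  have "invertible G" using assms by (simp add: invertible_det_nz)
  then have "G ** matrix_inv G = mat 1"
    unfolding invertible_def matrix_inv_def by (metis (mono_tags, lifting) someI_ex)
  then show ?thesis by (simp add: matrix_vector_mul_assoc)
qed

text \<open>From a point on the edge, a small step in the direction \<open>- axis 1 1\<close> would
  leave the half-plane but not the open set.\<close>

lemma half_plane_open_positive:
  assumes "open N" "N \<subseteq> half_plane" "p \<in> N"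
  shows "0 < p $ 1"
proof -
  obtain e where e: "e > 0" "cball p e \<subseteq> N"
    using assms(1,3) open_contains_cball by blast
  have "p - e *\<^sub>R axis 1 1 \<in> cball p e"
    using e(1) by (simp add: dist_norm)
  then have "p - e *\<^sub>R axis 1 1 \<in> half_plane" using e(2) assms(2) by blast
  then show ?thesis using e(1) by (simp add: half_plane_def)
qed

context riemannian_surface
begin

lemma chart_image_half_plane: "\<kappa> \<in> \<A> \<Longrightarrow> snd \<kappa> ` fst \<kappa> \<subseteq> half_plane"
  by (rule openin_imp_subset[OF chart_openin_half_plane])

lemma interior_neighbourhood:
  assumes "\<kappa> \<in> \<A>" "openin (top_of_set M) V" "V \<subseteq> fst \<kappa>" "x \<in> V" "0 < snd \<kappa> x $ 1"
  obtains N where "open N" "snd \<kappa> x \<in> N" "N \<subseteq> snd \<kappa> ` V" "\<And>p. p \<in> N \<Longrightarrow> 0 < p $ 1"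
proof -
  obtain T where T: "open T" "snd \<kappa> ` V = half_plane \<inter> T"
    using openin_image_half_plane[OF assms(1-3)] unfolding openin_open by blast
  have "open (T \<inter> {p. 0 < p $ 1})"
    using T(1) by (intro open_Int open_Collect_less continuous_intros)
  moreover have "snd \<kappa> x \<in> T \<inter> {p. 0 < p $ 1}" using T(2) assms(4,5) by blast
  moreover have "T \<inter> {p. 0 < p $ 1} \<subseteq> snd \<kappa> ` V"
    unfolding T(2) half_plane_def by (auto intro: less_imp_le)
  ultimately show thesis by (intro that) auto
qed

lemma openin_chart_Int:
  "\<kappa> \<in> \<A> \<Longrightarrow> \<kappa>' \<in> \<A> \<Longrightarrow> openin (top_of_set M) (fst \<kappa> \<inter> fst \<kappa>')"
  by (intro openin_Int chart_openin)

text \<open>Invariance of domain: the transition map takes a plane neighbourhood of an interior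
  point injectively and continuously onto an open subset of the plane. That subset lies in the
  half-plane and so avoids its edge.\<close>

lemma interior_chart_independent:
  assumes "\<kappa> \<in> \<A>" "\<kappa>' \<in> \<A>" "x \<in> fst \<kappa>" "x \<in> fst \<kappa>'" "0 < snd \<kappa> x $ 1"
  shows "0 < snd \<kappa>' x $ 1"
proof -
  obtain N where N: "open N" "snd \<kappa> x \<in> N" "N \<subseteq> snd \<kappa> ` (fst \<kappa> \<inter> fst \<kappa>')"
    using interior_neighbourhood[OF assms(1) openin_chart_Int[OF assms(1,2)] Int_lower1, of x] assms(3-5)
    by (metis IntI)
  let ?T = "snd \<kappa>' \<circ> chart_inv \<kappa>"
  have inv: "chart_inv \<kappa> p \<in> fst \<kappa> \<inter> fst \<kappa>' \<and> snd \<kappa> (chart_inv \<kappa> p) = p" if p: "p \<in> N" for p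
  proof -
    obtain y where y: "y \<in> fst \<kappa>" "y \<in> fst \<kappa>'" "p = snd \<kappa> y" using N(3) p by blast
    then show ?thesis using chart_inv_snd[OF assms(1) y(1)] by simp
  qed
  have "continuous_on N ?T"
  proof (rule continuous_on_compose)
    show "continuous_on N (chart_inv \<kappa>)"
      by (rule continuous_on_subset[OF homeomorphism_cont2[OF chart_homeo[OF assms(1)]]]) (use N(3) in blast)
    show "continuous_on (chart_inv \<kappa> ` N) (snd \<kappa>')"
      by (rule continuous_on_subset[OF homeomorphism_cont1[OF chart_homeo[OF assms(2)]]]) (use inv in blast)
  qed
  moreover have "inj_on ?T N"
  proof (rule inj_onI)
    fix p q assume pq: "p \<in> N" "q \<in> N" "?T p = ?T q"
    then have "chart_inv \<kappa> p = chart_inv \<kappa> q"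
      using inj_onD[OF chart_inj[OF assms(2)], of "chart_inv \<kappa> p" "chart_inv \<kappa> q"] inv by simp
    then show "p = q" using inv pq by metis
  qed
  ultimately have "open (?T ` N)"
    using invariance_of_domain N(1) by blast
  moreover have "?T ` N \<subseteq> half_plane"
    using inv chart_image_half_plane[OF assms(2)] by (auto simp: image_subset_iff)
  moreover have "snd \<kappa>' x \<in> ?T ` N"
    using N(2) chart_inv_snd[OF assms(1,3)] by (intro image_eqI[of _ _ "snd \<kappa> x"]) simp_all
  ultimately show ?thesis by (rule half_plane_open_positive)
qed

lemma surface_interior_iff:
  assumes "\<kappa> \<in> \<A>" "x \<in> fst \<kappa>"
  shows "x \<in> surface_interior \<A> \<longleftrightarrow> 0 < snd \<kappa> x $ 1"
  unfolding surface_interior_def mem_Collect_eq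
  using interior_chart_independent[OF _ assms(1) _ assms(2)] assms by blast

lemma ex_chart: "x \<in> M \<Longrightarrow> \<exists>\<kappa>. \<kappa> \<in> \<A> \<and> x \<in> fst \<kappa>"
  using smooth_surface unfolding smooth_surface_def by blast

lemma interior_subset: "surface_interior \<A> \<subseteq> M"
  using chart_subset unfolding surface_interior_def by blast

text \<open>The vector \<open>w\<close> is the gradient in the chart, described through the metric instead of its
  inverse; this form is convenient for comparing metrics.\<close>

lemma grad_norm_sq_chart:
  assumes \<kappa>: "\<kappa> \<in> \<A>" and V: "openin (top_of_set M) V" "V \<subseteq> fst \<kappa>" "x \<in> V"
    and int: "x \<in> surface_interior \<A>"
    and eq: "\<And>y. y \<in> V \<Longrightarrow> u y = f (snd \<kappa> y)"
    and der: "(f has_derivative F) (at (snd \<kappa> x))"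
    and w: "\<And>v. F v = v \<bullet> (g \<kappa> (snd \<kappa> x) *v w)"
  shows "grad_norm_sq \<A> g u x = w \<bullet> (g \<kappa> (snd \<kappa> x) *v w)"
proof -
  define \<kappa>' where "\<kappa>' = (SOME \<kappa>. \<kappa> \<in> \<A> \<and> x \<in> fst \<kappa>)"
  have "x \<in> M" using interior_subset int by blast
  then have "\<kappa>' \<in> \<A> \<and> x \<in> fst \<kappa>'"
    unfolding \<kappa>'_def by (rule someI_ex[OF ex_chart])
  then have \<kappa>': "\<kappa>' \<in> \<A>" "x \<in> fst \<kappa>'" by auto
  have x: "x \<in> fst \<kappa>" using V by blast
  let ?G = "g \<kappa> (snd \<kappa> x)" and ?G' = "g \<kappa>' (snd \<kappa>' x)" and ?T = "snd \<kappa> \<circ> chart_inv \<kappa>'"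
  have "openin (top_of_set M) (V \<inter> fst \<kappa>')"
    by (rule openin_Int[OF V(1) chart_openin[OF \<kappa>'(1)]])
  then obtain N where N: "open N" "snd \<kappa>' x \<in> N" "N \<subseteq> snd \<kappa>' ` (V \<inter> fst \<kappa>')"
    using interior_neighbourhood[OF \<kappa>'(1) _ Int_lower2, of V x] V(3) \<kappa>'(2)
      surface_interior_iff[OF \<kappa>'] int by (metis IntI)
  have x': "x \<in> fst \<kappa>' \<inter> fst \<kappa>" using x \<kappa>'(2) by blast
  obtain D where D: "(?T has_derivative D) (at (snd \<kappa>' x) within snd \<kappa>' ` (fst \<kappa>' \<inter> fst \<kappa>))"
    by (rule transition_has_derivative[OF \<kappa>'(1) \<kappa> x'])
  have lin: "linear D" by (rule has_derivative_linear[OF D])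
  note G = metric_transition[OF \<kappa>'(1) \<kappa> x' D]
  have "N \<subseteq> snd \<kappa>' ` (fst \<kappa>' \<inter> fst \<kappa>)" using N(3) V(2) by blast
  then have "(?T has_derivative D) (at (snd \<kappa>' x) within N)"
    by (rule has_derivative_subset[OF D])
  then have DT: "(?T has_derivative D) (at (snd \<kappa>' x))"
    using at_within_open[OF N(2,1)] by simp
  have Tx: "?T (snd \<kappa>' x) = snd \<kappa> x" using chart_inv_snd[OF \<kappa>'] by simp
  have "((f \<circ> ?T) has_derivative (F \<circ> D)) (at (snd \<kappa>' x))"
    by (rule diff_chain_at[OF DT]) (use der Tx in simp)
  then have "((u \<circ> chart_inv \<kappa>') has_derivative (F \<circ> D)) (at (snd \<kappa>' x))"
  proof (rule has_derivative_transform_within_open[OF _ N(1,2)])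
    fix p assume "p \<in> N"
    then obtain y where y: "y \<in> V" "y \<in> fst \<kappa>'" "p = snd \<kappa>' y" using N(3) by blast
    then show "(f \<circ> ?T) p = (u \<circ> chart_inv \<kappa>') p"
      using chart_inv_snd[OF \<kappa>'(1) y(2)] eq[OF y(1)] by simp
  qed
  then have fd: "frechet_derivative (u \<circ> chart_inv \<kappa>') (at (snd \<kappa>' x)) = F \<circ> D"
    by (rule frechet_derivative_at[symmetric])
  define d where "d = euclidean_gradient (u \<circ> chart_inv \<kappa>') (snd \<kappa>' x)"
  have d: "F (D v) = d \<bullet> v" for v
    using linear_functional_as_inner[of "F \<circ> D" v] linear_compose[OF lin has_derivative_linear[OF der]]
    by (simp add: d_def euclidean_gradient_def fd)
  define w' where "w' = matrix_inv ?G' *v d"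
  have w': "?G' *v w' = d"
    unfolding w'_def by (rule matrix_inv_solves) (use metric_det_pos[OF \<kappa>'] in simp)
  \<comment> \<open>The transition map pulls \<open>?G\<close> back to \<open>?G'\<close>. The
    latter is definite, so the derivative has no kernel.\<close>
  have "inj D"
    unfolding linear_injective_0[OF lin]
  proof (intro allI impI)
    fix v assume "D v = 0"
    then have "v \<bullet> (?G' *v v) = 0" using G[of v v] by simp
    then show "v = 0" using metric_positive[OF \<kappa>', of v] by force
  qed
  then have surj: "surj D" using linear_inj_imp_surj[OF lin] by blast
  \<comment> \<open>Both \<open>w\<close> and \<open>D w'\<close> represent the functional
    \<open>F\<close> with respect to \<open>?G\<close>: gradients computed in the two charts
    correspond under \<open>D\<close>.\<close>
  have "v \<bullet> (?G *v w) = v \<bullet> (?G *v D w')" for v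
  proof -
    obtain v' where v': "v = D v'" using surj by (metis surjD)
    have "v \<bullet> (?G *v w) = d \<bullet> v'" using w[of v] d[of v'] v' by simp
    also have "\<dots> = v' \<bullet> (?G' *v w')" by (simp add: w' inner_commute)
    also have "\<dots> = v \<bullet> (?G *v D w')" using G[of v' w'] v' by simp
    finally show ?thesis .
  qed
  then have eqG: "?G *v w = ?G *v D w'" by (metis vector_eq_ldot)
  have "w \<bullet> (?G *v w) = D w' \<bullet> (?G *v D w')"
    unfolding eqG using symmetric_matrix_inner[OF metric_symmetric[OF \<kappa> x], of w "D w'"] by (simp add: eqG)
  also have "\<dots> = w' \<bullet> (?G' *v w')" using G[of w' w'] by simp
  also have "\<dots> = d \<bullet> w'" by (simp add: w' inner_commute)
  finally show ?thesis
    by (simp add: grad_norm_sq_def Let_def \<kappa>'_def[symmetric] d_def[symmetric] w'_def[symmetric])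
qed

lemma gradient_vector_exists:
  assumes "\<kappa> \<in> \<A>" "x \<in> fst \<kappa>" "linear F"
  obtains w where "\<And>v. F v = v \<bullet> (g \<kappa> (snd \<kappa> x) *v w)"
proof
  fix v
  show "F v = v \<bullet> (g \<kappa> (snd \<kappa> x) *v (matrix_inv (g \<kappa> (snd \<kappa> x)) *v (\<chi> i. F (axis i 1))))"
    using matrix_inv_solves[of "g \<kappa> (snd \<kappa> x)"] metric_det_pos[OF assms(1,2)]
      linear_functional_as_inner[OF assms(3), of v]
    by (simp add: inner_commute)
qed

lemma grad_norm_sq_locally_constant:
  assumes "openin (top_of_set M) V" "x \<in> V" "x \<in> surface_interior \<A>" "\<And>y. y \<in> V \<Longrightarrow> u y = c"
  shows "grad_norm_sq \<A> g u x = 0"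
proof -
  have "x \<in> M" using interior_subset assms(3) by blast
  then obtain \<kappa> where \<kappa>: "\<kappa> \<in> \<A>" "x \<in> fst \<kappa>" using ex_chart by blast
  have "grad_norm_sq \<A> g u x = 0 \<bullet> (g \<kappa> (snd \<kappa> x) *v 0)"
  proof (rule grad_norm_sq_chart[OF \<kappa>(1) _ _ _ assms(3)])
    show "openin (top_of_set M) (V \<inter> fst \<kappa>)"
      by (rule openin_Int[OF assms(1) chart_openin[OF \<kappa>(1)]])
    show "((\<lambda>p. c) has_derivative (\<lambda>v. 0)) (at (snd \<kappa> x))" by simp
  qed (use assms(2,4) \<kappa>(2) in auto)
  then show ?thesis by simp
qed

lemma test_function_has_derivative:
  assumes "test_function M \<A> u" "\<kappa> \<in> \<A>" "x \<in> fst \<kappa>" "x \<in> surface_interior \<A>"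
  obtains F where "((u \<circ> chart_inv \<kappa>) has_derivative F) (at (snd \<kappa> x))"
proof -
  let ?S = "snd \<kappa> ` (fst \<kappa> \<inter> surface_interior \<A>)"
  have "smooth_on ?S (u \<circ> chart_inv \<kappa>)"
    using assms(1,2) unfolding test_function_def by blast
  moreover have "snd \<kappa> x \<in> ?S" using assms(3,4) by blast
  ultimately obtain W h where W: "open W" "snd \<kappa> x \<in> W" "\<And>n. Ck_on n W h"
      "\<And>y. y \<in> W \<inter> ?S \<Longrightarrow> h y = (u \<circ> chart_inv \<kappa>) y"
    unfolding smooth_on_def by meson
  obtain N where N: "open N" "snd \<kappa> x \<in> N" "N \<subseteq> snd \<kappa> ` fst \<kappa>" "\<And>p. p \<in> N \<Longrightarrow> 0 < p $ 1"
    using interior_neighbourhood[OF assms(2) chart_openin[OF assms(2)] order_refl assms(3)]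
      surface_interior_iff[OF assms(2,3)] assms(4) by metis
  have NS: "N \<subseteq> ?S"
  proof
    fix p assume p: "p \<in> N"
    then obtain y where y: "y \<in> fst \<kappa>" "p = snd \<kappa> y" using N(3) by blast
    then have "y \<in> surface_interior \<A>" using surface_interior_iff[OF assms(2) y(1)] N(4)[OF p] by simp
    then show "p \<in> ?S" using y by blast
  qed
  have "(h has_derivative frechet_derivative h (at (snd \<kappa> x))) (at (snd \<kappa> x))"
    by (rule Ck_on_Suc_has_derivative[OF W(3)[of "Suc 0"] W(2)])
  then have "((u \<circ> chart_inv \<kappa>) has_derivative frechet_derivative h (at (snd \<kappa> x))) (at (snd \<kappa> x))"
  proof (rule has_derivative_transform_within_open)
    show "open (W \<inter> N)" "snd \<kappa> x \<in> W \<inter> N" using W N by auto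
    show "h p = (u \<circ> chart_inv \<kappa>) p" if "p \<in> W \<inter> N" for p using W(4)[of p] NS that by blast
  qed
  then show thesis by (rule that)
qed

text \<open>The affine relation is assumed on \<open>M\<close> only, because the elements of the
  test spaces are set to 0 outside \<open>M\<close>. Gradients are computed through charts and do
  not see the difference.\<close>

lemma grad_norm_sq_affine:
  assumes u: "test_function M \<A> u" and x: "x \<in> surface_interior \<A>"
    and eq: "\<And>y. y \<in> M \<Longrightarrow> u' y = a + b * u y"
  shows "grad_norm_sq \<A> g u' x = b\<^sup>2 * grad_norm_sq \<A> g u x"
proof -
  have "x \<in> M" using interior_subset x by blast
  then obtain \<kappa> where \<kappa>: "\<kappa> \<in> \<A>" "x \<in> fst \<kappa>" using ex_chart by blast
  obtain F where F: "((u \<circ> chart_inv \<kappa>) has_derivative F) (at (snd \<kappa> x))"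
    by (rule test_function_has_derivative[OF u \<kappa> x])
  obtain w where w: "\<And>v. F v = v \<bullet> (g \<kappa> (snd \<kappa> x) *v w)"
    by (rule gradient_vector_exists[OF \<kappa> has_derivative_linear[OF F]]) blast
  have "grad_norm_sq \<A> g u x = w \<bullet> (g \<kappa> (snd \<kappa> x) *v w)"
    by (rule grad_norm_sq_chart[OF \<kappa>(1) chart_openin[OF \<kappa>(1)] order_refl \<kappa>(2) x _ F w])
      (simp add: chart_inv_snd[OF \<kappa>(1)])
  moreover have "grad_norm_sq \<A> g u' x = (b *\<^sub>R w) \<bullet> (g \<kappa> (snd \<kappa> x) *v (b *\<^sub>R w))"
  proof (rule grad_norm_sq_chart[OF \<kappa>(1) chart_openin[OF \<kappa>(1)] order_refl \<kappa>(2) x])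
    show "u' y = a + b * (u \<circ> chart_inv \<kappa>) (snd \<kappa> y)" if "y \<in> fst \<kappa>" for y
      using eq chart_subset[OF \<kappa>(1)] that by (simp add: chart_inv_snd[OF \<kappa>(1)] subsetD)
    show "((\<lambda>p. a + b * (u \<circ> chart_inv \<kappa>) p) has_derivative (\<lambda>v. b * F v)) (at (snd \<kappa> x))"
      using has_derivative_add[OF has_derivative_const has_derivative_mult_right[OF F]] by simp
    show "b * F v = v \<bullet> (g \<kappa> (snd \<kappa> x) *v (b *\<^sub>R w))" for v
      by (simp add: w matrix_vector_mult_scaleR)
  qed
  ultimately show ?thesis
    by (simp add: matrix_vector_mult_scaleR power2_eq_square)
qed

lemma test_function_affine:
  assumes u: "test_function M \<A> u" and eq: "\<And>y. y \<in> M \<Longrightarrow> u' y = a + b * u y"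
  shows "test_function M \<A> u'"
  unfolding test_function_def
proof (intro conjI ballI)
  have "continuous_on M (\<lambda>y. a + b * u y)"
    using u unfolding test_function_def by (intro continuous_intros) blast
  then show "continuous_on M u'"
    by (rule continuous_on_cong[THEN iffD1, OF refl _, rotated]) (simp add: eq)
next
  fix \<kappa> assume \<kappa>: "\<kappa> \<in> \<A>"
  let ?S = "snd \<kappa> ` (fst \<kappa> \<inter> surface_interior \<A>)"
  show "smooth_on ?S (u' \<circ> chart_inv \<kappa>)"
    unfolding smooth_on_def
  proof
    fix p assume p: "p \<in> ?S"
    have "smooth_on ?S (u \<circ> chart_inv \<kappa>)" using u \<kappa> unfolding test_function_def by blast
    then obtain W h where W: "open W" "p \<in> W" "\<And>n. Ck_on n W h"
        "\<And>y. y \<in> W \<inter> ?S \<Longrightarrow> h y = (u \<circ> chart_inv \<kappa>) y"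
      using p unfolding smooth_on_def by meson
    show "\<exists>W h. open W \<and> p \<in> W \<and> (\<forall>n. Ck_on n W h) \<and> (\<forall>y\<in>W \<inter> ?S. h y = (u' \<circ> chart_inv \<kappa>) y)"
    proof (intro exI conjI allI ballI)
      show "Ck_on n W (\<lambda>q. a + b * h q)" for n
        by (intro Ck_on_add Ck_on_mult Ck_on_const W)
      fix y assume y: "y \<in> W \<inter> ?S"
      then obtain z where z: "z \<in> fst \<kappa>" "y = snd \<kappa> z" by blast
      then have "chart_inv \<kappa> y \<in> M" using chart_inv_snd[OF \<kappa> z(1)] chart_subset[OF \<kappa>] by auto
      then show "a + b * h y = (u' \<circ> chart_inv \<kappa>) y" using W(4)[OF y] eq by simp
    qed (fact W)+
  qed
qed

end

section \<open>Estimates for the first eigenvalue\<close>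

lemma integrable_continuous_on_compact:
  fixes u :: "'a::topological_space \<Rightarrow> real"
  assumes "compact M" "sets \<mu> = sets (restrict_space borel M)" "emeasure \<mu> M < \<infinity>" "continuous_on M u"
  shows "integrable \<mu> u"
proof -
  have sp: "space \<mu> = M"
    using sets_eq_imp_space_eq[OF assms(2)] by (simp add: space_restrict_space)
  interpret finite_measure \<mu>
    by (rule finite_measureI) (use assms(3) in \<open>simp add: sp\<close>)
  have "bounded (u ` M)"
    by (rule compact_imp_bounded[OF compact_continuous_image[OF assms(4,1)]])
  then obtain B where B: "\<And>x. x \<in> M \<Longrightarrow> norm (u x) \<le> B"
    unfolding bounded_iff by blast
  show ?thesis
  proof (rule integrable_const_bound)
    show "AE x in \<mu>. norm (u x) \<le> B" using B by (intro AE_I2) (simp add: sp)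
    show "u \<in> borel_measurable \<mu>"
      using borel_measurable_continuous_on_restrict[OF assms(4)]
      by (simp cong: measurable_cong_sets add: assms(2))
  qed
qed

text \<open>The constant is determinant over trace, a lower bound for the smaller eigenvalue. The
  identity in the proof is the Cayley-Hamilton theorem: the square of the matrix is the trace times
  the matrix minus the determinant.\<close>

lemma positive_definite_form_lower_bound:
  fixes A B C :: real
  assumes "A > 0" "C > 0" "A * C - B\<^sup>2 > 0"
  obtains m where "m > 0" "\<And>\<alpha> \<beta>. m * (\<alpha>\<^sup>2 + \<beta>\<^sup>2) \<le> \<alpha>\<^sup>2 * A + 2 * \<alpha> * \<beta> * B + \<beta>\<^sup>2 * C"
proof
  show "0 < (A * C - B\<^sup>2) / (A + C)" using assms by simp
  fix \<alpha> \<beta> :: real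
  have "(A + C) * (\<alpha>\<^sup>2 * A + 2 * \<alpha> * \<beta> * B + \<beta>\<^sup>2 * C) - (A * C - B\<^sup>2) * (\<alpha>\<^sup>2 + \<beta>\<^sup>2) =
      (A * \<alpha> + B * \<beta>)\<^sup>2 + (B * \<alpha> + C * \<beta>)\<^sup>2"
    by algebra
  then have "(A * C - B\<^sup>2) * (\<alpha>\<^sup>2 + \<beta>\<^sup>2) \<le> (\<alpha>\<^sup>2 * A + 2 * \<alpha> * \<beta> * B + \<beta>\<^sup>2 * C) * (A + C)"
    by (smt (verit) mult.commute sum_power2_ge_zero)
  then show "(A * C - B\<^sup>2) / (A + C) * (\<alpha>\<^sup>2 + \<beta>\<^sup>2) \<le> \<alpha>\<^sup>2 * A + 2 * \<alpha> * \<beta> * B + \<beta>\<^sup>2 * C"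
    using assms by (simp add: pos_divide_le_eq)
qed

text \<open>The tolerance \<open>\<eta> * m / 2\<close> is spent twice, once on the two squares and
  once on the mixed term, which is bounded by \<open>\<bar>2 * \<alpha> * \<beta>\<bar> \<le>
  \<alpha>\<^sup>2 + \<beta>\<^sup>2\<close>. The total error is at most \<eta> times the lower
  bound of the form.\<close>

lemma quadratic_form_perturbation:
  fixes A B C m \<eta> :: real
  assumes "\<bar>A' - A\<bar> \<le> \<eta> * m / 2" "\<bar>B' - B\<bar> \<le> \<eta> * m / 2" "\<bar>C' - C\<bar> \<le> \<eta> * m / 2" "0 \<le> \<eta>"
    and "m * (\<alpha>\<^sup>2 + \<beta>\<^sup>2) \<le> \<alpha>\<^sup>2 * A + 2 * \<alpha> * \<beta> * B + \<beta>\<^sup>2 * C"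
  shows "(1 - \<eta>) * (\<alpha>\<^sup>2 * A + 2 * \<alpha> * \<beta> * B + \<beta>\<^sup>2 * C) \<le> \<alpha>\<^sup>2 * A' + 2 * \<alpha> * \<beta> * B' + \<beta>\<^sup>2 * C'"
proof -
  define k where "k = \<eta> * m / 2"
  have k: "A - A' \<le> k" "C - C' \<le> k"
    using abs_ge_minus_self[of "A' - A"] abs_ge_minus_self[of "C' - C"] assms(1,3) unfolding k_def by linarith+
  have "\<alpha>\<^sup>2 * A - \<alpha>\<^sup>2 * A' \<le> \<alpha>\<^sup>2 * k"
    using mult_left_mono[OF k(1), of "\<alpha>\<^sup>2"] by (simp add: right_diff_distrib)
  moreover have "\<beta>\<^sup>2 * C - \<beta>\<^sup>2 * C' \<le> \<beta>\<^sup>2 * k"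
    using mult_left_mono[OF k(2), of "\<beta>\<^sup>2"] by (simp add: right_diff_distrib)
  moreover have "2 * \<alpha> * \<beta> * B - 2 * \<alpha> * \<beta> * B' \<le> (\<alpha>\<^sup>2 + \<beta>\<^sup>2) * k"
  proof -
    have "2 * \<alpha> * \<beta> * (B - B') \<le> \<bar>2 * \<alpha> * \<beta>\<bar> * \<bar>B - B'\<bar>"
      by (metis abs_ge_self abs_mult)
    also have "\<dots> \<le> (\<alpha>\<^sup>2 + \<beta>\<^sup>2) * k"
    proof (rule mult_mono)
      show "\<bar>2 * \<alpha> * \<beta>\<bar> \<le> \<alpha>\<^sup>2 + \<beta>\<^sup>2"
        using sum_squares_bound[of \<alpha> \<beta>] sum_squares_bound[of "- \<alpha>" \<beta>] by (simp add: abs_le_iff)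
      show "\<bar>B - B'\<bar> \<le> k" using assms(2) by (simp add: k_def abs_minus_commute)
    qed auto
    finally show ?thesis by (simp add: algebra_simps)
  qed
  moreover have "2 * ((\<alpha>\<^sup>2 + \<beta>\<^sup>2) * k) = \<eta> * (m * (\<alpha>\<^sup>2 + \<beta>\<^sup>2))" by (simp add: k_def)
  moreover have "\<eta> * (m * (\<alpha>\<^sup>2 + \<beta>\<^sup>2)) \<le> \<eta> * (\<alpha>\<^sup>2 * A + 2 * \<alpha> * \<beta> * B + \<beta>\<^sup>2 * C)"
    by (rule mult_left_mono[OF assms(5,4)])
  ultimately show ?thesis by (simp add: algebra_simps)
qed

lemma fun_span_doubletonE:
  assumes "v \<in> fun_vs.span {a, b}"
  obtains \<alpha> \<beta> where "v = (\<lambda>x. \<alpha> * a x + \<beta> * b x)"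
proof -
  obtain \<alpha> where "v - (\<lambda>x. \<alpha> * a x) \<in> fun_vs.span {b}"
    using assms unfolding fun_vs.span_insert by blast
  then obtain \<beta> where "v - (\<lambda>x. \<alpha> * a x) = (\<lambda>x. \<beta> * b x)"
    unfolding fun_vs.span_singleton by blast
  then have "v = (\<lambda>x. \<alpha> * a x + \<beta> * b x)"
    by (auto simp: fun_eq_iff algebra_simps)
  then show thesis by (rule that)
qed

context riemannian_surface
begin

text \<open>The test space is the span of \<open>u\<close> and the constants. The bound \<open>h\<close> is there because the
  measurability of \<open>grad_norm_sq\<close> is then not an issue.\<close>

lemma eigenvalue_1_variance_le:
  assumes gc: "g = (SOME g. g \<in> c)"
    and \<mu>: "sets \<mu> = sets borel_M" "emeasure \<mu> M = 1"
    and u: "test_function M \<A> u"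
    and h: "h \<in> borel_measurable vol"
      "\<And>x. x \<in> surface_interior \<A> \<Longrightarrow> ennreal (grad_norm_sq \<A> g u x) \<le> h x"
  shows "eigenvalue M \<A> c 1 \<mu> * ennreal (\<integral>x. (u x - (\<integral>x. u x \<partial>\<mu>))\<^sup>2 \<partial>\<mu>) \<le> (\<integral>\<^sup>+x. h x \<partial>vol)"
proof -
  have sp: "space \<mu> = M"
    using sets_eq_imp_space_eq[OF \<mu>(1)] by (simp add: space_restrict_space)
  interpret prob_space \<mu> by (rule prob_spaceI) (simp add: sp \<mu>(2))
  have cont: "continuous_on M u" using u unfolding test_function_def by blast
  note int = integrable_continuous_on_compact[OF compact \<mu>(1)]
  define m where "m = (\<integral>x. u x \<partial>\<mu>)"
  define V where "V = (\<integral>x. (u x - m)\<^sup>2 \<partial>\<mu>)"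
  define H where "H = (\<integral>\<^sup>+x. h x \<partial>vol)"
  \<comment> \<open>The value 0 off \<open>M\<close> is forced by \<open>test_subspace\<close>,
    which wants an element that vanishes almost everywhere to be the zero function on the whole
    type.\<close>
  define el where "el = (\<lambda>a b x. if x \<in> M then a + b * u x else 0)"
  have V0: "0 \<le> V" unfolding V_def by simp
  have int_el: "integrable \<mu> (\<lambda>x. (el a b x)\<^sup>2)" for a b
  proof (rule int)
    have "continuous_on M (\<lambda>x. (a + b * u x)\<^sup>2)" by (intro continuous_intros cont)
    then show "continuous_on M (\<lambda>x. (el a b x)\<^sup>2)"
      by (rule continuous_on_cong[THEN iffD1, OF refl _, rotated]) (simp add: el_def)
  qed (simp add: \<mu>(2))
  \<comment> \<open>Constants are orthogonal to \<open>u - m\<close>, which has mean zero;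
    \<open>V\<close> is the variance of \<open>u\<close>.\<close>
  have q: "(\<integral>x. (el a b x)\<^sup>2 \<partial>\<mu>) = (a + b * m)\<^sup>2 + b\<^sup>2 * V" for a b
  proof -
    have i1: "integrable \<mu> (\<lambda>x. u x - m)"
      by (rule int) (intro continuous_intros cont | simp add: \<mu>(2))+
    have i2: "integrable \<mu> (\<lambda>x. (u x - m)\<^sup>2)"
      by (rule int) (intro continuous_intros cont | simp add: \<mu>(2))+
    have iu: "integrable \<mu> u" by (rule int[OF _ cont]) (simp add: \<mu>(2))
    have "(\<integral>x. (el a b x)\<^sup>2 \<partial>\<mu>) =
        (\<integral>x. (a + b * m)\<^sup>2 + (2 * (a + b * m) * b * (u x - m) + b\<^sup>2 * (u x - m)\<^sup>2) \<partial>\<mu>)"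
      by (rule Bochner_Integration.integral_cong) (simp_all add: el_def sp power2_eq_square algebra_simps)
    also have "\<dots> = (a + b * m)\<^sup>2 + (2 * (a + b * m) * b * (\<integral>x. u x - m \<partial>\<mu>) + b\<^sup>2 * V)"
      using i1 i2 by (simp add: V_def prob_space)
    also have "(\<integral>x. u x - m \<partial>\<mu>) = 0"
      using iu by (simp add: m_def prob_space)
    finally show ?thesis by simp
  qed
  show ?thesis
  \<comment> \<open>For V = 0 the left-hand side is 0 even if the eigenvalue is infinite, since
    \<infinity> times 0 is 0 in \<open>ennreal\<close>. For V > 0 the constants and \<open>u\<close>
    span a plane in the space of square integrable functions.\<close>
  proof (cases "V = 0")
    case False
    then have V: "V > 0" using V0 by simp
    have q0: "a = 0 \<and> b = 0" if "(a + b * m)\<^sup>2 + b\<^sup>2 * V = 0" for a b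
    proof -
      have "0 \<le> (a + b * m)\<^sup>2" "0 \<le> b\<^sup>2 * V" using V by auto
      then have "b\<^sup>2 * V = 0" "(a + b * m)\<^sup>2 = 0" using that by linarith+
      then show ?thesis using V by simp
    qed
    have nz: "a = 0 \<and> b = 0" if "el a b = 0" for a b
      using q0[of a b] q[of a b] by (simp add: that)
    define \<Lambda> where "\<Lambda> = {el a b | a b. True}"
    have add: "el a b + el a' b' = el (a + a') (b + b')" for a b a' b'
      by (auto simp: el_def fun_eq_iff algebra_simps)
    have scale: "(\<lambda>x. r * el a b x) = el (r * a) (r * b)" for r a b
      by (auto simp: el_def fun_eq_iff algebra_simps)
    have zero: "0 = el 0 0" by (auto simp: el_def fun_eq_iff)
    have "test_subspace M \<A> \<mu> (1 + 1) \<Lambda>"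
      unfolding test_subspace_def
    proof (intro conjI ballI impI)
      show "fun_subspace \<Lambda>"
      proof (rule fun_vs.subspaceI)
        show "0 \<in> \<Lambda>" unfolding \<Lambda>_def using zero by blast
        show "x + y \<in> \<Lambda>" if "x \<in> \<Lambda>" "y \<in> \<Lambda>" for x y
          using that add unfolding \<Lambda>_def by blast
        show "(\<lambda>x. r * v x) \<in> \<Lambda>" if "v \<in> \<Lambda>" for r v
          using that scale unfolding \<Lambda>_def by blast
      qed
      have n01: "el 0 1 \<noteq> 0" using nz[of 0 1] by auto
      have not_span: "el 1 0 \<notin> fun_vs.span {el 0 1}"
      proof
        assume "el 1 0 \<in> fun_vs.span {el 0 1}"
        then obtain k where "el 1 0 = el 0 k"
          unfolding fun_vs.span_singleton using scale[of _ 0 1] by auto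
        then have "el 1 (- k) = 0"
          using add[of 1 0 0 "- k"] add[of 0 k 0 "- k"] zero by simp
        then show False using nz[of 1 "- k"] by simp
      qed
      show "fun_dim \<Lambda> = 1 + 1"
      proof (rule fun_vs.dim_unique)
        show "{el 1 0, el 0 1} \<subseteq> \<Lambda>" unfolding \<Lambda>_def by blast
        show "\<Lambda> \<subseteq> fun_vs.span {el 1 0, el 0 1}"
        proof
          fix v assume "v \<in> \<Lambda>"
          then obtain a b where v: "v = el a b" unfolding \<Lambda>_def by blast
          have "v = (\<lambda>x. a * el 1 0 x) + (\<lambda>x. b * el 0 1 x)"
            unfolding scale add v by simp
          then show "v \<in> fun_vs.span {el 1 0, el 0 1}"
            by (auto intro!: fun_vs.span_add fun_vs.span_scale intro: fun_vs.span_base)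
        qed
        show "fun_vs.independent {el 1 0, el 0 1}"
          using fun_vs.independent_insertI[OF not_span] fun_vs.dependent_single[of "el 0 1"] n01 by blast
        have "el 1 0 \<noteq> el 0 1" using not_span fun_vs.span_base[of "el 0 1" "{el 0 1}"] by auto
        then show "card {el 1 0, el 0 1} = 1 + 1" by simp
      qed
      fix v assume "v \<in> \<Lambda>"
      then obtain a b where v: "v = el a b" unfolding \<Lambda>_def by blast
      show "test_function M \<A> v"
        by (rule test_function_affine[OF u, of _ a b]) (simp add: v el_def)
      show "integrable \<mu> (\<lambda>x. (v x)\<^sup>2)" unfolding v by (rule int_el)
      assume "AE x in \<mu>. v x = 0"
      then have "(\<integral>x. (v x)\<^sup>2 \<partial>\<mu>) = (\<integral>x. 0 \<partial>\<mu>)"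
        by (intro integral_cong_AE) (use int_el[of a b] in \<open>auto simp: v\<close>)
      then have "a = 0 \<and> b = 0" using q0[of a b] q[of a b] v by simp
      then show "v = 0" using v zero by simp
    qed
    then have "eigenvalue M \<A> c 1 \<mu> \<le> (SUP v\<in>\<Lambda> - {0}. rayleigh_quotient M \<A> c v \<mu>)"
      unfolding eigenvalue_def by (intro INF_lower) simp
    also have "\<dots> \<le> H / ennreal V"
    proof (rule SUP_least)
      fix v assume v': "v \<in> \<Lambda> - {0}"
      then obtain a b where v: "v = el a b" unfolding \<Lambda>_def by blast
      define Q where "Q = (a + b * m)\<^sup>2 + b\<^sup>2 * V"
      have "Q \<noteq> 0" using q0[of a b] v' v zero unfolding Q_def by auto
      \<comment> \<open>A constant added to \<open>b * u\<close> does not change the energy, and the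
        norm is smallest when the mean is 0. The largest quotient is therefore that of
        \<open>u - m\<close>.\<close>
      moreover have Q: "b\<^sup>2 * V \<le> Q" "0 \<le> Q" unfolding Q_def using V by auto
      ultimately have Qpos: "0 < Q" by simp
      have "dirichlet_energy M \<A> g v \<le> (\<integral>\<^sup>+x. ennreal (b\<^sup>2) * h x \<partial>vol)"
        unfolding dirichlet_energy_def
      proof (rule nn_integral_mono)
        fix x
        show "ennreal (grad_norm_sq \<A> g v x) * indicator (surface_interior \<A>) x \<le> ennreal (b\<^sup>2) * h x"
        proof (cases "x \<in> surface_interior \<A>")
          case True
          have "grad_norm_sq \<A> g v x = b\<^sup>2 * grad_norm_sq \<A> g u x"
            by (rule grad_norm_sq_affine[OF u True, of _ a]) (simp add: v el_def)
          then show ?thesis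
            using h(2)[OF True] True by (simp add: ennreal_mult' mult_left_mono)
        qed simp
      qed
      also have "\<dots> = ennreal (b\<^sup>2) * H" unfolding H_def by (rule nn_integral_cmult[OF h(1)])
      also have "\<dots> = ennreal (b\<^sup>2) * (ennreal V * (H / ennreal V))"
        using V by (simp add: ennreal_times_divide mult.commute[of _ H] ennreal_mult_divide_eq)
      also have "\<dots> = ennreal (b\<^sup>2 * V) * (H / ennreal V)"
        using V by (simp add: ennreal_mult mult.assoc)
      also have "\<dots> \<le> ennreal Q * (H / ennreal V)"
        using Q(1) by (intro mult_right_mono ennreal_leI) auto
      finally have "dirichlet_energy M \<A> g v / ennreal Q \<le> H / ennreal V"
        using Qpos by (intro divide_le_posI_ennreal) auto
      moreover have "(\<integral>\<^sup>+x. ennreal ((v x)\<^sup>2) \<partial>\<mu>) = ennreal Q"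
        unfolding v Q_def q[symmetric] by (rule nn_integral_eq_integral[OF int_el]) simp
      ultimately show "rayleigh_quotient M \<A> c v \<mu> \<le> H / ennreal V"
        unfolding rayleigh_quotient_def gc[symmetric] by simp
    qed
    finally have "eigenvalue M \<A> c 1 \<mu> * ennreal V \<le> H / ennreal V * ennreal V"
      by (intro mult_right_mono) auto
    also have "\<dots> = H"
      using V by (simp add: ennreal_divide_times ennreal_times_divide ennreal_mult_divide_eq)
    finally show ?thesis unfolding V_def m_def H_def .
  qed (simp add: V_def m_def)
qed

text \<open>With the test space \<Lambda> fixed, only the denominators depend on the measure,
  through the integrals of three products of basis elements. Positive definiteness for the limit
  measure turns their convergence into the inequality \<open>lower\<close>, which is uniform over
  \<Lambda>.\<close>

lemma eigenvalue_1_upper_semicontinuous: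
  assumes \<nu>: "\<And>n. sets (\<nu> n) = sets borel_M" "\<And>n. emeasure (\<nu> n) M = 1"
    and \<nu>': "sets \<nu>' = sets borel_M" "emeasure \<nu>' M = 1"
    and weak: "weakly_converges M \<nu> \<nu>'"
    and lim: "(\<lambda>n. eigenvalue M \<A> c 1 (\<nu> n)) \<longlonglongrightarrow> L"
  shows "L \<le> eigenvalue M \<A> c 1 \<nu>'"
  unfolding eigenvalue_def
proof (rule INF_greatest)
  fix \<Lambda> assume "\<Lambda> \<in> {\<Lambda>. test_subspace M \<A> \<nu>' (1 + 1) \<Lambda>}"
  then have \<Lambda>: "fun_subspace \<Lambda>" "fun_dim \<Lambda> = 2" "\<And>u. u \<in> \<Lambda> \<Longrightarrow> test_function M \<A> u"
    "\<And>u. u \<in> \<Lambda> \<Longrightarrow> (AE x in \<nu>'. u x = 0) \<Longrightarrow> u = 0"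
    by (auto simp: test_subspace_def numeral_2_eq_2)
  define S where "S = (SUP u\<in>\<Lambda> - {0}. rayleigh_quotient M \<A> c u \<nu>')"
  note int = integrable_continuous_on_compact[OF compact]
  have fin: "emeasure (\<nu> n) M < \<infinity>" "emeasure \<nu>' M < \<infinity>" for n using \<nu>(2) \<nu>'(2) by auto
  obtain B where B: "B \<subseteq> \<Lambda>" "fun_vs.independent B" "\<Lambda> \<subseteq> fun_vs.span B" "card B = fun_dim \<Lambda>"
    by (rule fun_vs.basis_exists)
  then obtain b1 b2 where b: "B = {b1, b2}" "b1 \<noteq> b2" using \<Lambda>(2) by (metis card_2_iff)
  have cont: "continuous_on M b1" "continuous_on M b2"
    using \<Lambda>(3) B(1) b(1) unfolding test_function_def by blast+
  have indep: "\<alpha> = 0 \<and> \<beta> = 0" if 0: "(\<lambda>x. \<alpha> * b1 x + \<beta> * b2 x) = 0" for \<alpha> \<beta>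
  proof -
    have b1: "b1 \<notin> fun_vs.span {b2}" and b2: "b2 \<noteq> 0"
      using B(2) b fun_vs.independent_insert[of b1 "{b2}"] fun_vs.dependent_single[of b2] by auto
    have "\<alpha> = 0"
    proof (rule ccontr)
      assume "\<alpha> \<noteq> 0"
      then have "b1 = (\<lambda>x. (- \<beta> / \<alpha>) * b2 x)"
        using 0 by (auto simp: fun_eq_iff field_simps eq_neg_iff_add_eq_0)
      then show False using b1 unfolding fun_vs.span_singleton by blast
    qed
    moreover have "\<beta> = 0"
    proof (rule ccontr)
      assume "\<beta> \<noteq> 0"
      then have "b2 = 0" using 0 \<open>\<alpha> = 0\<close> by (auto simp: fun_eq_iff)
      then show False using b2 by simp
    qed
    ultimately show ?thesis by simp
  qed
  have el: "(\<lambda>x. \<alpha> * b1 x + \<beta> * b2 x) \<in> \<Lambda>" for \<alpha> \<beta>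
  proof -
    have "(\<lambda>x. \<alpha> * b1 x) \<in> \<Lambda>" "(\<lambda>x. \<beta> * b2 x) \<in> \<Lambda>"
      using fun_vs.subspace_scale[OF \<Lambda>(1)] B(1) b(1) by auto
    from fun_vs.subspace_add[OF \<Lambda>(1) this] show ?thesis by (simp add: plus_fun_def)
  qed
  define form where "form = (\<lambda>\<mu>::'a measure. \<lambda>\<alpha> \<beta>. \<alpha>\<^sup>2 * (\<integral>x. (b1 x)\<^sup>2 \<partial>\<mu>) +
    2 * \<alpha> * \<beta> * (\<integral>x. b1 x * b2 x \<partial>\<mu>) + \<beta>\<^sup>2 * (\<integral>x. (b2 x)\<^sup>2 \<partial>\<mu>))"
  have form: "integrable \<mu> (\<lambda>x. (\<alpha> * b1 x + \<beta> * b2 x)\<^sup>2)"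
      "(\<integral>x. (\<alpha> * b1 x + \<beta> * b2 x)\<^sup>2 \<partial>\<mu>) = form \<mu> \<alpha> \<beta>"
      "(\<integral>\<^sup>+x. ennreal ((\<alpha> * b1 x + \<beta> * b2 x)\<^sup>2) \<partial>\<mu>) = ennreal (form \<mu> \<alpha> \<beta>)"
    if "sets \<mu> = sets borel_M" "emeasure \<mu> M < \<infinity>" for \<mu> \<alpha> \<beta>
  proof -
    have i: "integrable \<mu> (\<lambda>x. (b1 x)\<^sup>2)" "integrable \<mu> (\<lambda>x. b1 x * b2 x)" "integrable \<mu> (\<lambda>x. (b2 x)\<^sup>2)"
      by (intro int[OF that] continuous_intros cont)+
    show 1: "integrable \<mu> (\<lambda>x. (\<alpha> * b1 x + \<beta> * b2 x)\<^sup>2)"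
      by (intro int[OF that] continuous_intros cont)
    have "(\<lambda>x. (\<alpha> * b1 x + \<beta> * b2 x)\<^sup>2) =
        (\<lambda>x. \<alpha>\<^sup>2 * (b1 x)\<^sup>2 + 2 * \<alpha> * \<beta> * (b1 x * b2 x) + \<beta>\<^sup>2 * (b2 x)\<^sup>2)"
      by (auto simp: fun_eq_iff power2_eq_square algebra_simps)
    then show 2: "(\<integral>x. (\<alpha> * b1 x + \<beta> * b2 x)\<^sup>2 \<partial>\<mu>) = form \<mu> \<alpha> \<beta>"
      using i by (simp add: form_def)
    show "(\<integral>\<^sup>+x. ennreal ((\<alpha> * b1 x + \<beta> * b2 x)\<^sup>2) \<partial>\<mu>) = ennreal (form \<mu> \<alpha> \<beta>)"
      unfolding 2[symmetric] by (rule nn_integral_eq_integral[OF 1]) simp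
  qed
  have pos: "0 < form \<nu>' \<alpha> \<beta>" if "\<alpha> \<noteq> 0 \<or> \<beta> \<noteq> 0" for \<alpha> \<beta>
  proof (rule ccontr)
    assume "\<not> 0 < form \<nu>' \<alpha> \<beta>"
    moreover have "0 \<le> form \<nu>' \<alpha> \<beta>" unfolding form(2)[OF \<nu>'(1) fin(2), symmetric] by simp
    ultimately have "(\<integral>x. (\<alpha> * b1 x + \<beta> * b2 x)\<^sup>2 \<partial>\<nu>') = 0"
      using form(2)[OF \<nu>'(1) fin(2)] by simp
    then have "AE x in \<nu>'. (\<alpha> * b1 x + \<beta> * b2 x)\<^sup>2 = 0"
      using integral_nonneg_eq_0_iff_AE[OF form(1)[OF \<nu>'(1) fin(2)]] by simp
    then have "AE x in \<nu>'. \<alpha> * b1 x + \<beta> * b2 x = 0" by simp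
    from indep[OF \<Lambda>(4)[OF el this]] that show False by blast
  qed
  define a11 a12 a22 where "a11 = (\<integral>x. (b1 x)\<^sup>2 \<partial>\<nu>')" and "a12 = (\<integral>x. b1 x * b2 x \<partial>\<nu>')"
    and "a22 = (\<integral>x. (b2 x)\<^sup>2 \<partial>\<nu>')"
  have form': "form \<nu>' \<alpha> \<beta> = \<alpha>\<^sup>2 * a11 + 2 * \<alpha> * \<beta> * a12 + \<beta>\<^sup>2 * a22" for \<alpha> \<beta>
    by (simp add: form_def a11_def a12_def a22_def)
  have "0 < a11" "0 < a22" using pos[of 1 0] pos[of 0 1] by (auto simp: form')
  moreover have "0 < a11 * a22 - a12\<^sup>2"
  proof -
    \<comment> \<open>At this pair the form equals \<open>a11\<close> times its determinant.\<close>
    have "0 < form \<nu>' (- a12) a11" using pos[of "- a12" a11] \<open>0 < a11\<close> by simp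
    also have "\<dots> = a11 * (a11 * a22 - a12\<^sup>2)" by (simp add: form' power2_eq_square algebra_simps)
    finally show ?thesis using \<open>0 < a11\<close> zero_less_mult_pos by blast
  qed
  ultimately obtain m where m: "m > 0"
      "\<And>\<alpha> \<beta>. m * (\<alpha>\<^sup>2 + \<beta>\<^sup>2) \<le> \<alpha>\<^sup>2 * a11 + 2 * \<alpha> * \<beta> * a12 + \<beta>\<^sup>2 * a22"
    by (rule positive_definite_form_lower_bound) blast
  have key: "L \<le> ennreal (1 / (1 - \<eta>)) * S" if \<eta>: "0 < \<eta>" "\<eta> < 1" for \<eta> :: real
  proof (rule LIMSEQ_le_const2[OF lim])
    have ev: "\<forall>\<^sub>F n in sequentially. \<bar>(\<integral>x. f x \<partial>\<nu> n) - (\<integral>x. f x \<partial>\<nu>')\<bar> \<le> \<eta> * m / 2"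
      if "continuous_on M f" for f :: "'a \<Rightarrow> real"
    proof -
      have "(\<lambda>n. \<integral>x. f x \<partial>\<nu> n) \<longlonglongrightarrow> (\<integral>x. f x \<partial>\<nu>')" using weak that by (simp add: weakly_converges_def)
      then have "\<forall>\<^sub>F n in sequentially. dist (\<integral>x. f x \<partial>\<nu> n) (\<integral>x. f x \<partial>\<nu>') < \<eta> * m / 2"
        by (rule tendstoD) (use \<eta> m in simp)
      then show ?thesis by (rule eventually_mono) (simp add: dist_real_def)
    qed
    have "\<forall>\<^sub>F n in sequentially. eigenvalue M \<A> c 1 (\<nu> n) \<le> ennreal (1 / (1 - \<eta>)) * S"
      using ev[OF continuous_on_power[OF cont(1), of 2]] ev[OF continuous_on_mult[OF cont]]
        ev[OF continuous_on_power[OF cont(2), of 2]]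
    proof eventually_elim
      case (elim n)
      have lower: "(1 - \<eta>) * form \<nu>' \<alpha> \<beta> \<le> form (\<nu> n) \<alpha> \<beta>" for \<alpha> \<beta>
        unfolding form' unfolding form_def
        by (rule quadratic_form_perturbation[where m = m])
          (use elim \<eta> m in \<open>auto simp: a11_def a12_def a22_def\<close>)
      have \<Lambda>E: "\<exists>\<alpha> \<beta>. u = (\<lambda>x. \<alpha> * b1 x + \<beta> * b2 x) \<and> (u \<noteq> 0 \<longrightarrow> \<alpha> \<noteq> 0 \<or> \<beta> \<noteq> 0)" if u: "u \<in> \<Lambda>" for u
      proof -
        have "u \<in> fun_vs.span {b1, b2}" using u B(3) b(1) by blast
        then obtain \<alpha> \<beta> where "u = (\<lambda>x. \<alpha> * b1 x + \<beta> * b2 x)" by (rule fun_span_doubletonE)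
        then show ?thesis by (intro exI[of _ \<alpha>] exI[of _ \<beta>]) (auto simp: fun_eq_iff)
      qed
      \<comment> \<open>The dimension does not drop: by \<open>lower\<close>, an element that is
        null for \<open>\<nu> n\<close> is also null for \<open>\<nu>'\<close>.\<close>
      have "test_subspace M \<A> (\<nu> n) (1 + 1) \<Lambda>"
        unfolding test_subspace_def
      proof (intro conjI ballI impI)
        fix u assume u: "u \<in> \<Lambda>"
        then obtain \<alpha> \<beta> where ue: "u = (\<lambda>x. \<alpha> * b1 x + \<beta> * b2 x)" and nz: "u \<noteq> 0 \<longrightarrow> \<alpha> \<noteq> 0 \<or> \<beta> \<noteq> 0"
          using \<Lambda>E by blast
        show "test_function M \<A> u" by (rule \<Lambda>(3)[OF u])
        show "integrable (\<nu> n) (\<lambda>x. (u x)\<^sup>2)" unfolding ue by (rule form(1)[OF \<nu>(1) fin(1)])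
        assume "AE x in \<nu> n. u x = 0"
        then have "AE x in \<nu> n. (u x)\<^sup>2 = 0" by simp
        then have "form (\<nu> n) \<alpha> \<beta> = 0"
          using integral_nonneg_eq_0_iff_AE[OF form(1)[OF \<nu>(1) fin(1), of n \<alpha> \<beta>]]
            form(2)[OF \<nu>(1) fin(1), of n \<alpha> \<beta>] by (simp add: ue)
        then have "(1 - \<eta>) * form \<nu>' \<alpha> \<beta> \<le> 0" using lower[of \<alpha> \<beta>] by simp
        then have "\<not> 0 < form \<nu>' \<alpha> \<beta>" using \<eta> by (simp add: mult_le_0_iff)
        then show "u = 0" using pos nz by blast
      qed (use \<Lambda> in \<open>auto simp: numeral_2_eq_2\<close>)
      then have "eigenvalue M \<A> c 1 (\<nu> n) \<le> (SUP u\<in>\<Lambda> - {0}. rayleigh_quotient M \<A> c u (\<nu> n))"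
        unfolding eigenvalue_def by (intro INF_lower) simp
      also have "\<dots> \<le> ennreal (1 / (1 - \<eta>)) * S"
      proof (rule SUP_least)
        fix u assume u: "u \<in> \<Lambda> - {0}"
        then obtain \<alpha> \<beta> where ue: "u = (\<lambda>x. \<alpha> * b1 x + \<beta> * b2 x)" and nz: "\<alpha> \<noteq> 0 \<or> \<beta> \<noteq> 0"
          using \<Lambda>E by blast
        define E where "E = dirichlet_energy M \<A> (SOME g. g \<in> c) u"
        define Q where "Q = form \<nu>' \<alpha> \<beta>"
        have Q: "0 < Q" unfolding Q_def by (rule pos[OF nz])
        then have Qn: "0 < form (\<nu> n) \<alpha> \<beta>"
          using lower[of \<alpha> \<beta>] \<eta> unfolding Q_def by (smt (verit) mult_pos_pos)
        have "E / ennreal Q \<le> S"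
        proof -
          have "rayleigh_quotient M \<A> c u \<nu>' \<le> S" unfolding S_def by (rule SUP_upper[OF u])
          then show ?thesis
            unfolding rayleigh_quotient_def E_def Q_def ue form(3)[OF \<nu>'(1) fin(2)] .
        qed
        have "E = ennreal Q * (E / ennreal Q)"
          using Q by (simp add: ennreal_times_divide mult.commute[of _ E] ennreal_mult_divide_eq)
        also have "\<dots> \<le> ennreal (form (\<nu> n) \<alpha> \<beta> * (1 / (1 - \<eta>))) * S"
        proof (rule mult_mono)
          show "ennreal Q \<le> ennreal (form (\<nu> n) \<alpha> \<beta> * (1 / (1 - \<eta>)))"
            using lower[of \<alpha> \<beta>] \<eta> unfolding Q_def by (intro ennreal_leI) (simp add: field_simps)
        qed (use \<open>E / ennreal Q \<le> S\<close> in auto)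
        also have "\<dots> = ennreal (form (\<nu> n) \<alpha> \<beta>) * (ennreal (1 / (1 - \<eta>)) * S)"
          using Qn \<eta> by (subst ennreal_mult) (auto simp only: mult.assoc less_imp_le divide_nonneg_nonneg)
        finally have "E / ennreal (form (\<nu> n) \<alpha> \<beta>) \<le> ennreal (1 / (1 - \<eta>)) * S"
          using Qn by (intro divide_le_posI_ennreal) auto
        then show "rayleigh_quotient M \<A> c u (\<nu> n) \<le> ennreal (1 / (1 - \<eta>)) * S"
          unfolding rayleigh_quotient_def E_def ue form(3)[OF \<nu>(1) fin(1)] .
      qed
      finally show ?case .
    qed
    then show "\<exists>N. \<forall>n\<ge>N. eigenvalue M \<A> c 1 (\<nu> n) \<le> ennreal (1 / (1 - \<eta>)) * S"
      by (simp add: eventually_sequentially)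
  qed
  show "L \<le> (SUP u\<in>\<Lambda> - {0}. rayleigh_quotient M \<A> c u \<nu>')"
    unfolding S_def[symmetric]
  \<comment> \<open>Only a finite \<open>S\<close> needs an argument; \<eta> then tends to 0 in
    \<open>key\<close>.\<close>
  proof (cases S)
    case (real s)
    have "((\<lambda>\<eta>. ennreal (1 / (1 - \<eta>) * s)) \<longlongrightarrow> ennreal (1 / (1 - 0) * s)) (at_right (0::real))"
      by (intro tendsto_intros) auto
    moreover have "\<forall>\<^sub>F \<eta> in at_right (0::real). L \<le> ennreal (1 / (1 - \<eta>) * s)"
    proof -
      have "\<forall>\<^sub>F \<eta> in at_right (0::real). \<eta> < 1" by (rule eventually_at_right_real[THEN eventually_mono]) auto
      moreover have "\<forall>\<^sub>F \<eta> in at_right (0::real). 0 < \<eta>" by (simp add: eventually_at_filter)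
      ultimately show ?thesis
      proof eventually_elim
        case (elim \<eta>)
        then show ?case using key[of \<eta>] real by (simp add: ennreal_mult''[symmetric])
      qed
    qed
    ultimately have "L \<le> ennreal (1 / (1 - 0) * s)"
      by (rule tendsto_lowerbound) simp
    then show "L \<le> S" using real by simp
  qed simp
qed

end

section \<open>Test functions supported in a chart\<close>

lemma quadratic_form_le:
  fixes G :: "real^2^2"
  shows "\<bar>v \<bullet> (G *v v)\<bar> \<le> (\<Sum>i\<in>UNIV. \<Sum>j\<in>UNIV. \<bar>G $ i $ j\<bar>) * (norm v)\<^sup>2"
proof -
  have "v \<bullet> (G *v v) = (\<Sum>i\<in>UNIV. \<Sum>j\<in>UNIV. G $ i $ j * (v $ i * v $ j))"
    by (simp add: inner_vec_def matrix_vector_mult_def sum_distrib_left algebra_simps)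
  also have "\<bar>\<dots>\<bar> \<le> (\<Sum>i\<in>UNIV. \<Sum>j\<in>UNIV. \<bar>G $ i $ j\<bar> * (norm v)\<^sup>2)"
  proof (rule order_trans[OF sum_abs] , rule sum_mono)
    fix i :: 2
    show "\<bar>\<Sum>j\<in>UNIV. G $ i $ j * (v $ i * v $ j)\<bar> \<le> (\<Sum>j\<in>UNIV. \<bar>G $ i $ j\<bar> * (norm v)\<^sup>2)"
    proof (rule order_trans[OF sum_abs], rule sum_mono)
      fix j :: 2
      have "\<bar>v $ i\<bar> * \<bar>v $ j\<bar> \<le> norm v * norm v"
        by (intro mult_mono component_le_norm_cart) auto
      then show "\<bar>G $ i $ j * (v $ i * v $ j)\<bar> \<le> \<bar>G $ i $ j\<bar> * (norm v)\<^sup>2"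
        unfolding abs_mult power2_eq_square by (intro mult_left_mono) auto
    qed
  qed
  finally show ?thesis by (simp add: sum_distrib_right)
qed

text \<open>The upper triangular Cholesky factor: its rows come from completing the square in
  \<open>v $ 1\<close>, and its determinant is \<open>s * (t / s) = t\<close>. As a linear change of
  coordinates, \<open>B\<close> makes the metric at one point Euclidean.\<close>

lemma cholesky_2:
  fixes G :: "real^2^2"
  assumes "transpose G = G" "\<And>v. v \<noteq> 0 \<Longrightarrow> 0 < v \<bullet> (G *v v)"
  obtains B :: "real^2^2" where "det B = sqrt (det G)" "\<And>v. v \<bullet> (G *v v) = (norm (B *v v))\<^sup>2"
proof -
  define a b d where "a = G $ 1 $ 1" and "b = G $ 1 $ 2" and "d = det G"
  have pos: "0 < a" "0 < d" using det_pos_def_2[OF assms] by (simp_all add: a_def d_def)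
  have sym: "G $ 2 $ 1 = b"
    using arg_cong[OF assms(1), of "\<lambda>G. G $ 1 $ 2"] by (simp add: transpose_def b_def)
  have c: "G $ 2 $ 2 = (b\<^sup>2 + d) / a"
    using pos by (simp add: d_def det_2 sym a_def[symmetric] b_def[symmetric] field_simps power2_eq_square)
  define s where "s = sqrt a"
  define t where "t = sqrt d"
  have st: "0 < s" "0 < t" "a = s\<^sup>2" "d = t\<^sup>2" using pos by (auto simp: s_def t_def)
  define B :: "real^2^2" where "B = vector [vector [s, b / s], vector [0, t / s]]"
  have "det B = sqrt (det G)"
    using st unfolding d_def[symmetric] by (simp add: B_def det_2)
  moreover have "v \<bullet> (G *v v) = (norm (B *v v))\<^sup>2" for v
  proof -
    have "v \<bullet> (G *v v) = s\<^sup>2 * (v $ 1)\<^sup>2 + 2 * b * v $ 1 * v $ 2 + (b\<^sup>2 + t\<^sup>2) / s\<^sup>2 * (v $ 2)\<^sup>2"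
      using st by (simp add: inner_vec_def matrix_vector_mult_def sum_2 sym c a_def[symmetric] b_def[symmetric]
          power2_eq_square algebra_simps)
    also have "\<dots> = (s * v $ 1 + b / s * v $ 2)\<^sup>2 + (t / s * v $ 2)\<^sup>2"
      using st(1) by (simp add: field_simps power2_eq_square)
    also have "\<dots> = (norm (B *v v))\<^sup>2"
      unfolding power2_norm_eq_inner
      by (simp add: inner_vec_def matrix_vector_mult_def sum_2 B_def power2_eq_square)
    finally show ?thesis .
  qed
  ultimately show thesis by (rule that)
qed

context riemannian_surface
begin

text \<open>Bounds on one side suffice: a lower bound for the metric bounds gradients from above,
  and an upper bound for the density does the same for the volume. Since
  \<open>norm (B *v v)\<close> is at least \<open>b * norm v\<close>, entries of the metric within
  \<open>\<epsilon> * b\<^sup>2\<close> in total give an error that is small relative to the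
  form.\<close>

lemma metric_nearly_constant:
  assumes \<kappa>: "\<kappa> \<in> \<A>" "x0 \<in> fst \<kappa>" and \<epsilon>: "0 < \<epsilon>"
  obtains B :: "real^2^2" and \<rho> where "0 < det B" "0 < \<rho>"
    "\<And>x v. x \<in> fst \<kappa> \<Longrightarrow> dist (snd \<kappa> x) (snd \<kappa> x0) < \<rho> \<Longrightarrow>
      (1 - \<epsilon>) * (norm (B *v v))\<^sup>2 \<le> v \<bullet> (g \<kappa> (snd \<kappa> x) *v v)"
    "\<And>x. x \<in> fst \<kappa> \<Longrightarrow> dist (snd \<kappa> x) (snd \<kappa> x0) < \<rho> \<Longrightarrow>
      area_density \<kappa> (snd \<kappa> x) \<le> (1 + \<epsilon>) * det B"
proof -
  let ?p = "snd \<kappa> x0" and ?\<Omega> = "snd \<kappa> ` fst \<kappa>"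
  obtain B :: "real^2^2" where B: "det B = sqrt (det (g \<kappa> ?p))"
      "\<And>v. v \<bullet> (g \<kappa> ?p *v v) = (norm (B *v v))\<^sup>2"
    by (rule cholesky_2[OF metric_symmetric[OF \<kappa>] metric_positive[OF \<kappa>]]) blast+
  have detB: "0 < det B" using B(1) metric_det_pos[OF \<kappa>] by simp
  have "inj ((*v) B)"
    using detB invertible_det_nz[of B] inj_matrix_vector_mult by force
  then obtain b where b: "b > 0" "\<And>v. b * norm v \<le> norm (B *v v)"
    using linear_inj_bounded_below_pos[OF matrix_vector_mul_linear] by blast
  define E where "E = (\<lambda>p. \<Sum>i\<in>UNIV. \<Sum>j\<in>UNIV. \<bar>(g \<kappa> p - g \<kappa> ?p) $ i $ j\<bar>)"
  have "continuous_on ?\<Omega> (\<lambda>p. g \<kappa> p $ i $ j)" for i j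
    by (rule continuous_on_component[OF continuous_on_component[OF continuous_on_metric[OF \<kappa>(1)]]])
  then have contE: "continuous_on ?\<Omega> E"
    unfolding E_def vector_minus_component
    by (intro continuous_on_sum continuous_on_rabs continuous_on_diff continuous_on_const)
  have p: "?p \<in> ?\<Omega>" using \<kappa>(2) by blast
  have E0: "E ?p = 0" by (simp add: E_def)
  have "0 < \<epsilon> * b\<^sup>2" using \<epsilon> b(1) by simp
  then obtain \<rho>1 where \<rho>1: "\<rho>1 > 0" "\<And>q. q \<in> ?\<Omega> \<Longrightarrow> dist q ?p < \<rho>1 \<Longrightarrow> dist (E q) (E ?p) < \<epsilon> * b\<^sup>2"
    using contE p unfolding continuous_on_iff by meson
  have "0 < \<epsilon> * det B" using \<epsilon> detB by simp
  then obtain \<rho>2 where \<rho>2: "\<rho>2 > 0"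
      "\<And>q. q \<in> ?\<Omega> \<Longrightarrow> dist q ?p < \<rho>2 \<Longrightarrow> dist (area_density \<kappa> q) (area_density \<kappa> ?p) < \<epsilon> * det B"
    using continuous_on_area_density[OF \<kappa>(1)] p unfolding continuous_on_iff by meson
  show thesis
  proof (rule that[OF detB])
    show "0 < min \<rho>1 \<rho>2" using \<rho>1(1) \<rho>2(1) by simp
    fix x assume x: "x \<in> fst \<kappa>" "dist (snd \<kappa> x) ?p < min \<rho>1 \<rho>2"
    have q: "snd \<kappa> x \<in> ?\<Omega>" using x(1) by blast
    have "dist (area_density \<kappa> (snd \<kappa> x)) (det B) < \<epsilon> * det B"
      using \<rho>2(2)[OF q] x(2) by (simp add: B(1) area_density_def)
    then show "area_density \<kappa> (snd \<kappa> x) \<le> (1 + \<epsilon>) * det B"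
      by (simp add: dist_real_def distrib_right abs_less_iff)
    have Eq: "E (snd \<kappa> x) \<le> \<epsilon> * b\<^sup>2"
      using \<rho>1(2)[OF q] x(2) E0 by (simp add: dist_real_def abs_less_iff)
    fix v
    have "(b * norm v)\<^sup>2 \<le> (norm (B *v v))\<^sup>2"
      using b by (intro power_mono) auto
    then have "\<epsilon> * (b * norm v)\<^sup>2 \<le> \<epsilon> * (norm (B *v v))\<^sup>2"
      using \<epsilon> by (intro mult_left_mono) auto
    moreover have "E (snd \<kappa> x) * (norm v)\<^sup>2 \<le> \<epsilon> * (b * norm v)\<^sup>2"
      using mult_right_mono[OF Eq, of "(norm v)\<^sup>2"] by (simp add: power_mult_distrib mult.assoc)
    moreover have "\<bar>v \<bullet> ((g \<kappa> (snd \<kappa> x) - g \<kappa> ?p) *v v)\<bar> \<le> E (snd \<kappa> x) * (norm v)\<^sup>2"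
      unfolding E_def by (rule quadratic_form_le)
    moreover have "v \<bullet> ((g \<kappa> (snd \<kappa> x) - g \<kappa> ?p) *v v) =
        v \<bullet> (g \<kappa> (snd \<kappa> x) *v v) - (norm (B *v v))\<^sup>2"
      by (simp add: matrix_vector_mult_diff_rdistrib inner_diff_right B(2))
    ultimately show "(1 - \<epsilon>) * (norm (B *v v))\<^sup>2 \<le> v \<bullet> (g \<kappa> (snd \<kappa> x) *v v)"
      unfolding left_diff_distrib by (simp add: abs_le_iff)
  qed
qed

end

section \<open>Functions on the plane transplanted to the surface\<close>

lemma euclidean_gradient_eqI:
  assumes "(f has_derivative (\<lambda>v. e \<bullet> v)) (at y)"
  shows "euclidean_gradient f y = e"
  by (simp add: euclidean_gradient_def frechet_derivative_at[OF assms, symmetric] inner_axis vec_eq_iff)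

lemma has_derivative_euclidean_gradient:
  assumes "Ck_on (Suc 0) UNIV f"
  shows "(f has_derivative (\<lambda>v. euclidean_gradient f y \<bullet> v)) (at y)"
proof -
  have d: "(f has_derivative frechet_derivative f (at y)) (at y)"
    by (rule Ck_on_Suc_has_derivative[OF assms UNIV_I])
  have "frechet_derivative f (at y) = (\<lambda>v. euclidean_gradient f y \<bullet> v)"
    unfolding euclidean_gradient_def
    by (rule ext) (rule linear_functional_as_inner[OF has_derivative_linear[OF d]])
  with d show ?thesis by simp
qed

lemma borel_measurable_gradient:
  assumes "Ck_on (Suc 0) UNIV f"
  shows "(\<lambda>y. (norm (euclidean_gradient f y))\<^sup>2) \<in> borel_measurable borel"
proof -
  have "continuous_on UNIV (\<lambda>y. frechet_derivative f (at y) v)" for v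
    using assms by simp
  then have "(\<lambda>y. frechet_derivative f (at y) v) \<in> borel_measurable borel" for v
    by (rule borel_measurable_continuous_onI)
  then show ?thesis
    unfolding power2_norm_eq_inner inner_vec_def euclidean_gradient_def by simp
qed

text \<open>In the coordinates \<open>B *v (snd \<kappa> x - p0)\<close> the metric is within \<open>\<epsilon>\<close> of the Euclidean one on
  the ball of radius \<open>r\<close>. This replaces isothermal coordinates; only the Dirichlet energy up to a
  factor close to one matters.\<close>

locale almost_euclidean_chart = riemannian_surface M \<A> g
  for M :: "'a::topological_space set" and \<A> and g +
  fixes \<kappa> :: "'a chart" and B :: "real^2^2" and p0 :: "real^2" and r \<epsilon> :: real
  assumes chart: "\<kappa> \<in> \<A>"
    and \<epsilon>: "0 < \<epsilon>" "\<epsilon> < 1"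
    and det_pos: "0 < det B"
    and ball_subset: "{p \<in> half_plane. norm (B *v (p - p0)) \<le> r} \<subseteq> snd \<kappa> ` fst \<kappa>"
    and metric_ge: "\<And>x v. x \<in> fst \<kappa> \<Longrightarrow> norm (B *v (snd \<kappa> x - p0)) \<le> r \<Longrightarrow>
      (1 - \<epsilon>) * (norm (B *v v))\<^sup>2 \<le> v \<bullet> (g \<kappa> (snd \<kappa> x) *v v)"
    and density_le: "\<And>x. x \<in> fst \<kappa> \<Longrightarrow> norm (B *v (snd \<kappa> x - p0)) \<le> r \<Longrightarrow>
      area_density \<kappa> (snd \<kappa> x) \<le> (1 + \<epsilon>) * det B"
begin

definition coord :: "'a \<Rightarrow> real^2" where
  "coord x = B *v (snd \<kappa> x - p0)"

definition extend :: "(real^2 \<Rightarrow> real) \<Rightarrow> 'a \<Rightarrow> real" where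
  "extend f x = (if x \<in> fst \<kappa> then f (coord x) else 0)"

text \<open>Smoothness is required on the whole plane, with no condition on the edge of the
  half-plane. At a boundary point only the restriction to a part of the disc is transplanted, and
  test functions are free on the boundary.\<close>

definition supported :: "(real^2 \<Rightarrow> real) \<Rightarrow> bool" where
  "supported f \<longleftrightarrow> (\<forall>n. Ck_on n UNIV f) \<and> (\<forall>y. r < norm y \<longrightarrow> f y = 0)"

lemma supported_smooth: "supported f \<Longrightarrow> Ck_on n UNIV f"
  by (simp add: supported_def)

lemma inj_B: "inj ((*v) B)"
  using det_pos invertible_det_nz[of B] inj_matrix_vector_mult by force

lemma continuous_on_coord: "continuous_on (fst \<kappa>) coord"
  unfolding coord_def
  by (intro bounded_linear.continuous_on[OF matrix_vector_mul_bounded_linear]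
      continuous_on_diff continuous_on_const homeomorphism_cont1[OF chart_homeo[OF chart]])

lemma inj_on_coord: "inj_on coord (fst \<kappa>)"
proof (rule inj_onI)
  fix x y assume xy: "x \<in> fst \<kappa>" "y \<in> fst \<kappa>" "coord x = coord y"
  then have "snd \<kappa> x - p0 = snd \<kappa> y - p0" using injD[OF inj_B] unfolding coord_def by blast
  then show "x = y" using inj_onD[OF chart_inj[OF chart] _ xy(1,2)] by simp
qed

lemma compact_support: "compact {x \<in> fst \<kappa>. norm (coord x) \<le> r}"
proof -
  let ?C = "{p \<in> half_plane. norm (B *v (p - p0)) \<le> r}"
  obtain b where b: "b > 0" "\<And>v. b * norm v \<le> norm (B *v v)"
    using linear_inj_bounded_below_pos[OF matrix_vector_mul_linear inj_B] by blast
  have "bounded ?C"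
  proof (rule boundedI)
    fix p assume "p \<in> ?C"
    then have "b * norm (p - p0) \<le> r" using b(2)[of "p - p0"] by simp
    then have "norm (p - p0) \<le> r / b" using b(1) by (simp add: field_simps)
    then show "norm p \<le> r / b + norm p0" using norm_triangle_sub[of p p0] by linarith
  qed
  moreover have "closed ?C"
  proof -
    have "closed {p. norm (B *v (p - p0)) \<le> r}"
      by (intro closed_Collect_le continuous_on_norm continuous_on_const continuous_on_diff continuous_on_id
          bounded_linear.continuous_on[OF matrix_vector_mul_bounded_linear])
    then have "closed (half_plane \<inter> {p. norm (B *v (p - p0)) \<le> r})"
      by (rule closed_Int[OF closed_half_plane])
    then show ?thesis by (simp add: Collect_conj_eq[symmetric] Int_def)
  qed
  ultimately have "compact ?C" by (simp add: compact_eq_bounded_closed)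
  then have "compact (chart_inv \<kappa> ` ?C)"
    by (rule compact_continuous_image[rotated])
      (rule continuous_on_subset[OF homeomorphism_cont2[OF chart_homeo[OF chart]] ball_subset])
  also have "chart_inv \<kappa> ` ?C = {x \<in> fst \<kappa>. norm (coord x) \<le> r}"
  proof
    show "chart_inv \<kappa> ` ?C \<subseteq> {x \<in> fst \<kappa>. norm (coord x) \<le> r}"
    proof
      fix x assume "x \<in> chart_inv \<kappa> ` ?C"
      then obtain p where p: "p \<in> ?C" "x = chart_inv \<kappa> p" by blast
      then obtain y where y: "y \<in> fst \<kappa>" "p = snd \<kappa> y" using ball_subset by blast
      then have "x = y" using p(2) chart_inv_snd[OF chart] by simp
      then show "x \<in> {x \<in> fst \<kappa>. norm (coord x) \<le> r}" using p y by (simp add: coord_def)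
    qed
    show "{x \<in> fst \<kappa>. norm (coord x) \<le> r} \<subseteq> chart_inv \<kappa> ` ?C"
    proof
      fix x assume "x \<in> {x \<in> fst \<kappa>. norm (coord x) \<le> r}"
      then have x: "x \<in> fst \<kappa>" "norm (coord x) \<le> r" by auto
      have "snd \<kappa> x \<in> half_plane" using chart_image_half_plane[OF chart] x(1) by blast
      then show "x \<in> chart_inv \<kappa> ` ?C"
        using x chart_inv_snd[OF chart x(1)] by (intro image_eqI[of _ _ "snd \<kappa> x"]) (simp_all add: coord_def)
    qed
  qed
  finally show ?thesis .
qed

text \<open>The support is compact, hence closed since \<open>M\<close> is Hausdorff. Its complement
  is thus an open set that contains everything outside the chart, which is why extension by zero
  preserves smoothness.\<close>

lemma openin_off_support: "openin (top_of_set M) (M - {x \<in> fst \<kappa>. norm (coord x) \<le> r})"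
proof -
  have "Hausdorff_space (top_of_set M)" using smooth_surface unfolding smooth_surface_def by blast
  moreover have "compactin (top_of_set M) {x \<in> fst \<kappa>. norm (coord x) \<le> r}"
    using compact_support chart_subset[OF chart] by (simp add: compactin_subtopology subset_iff)
  ultimately have "closedin (top_of_set M) {x \<in> fst \<kappa>. norm (coord x) \<le> r}"
    by (rule compactin_imp_closedin)
  then show ?thesis by (simp add: closedin_def)
qed

lemma extend_off_support:
  assumes "supported f" "x \<in> M - {x \<in> fst \<kappa>. norm (coord x) \<le> r}"
  shows "extend f x = 0"
  using assms by (auto simp: extend_def supported_def)

lemma continuous_on_extend:
  assumes f: "supported f"
  shows "continuous_on M (extend f)"
proof -
  let ?O = "M - {x \<in> fst \<kappa>. norm (coord x) \<le> r}"
  have M: "M = fst \<kappa> \<union> ?O" using chart_subset[OF chart] by blast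
  have "continuous_on UNIV f" using f unfolding supported_def by (metis Ck_on.simps(1))
  then have "continuous_on (fst \<kappa>) (\<lambda>x. f (coord x))"
    by (rule continuous_on_compose2[OF _ continuous_on_coord]) simp
  then have 1: "continuous_on (fst \<kappa>) (extend f)"
    by (rule continuous_on_cong[THEN iffD1, OF refl _, rotated]) (simp add: extend_def)
  have 2: "continuous_on ?O (extend f)"
    by (rule continuous_on_cong[THEN iffD1, OF refl _ continuous_on_const[of _ 0]])
      (simp add: extend_off_support[OF f])
  have "continuous_on (fst \<kappa> \<union> ?O) (extend f)"
    by (rule continuous_on_Un_local_open[OF _ _ 1 2])
      (use chart_openin[OF chart] openin_off_support M in simp_all)
  then show ?thesis using M by simp
qed

lemma Ck_on_coord:
  fixes f :: "real^2 \<Rightarrow> real"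
  assumes "open W" "Ck_on n W h" "Ck_on n UNIV f"
  shows "Ck_on n W (\<lambda>y. f (B *v (h y - p0)))"
proof -
  have "Ck_on n W (\<lambda>y. B *v (h y + (- p0)))"
    by (rule Ck_on_bounded_linear[OF assms(1) matrix_vector_mul_bounded_linear
          Ck_on_add[OF assms(1,2) Ck_on_const]])
  then show ?thesis
    using Ck_on_compose[of W "\<lambda>y. B *v (h y + (- p0))" UNIV n f] assms(1,3) by simp
qed

lemma test_function_extend:
  assumes f: "supported f"
  shows "test_function M \<A> (extend f)"
  unfolding test_function_def
proof (intro conjI ballI)
  fix \<kappa>' assume \<kappa>': "\<kappa>' \<in> \<A>"
  let ?S = "snd \<kappa>' ` (fst \<kappa>' \<inter> surface_interior \<A>)"
  let ?O = "M - {x \<in> fst \<kappa>. norm (coord x) \<le> r}"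
  have S: "?S \<subseteq> half_plane" using chart_image_half_plane[OF \<kappa>'] by blast
  show "smooth_on ?S (extend f \<circ> chart_inv \<kappa>')"
    unfolding smooth_on_def
  proof
    fix q assume "q \<in> ?S"
    then obtain x where x: "x \<in> fst \<kappa>'" "x \<in> surface_interior \<A>" "q = snd \<kappa>' x" by blast
    show "\<exists>W h. open W \<and> q \<in> W \<and> (\<forall>n. Ck_on n W h) \<and>
        (\<forall>y\<in>W \<inter> ?S. h y = (extend f \<circ> chart_inv \<kappa>') y)"
    proof (cases "x \<in> fst \<kappa>")
      case True
      let ?S' = "snd \<kappa>' ` (fst \<kappa>' \<inter> fst \<kappa>)"
      have "smooth_on ?S' (snd \<kappa> \<circ> chart_inv \<kappa>')"
        using smooth_surface \<kappa>' chart unfolding smooth_surface_def by blast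
      moreover have "q \<in> ?S'" using x True by blast
      ultimately obtain W h where W: "open W" "q \<in> W" "\<And>n. Ck_on n W h"
          "\<And>y. y \<in> W \<inter> ?S' \<Longrightarrow> h y = (snd \<kappa> \<circ> chart_inv \<kappa>') y"
        unfolding smooth_on_def by meson
      \<comment> \<open>The map \<open>h\<close> agrees with the transition map on the overlap only.
        Within the half-plane, intersecting with \<open>T\<close> restricts the neighbourhood to the
        overlap.\<close>
      obtain T where T: "open T" "?S' = half_plane \<inter> T"
        using openin_image_half_plane[OF \<kappa>' openin_chart_Int[OF \<kappa>' chart] Int_lower1]
        unfolding openin_open by blast
      show ?thesis
      proof (intro exI conjI allI ballI)
        show "open (W \<inter> T)" by (rule open_Int[OF W(1) T(1)])
        show "q \<in> W \<inter> T" using W(2) \<open>q \<in> ?S'\<close> T(2) by blast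
        show "Ck_on n (W \<inter> T) (\<lambda>y. f (B *v (h y - p0)))" for n
          by (rule Ck_on_coord[OF open_Int[OF W(1) T(1)] Ck_on_subset[OF W(3) Int_lower1]])
            (use f in \<open>simp add: supported_def\<close>)
        fix y assume y: "y \<in> W \<inter> T \<inter> ?S"
        then have yS: "y \<in> ?S'" using S T(2) by blast
        then obtain z where z: "z \<in> fst \<kappa>'" "z \<in> fst \<kappa>" "y = snd \<kappa>' z" by blast
        have "h y = snd \<kappa> z" using W(4)[of y] y yS chart_inv_snd[OF \<kappa>' z(1)] z(3) by simp
        then show "f (B *v (h y - p0)) = (extend f \<circ> chart_inv \<kappa>') y"
          using z chart_inv_snd[OF \<kappa>' z(1)] by (simp add: extend_def coord_def)
      qed
    next
      case False
      have "openin (top_of_set M) (?O \<inter> fst \<kappa>')"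
        by (rule openin_Int[OF openin_off_support chart_openin[OF \<kappa>']])
      from openin_image_half_plane[OF \<kappa>' this Int_lower2]
      obtain T where T: "open T" "snd \<kappa>' ` (?O \<inter> fst \<kappa>') = half_plane \<inter> T"
        unfolding openin_open by blast
      have "x \<in> ?O \<inter> fst \<kappa>'" using x(1) False chart_subset[OF \<kappa>'] by blast
      then have "q \<in> T" using T(2) x(3) by blast
      show ?thesis
      proof (intro exI conjI allI ballI)
        show "Ck_on n T (\<lambda>y. 0)" for n by (rule Ck_on_const)
        fix y assume y: "y \<in> T \<inter> ?S"
        then have "y \<in> snd \<kappa>' ` (?O \<inter> fst \<kappa>')" using S T(2) by blast
        then obtain z where z: "z \<in> ?O" "z \<in> fst \<kappa>'" "y = snd \<kappa>' z" by blast
        then show "0 = (extend f \<circ> chart_inv \<kappa>') y"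
          using extend_off_support[OF f z(1)] chart_inv_snd[OF \<kappa>' z(2)] by simp
      qed (fact T(1) \<open>q \<in> T\<close>)+
    qed
  qed
qed (rule continuous_on_extend[OF f])

lemma gradient_off_support:
  assumes "supported f" "r < norm y"
  shows "euclidean_gradient f y = 0"
proof -
  have "open {y. r < norm y}" by (intro open_Collect_less continuous_intros)
  then have "(f has_derivative (\<lambda>v. 0)) (at y)"
    by (rule has_derivative_transform_within_open[OF has_derivative_const[of 0]])
      (use assms in \<open>auto simp: supported_def\<close>)
  then have "frechet_derivative f (at y) = (\<lambda>v. 0)"
    by (rule frechet_derivative_at[symmetric])
  then show ?thesis by (simp add: euclidean_gradient_def vec_eq_iff)
qed

text \<open>Let Q be the squared gradient norm, \<open>w\<close> the gradient in the chart and
  \<open>e\<close> the Euclidean gradient of \<open>f\<close>. Cauchy-Schwarz gives Q \<le> |e| |B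
  w|, and (1 - \<epsilon>) |B w|^2 \<le> Q because the metric is nearly Euclidean; together Q \<le>
  |e|^2 / (1 - \<epsilon>).\<close>

lemma grad_norm_sq_extend_le:
  assumes f: "supported f" and x: "x \<in> surface_interior \<A>"
  shows "ennreal (grad_norm_sq \<A> g (extend f) x) \<le>
    ennreal ((norm (euclidean_gradient f (B *v (snd \<kappa> x - p0))))\<^sup>2 / (1 - \<epsilon>)) * indicator (fst \<kappa>) x"
proof (cases "x \<in> fst \<kappa>")
  case True
  define e where "e = euclidean_gradient f (coord x)"
  have D: "((\<lambda>p. f (B *v (p - p0))) has_derivative (\<lambda>v. e \<bullet> (B *v v))) (at (snd \<kappa> x))"
  proof -
    have "((\<lambda>p. B *v (p - p0)) has_derivative (\<lambda>v. B *v v)) (at (snd \<kappa> x))"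
      by (rule bounded_linear.has_derivative[OF matrix_vector_mul_bounded_linear])
        (auto intro!: derivative_eq_intros)
    from has_derivative_compose[OF this has_derivative_euclidean_gradient[OF supported_smooth[OF f]]]
    show ?thesis by (simp add: e_def coord_def)
  qed
  obtain w where w: "\<And>v. e \<bullet> (B *v v) = v \<bullet> (g \<kappa> (snd \<kappa> x) *v w)"
    by (rule gradient_vector_exists[OF chart True has_derivative_linear[OF D]]) blast
  have Q: "grad_norm_sq \<A> g (extend f) x = w \<bullet> (g \<kappa> (snd \<kappa> x) *v w)"
    by (rule grad_norm_sq_chart[OF chart chart_openin[OF chart] order_refl True x _ D w])
      (simp add: extend_def coord_def)
  have "w \<bullet> (g \<kappa> (snd \<kappa> x) *v w) \<le> (norm e)\<^sup>2 / (1 - \<epsilon>)"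
  proof (cases "r < norm (coord x)")
    case True
    then have "e = 0" unfolding e_def by (rule gradient_off_support[OF f])
    then show ?thesis using w[of w] by simp
  next
    case False
    define a where "a = norm (B *v w)"
    have "(1 - \<epsilon>) * a\<^sup>2 \<le> w \<bullet> (g \<kappa> (snd \<kappa> x) *v w)"
      unfolding a_def by (rule metric_ge[OF \<open>x \<in> fst \<kappa>\<close>]) (use False in \<open>simp add: coord_def\<close>)
    moreover have "w \<bullet> (g \<kappa> (snd \<kappa> x) *v w) \<le> norm e * a"
      unfolding w[of w, symmetric] a_def by (rule norm_cauchy_schwarz)
    \<comment> \<open>The arithmetic-geometric mean inequality eliminates \<open>a\<close> without
      dividing by it.\<close>
    moreover have "2 * ((1 - \<epsilon>) * (norm e * a)) \<le> (norm e)\<^sup>2 + (1 - \<epsilon>) * ((1 - \<epsilon>) * a\<^sup>2)"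
      using zero_le_power2[of "norm e - (1 - \<epsilon>) * a"] by (simp add: power2_eq_square algebra_simps)
    ultimately have "(1 - \<epsilon>) * (w \<bullet> (g \<kappa> (snd \<kappa> x) *v w)) \<le> (norm e)\<^sup>2"
      using \<epsilon> mult_left_mono[of "(1 - \<epsilon>) * a\<^sup>2" "w \<bullet> (g \<kappa> (snd \<kappa> x) *v w)" "1 - \<epsilon>"]
        mult_left_mono[of "w \<bullet> (g \<kappa> (snd \<kappa> x) *v w)" "norm e * a" "1 - \<epsilon>"] by linarith
    then show ?thesis using \<epsilon> by (simp add: pos_le_divide_eq mult.commute)
  qed
  then show ?thesis
    using True by (simp add: Q e_def coord_def ennreal_leI)
next
  case False
  have "grad_norm_sq \<A> g (extend f) x = 0"
    by (rule grad_norm_sq_locally_constant[OF openin_off_support _ x extend_off_support[OF f]])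
      (use False interior_subset x in auto)
  then show ?thesis by simp
qed

text \<open>The factor collects 1 / (1 - \<epsilon>) from the gradient and 1 + \<epsilon> from the
  density, whose \<open>det B\<close> is the Jacobian of the affine coordinates. The integral is
  enlarged from the image of the chart to the whole plane, so half-discs at the boundary are treated
  like discs.\<close>

lemma nn_integral_gradient_le:
  assumes f: "supported f"
  shows "(\<integral>\<^sup>+x. ennreal ((norm (euclidean_gradient f (B *v (snd \<kappa> x - p0))))\<^sup>2 / (1 - \<epsilon>)) *
      indicator (fst \<kappa>) x \<partial>vol) \<le>
    ennreal ((1 + \<epsilon>) / (1 - \<epsilon>)) * (\<integral>\<^sup>+y. ennreal ((norm (euclidean_gradient f y))\<^sup>2) \<partial>lborel)"
proof -
  define N where "N = (\<lambda>y. (norm (euclidean_gradient f y))\<^sup>2)"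
  have N: "N \<in> borel_measurable borel" unfolding N_def by (rule borel_measurable_gradient[OF supported_smooth[OF f]])
  have T: "(\<lambda>p. B *v (p - p0)) \<in> borel_measurable borel"
    by (intro borel_measurable_continuous_onI continuous_on_const continuous_on_diff continuous_on_id
        bounded_linear.continuous_on[OF matrix_vector_mul_bounded_linear])
  have NT: "(\<lambda>p. N (B *v (p - p0))) \<in> borel_measurable borel"
    using measurable_compose[OF T N] .
  have "(\<integral>\<^sup>+x. ennreal (N (B *v (snd \<kappa> x - p0)) / (1 - \<epsilon>)) * indicator (fst \<kappa>) x \<partial>vol) =
      (\<integral>\<^sup>+p\<in>snd \<kappa> ` fst \<kappa>. ennreal (N (B *v (p - p0)) / (1 - \<epsilon>)) * ennreal (area_density \<kappa> p) \<partial>lborel)"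
    by (rule nn_integral_vol_chart[OF chart, where h = "\<lambda>p. ennreal (N (B *v (p - p0)) / (1 - \<epsilon>))"])
      (use NT in measurable)
  also have "\<dots> \<le> (\<integral>\<^sup>+p. ennreal ((1 + \<epsilon>) / (1 - \<epsilon>)) * ennreal (\<bar>det B\<bar> * N (B *v (p - p0))) \<partial>lborel)"
  proof (rule nn_integral_mono)
    fix p
    show "ennreal (N (B *v (p - p0)) / (1 - \<epsilon>)) * ennreal (area_density \<kappa> p) * indicator (snd \<kappa> ` fst \<kappa>) p
        \<le> ennreal ((1 + \<epsilon>) / (1 - \<epsilon>)) * ennreal (\<bar>det B\<bar> * N (B *v (p - p0)))"
    proof (cases "p \<in> snd \<kappa> ` fst \<kappa> \<and> norm (B *v (p - p0)) \<le> r")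
      case True
      then obtain x where x: "x \<in> fst \<kappa>" "p = snd \<kappa> x" by blast
      have le: "area_density \<kappa> p \<le> (1 + \<epsilon>) * det B"
        using density_le[OF x(1)] True x(2) by simp
      have nn: "0 \<le> N (B *v (p - p0))" by (simp add: N_def)
      have "N (B *v (p - p0)) / (1 - \<epsilon>) * area_density \<kappa> p \<le> N (B *v (p - p0)) / (1 - \<epsilon>) * ((1 + \<epsilon>) * det B)"
        using \<epsilon> nn by (intro mult_left_mono le) auto
      also have "\<dots> = (1 + \<epsilon>) / (1 - \<epsilon>) * (\<bar>det B\<bar> * N (B *v (p - p0)))"
        using det_pos by simp
      finally have "ennreal (N (B *v (p - p0)) / (1 - \<epsilon>) * area_density \<kappa> p) \<le>
          ennreal ((1 + \<epsilon>) / (1 - \<epsilon>) * (\<bar>det B\<bar> * N (B *v (p - p0))))"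
        by (rule ennreal_leI)
      moreover have "0 \<le> area_density \<kappa> p" using area_density_nonneg[OF chart] True by blast
      ultimately show ?thesis
        using True \<epsilon> nn by (simp add: ennreal_mult'[symmetric] ennreal_mult''[symmetric])
    next
      case False
      then have "N (B *v (p - p0)) = 0 \<or> p \<notin> snd \<kappa> ` fst \<kappa>"
        using gradient_off_support[OF f] unfolding N_def by force
      then show ?thesis by auto
    qed
  qed
  also have "\<dots> = ennreal ((1 + \<epsilon>) / (1 - \<epsilon>)) * (\<integral>\<^sup>+p. ennreal (\<bar>det B\<bar> * N (B *v (p - p0))) \<partial>lborel)"
    by (rule nn_integral_cmult) (use NT in measurable)
  also have "(\<integral>\<^sup>+p. ennreal (\<bar>det B\<bar> * N (B *v (p - p0))) \<partial>lborel) = (\<integral>\<^sup>+y. ennreal (N y) \<partial>lborel)"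
  proof -
    let ?T = "\<lambda>p. B *v (p - p0)"
    have surj: "range ?T = UNIV"
    proof -
      have "surj ((*v) B)" using linear_inj_imp_surj[OF matrix_vector_mul_linear inj_B] .
      then have "\<exists>p. y = ?T p" for y
        by (metis add_diff_cancel_right' surjD)
      then show ?thesis by auto
    qed
    have "(\<integral>\<^sup>+y\<in>range ?T. ennreal (N y) \<partial>lborel) =
      (\<integral>\<^sup>+p\<in>UNIV. ennreal (\<bar>det (matrix ((*v) B))\<bar> * N (?T p)) \<partial>lborel)"
    proof (rule nn_integral_change_of_variables)
      show "(?T has_derivative (*v) B) (at p within UNIV)" for p
        by (rule bounded_linear.has_derivative[OF matrix_vector_mul_bounded_linear])
          (auto intro!: derivative_eq_intros)
      show "inj ?T"
        by (rule injI) (use injD[OF inj_B] in fastforce)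
      show "(\<lambda>y. N y * indicator (range ?T) y) \<in> borel_measurable borel"
        unfolding surj using N by simp
      show "(\<lambda>p. \<bar>det (matrix ((*v) B))\<bar> * N (?T p) * indicator UNIV p) \<in> borel_measurable borel"
        using NT by simp
    qed (auto simp: N_def)
    then show ?thesis unfolding surj by (simp add: matrix_of_matrix_vector_mul)
  qed
  finally show ?thesis unfolding N_def .
qed

lemma eigenvalue_1_extend_variance_le:
  assumes "g = (SOME g. g \<in> c)" "sets \<mu> = sets borel_M" "emeasure \<mu> M = 1" and f: "supported f"
  shows "eigenvalue M \<A> c 1 \<mu> * ennreal (\<integral>x. (extend f x - (\<integral>x. extend f x \<partial>\<mu>))\<^sup>2 \<partial>\<mu>) \<le>
    ennreal ((1 + \<epsilon>) / (1 - \<epsilon>)) * (\<integral>\<^sup>+y. ennreal ((norm (euclidean_gradient f y))\<^sup>2) \<partial>lborel)"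
proof (rule order_trans[OF eigenvalue_1_variance_le[OF assms(1-3) test_function_extend[OF f] _
        grad_norm_sq_extend_le[OF f]] nn_integral_gradient_le[OF f]])
  have T: "(\<lambda>p. B *v (p - p0)) \<in> borel_measurable borel"
    by (intro borel_measurable_continuous_onI continuous_on_const continuous_on_diff continuous_on_id
        bounded_linear.continuous_on[OF matrix_vector_mul_bounded_linear])
  show "(\<lambda>x. ennreal ((norm (euclidean_gradient f (B *v (snd \<kappa> x - p0))))\<^sup>2 / (1 - \<epsilon>)) * indicator (fst \<kappa>) x)
      \<in> borel_measurable vol"
    by (rule borel_measurable_chart_indicator[OF chart,
          where h = "\<lambda>p. ennreal ((norm (euclidean_gradient f (B *v (p - p0))))\<^sup>2 / (1 - \<epsilon>))"])
      (use measurable_compose[OF T borel_measurable_gradient[OF supported_smooth[OF f]]] in measurable)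
qed assumption

end

context riemannian_surface
begin

lemma almost_euclidean_chart_exists:
  assumes "x0 \<in> M" "0 < \<epsilon>" "\<epsilon> < 1"
  obtains \<kappa> B r where "almost_euclidean_chart M \<A> g \<kappa> B (snd \<kappa> x0) r \<epsilon>" "x0 \<in> fst \<kappa>" "0 < r"
proof -
  obtain \<kappa> where \<kappa>: "\<kappa> \<in> \<A>" "x0 \<in> fst \<kappa>" using ex_chart[OF assms(1)] by blast
  obtain B :: "real^2^2" and \<rho> where B: "0 < det B" "0 < \<rho>"
    "\<And>x v. x \<in> fst \<kappa> \<Longrightarrow> dist (snd \<kappa> x) (snd \<kappa> x0) < \<rho> \<Longrightarrow>
      (1 - \<epsilon>) * (norm (B *v v))\<^sup>2 \<le> v \<bullet> (g \<kappa> (snd \<kappa> x) *v v)"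
    "\<And>x. x \<in> fst \<kappa> \<Longrightarrow> dist (snd \<kappa> x) (snd \<kappa> x0) < \<rho> \<Longrightarrow>
      area_density \<kappa> (snd \<kappa> x) \<le> (1 + \<epsilon>) * det B"
    by (rule metric_nearly_constant[OF \<kappa> assms(2)]) blast
  have "inj ((*v) B)" using B(1) invertible_det_nz[of B] inj_matrix_vector_mult by force
  then obtain b where b: "b > 0" "\<And>v. b * norm v \<le> norm (B *v v)"
    using linear_inj_bounded_below_pos[OF matrix_vector_mul_linear] by blast
  obtain T where T: "open T" "snd \<kappa> ` fst \<kappa> = half_plane \<inter> T"
    using chart_openin_half_plane[OF \<kappa>(1)] unfolding openin_open by blast
  have "snd \<kappa> x0 \<in> T" using T(2) \<kappa>(2) by blast
  then obtain \<rho>' where \<rho>': "\<rho>' > 0" "ball (snd \<kappa> x0) \<rho>' \<subseteq> T"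
    using T(1) open_contains_ball by blast
  \<comment> \<open>Since \<open>B\<close> stretches by at least \<open>b\<close>, the set where
    \<open>norm (B *v (p - snd \<kappa> x0)) \<le> r\<close> lies within distance
    \<open>min \<rho> \<rho>' / 2\<close>, where both the metric bounds and the inclusion in the
    chart hold.\<close>
  define r where "r = b * min \<rho> \<rho>' / 2"
  have r: "0 < r" using b(1) B(2) \<rho>'(1) by (simp add: r_def)
  have near: "dist p (snd \<kappa> x0) < min \<rho> \<rho>'" if "norm (B *v (p - snd \<kappa> x0)) \<le> r" for p
  proof -
    have "b * dist p (snd \<kappa> x0) \<le> b * (min \<rho> \<rho>' / 2)"
      using that b(2)[of "p - snd \<kappa> x0"] by (simp add: r_def dist_norm)
    then have "dist p (snd \<kappa> x0) \<le> min \<rho> \<rho>' / 2" using b(1) by simp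
    then show ?thesis using B(2) \<rho>'(1) by linarith
  qed
  have "almost_euclidean_chart M \<A> g \<kappa> B (snd \<kappa> x0) r \<epsilon>"
  proof (unfold_locales)
    show "{p \<in> half_plane. norm (B *v (p - snd \<kappa> x0)) \<le> r} \<subseteq> snd \<kappa> ` fst \<kappa>"
      using near \<rho>'(2) unfolding T(2) by (auto simp: dist_commute subset_iff)
  qed (use \<kappa> assms B near in \<open>auto simp: less_imp_le\<close>)
  then show thesis using \<kappa>(2) r by (rule that)
qed

end

section \<open>Energies in the Euclidean plane\<close>

text \<open>Discs with squared radius a have area pi a, so \<open>norm\<close> squared carries
  Lebesgue measure of the plane to pi times Lebesgue measure of the half-line. In terms of the
  radius itself the density would not be constant.\<close>

lemma nn_integral_radial:
  fixes f :: "real \<Rightarrow> ennreal"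
  assumes f: "f \<in> borel_measurable borel"
  shows "(\<integral>\<^sup>+y. f ((norm (y::real^2))\<^sup>2) \<partial>lborel) = ennreal pi * (\<integral>\<^sup>+s\<in>{0..}. f s \<partial>lborel)"
proof -
  let ?D = "distr lborel borel (\<lambda>y::real^2. (norm y)\<^sup>2)"
  let ?N = "density lborel (\<lambda>s::real. ennreal pi * indicator {0..} s)"
  have m: "(\<lambda>y::real^2. (norm y)\<^sup>2) \<in> measurable lborel borel" by measurable
  have eq: "emeasure ?D {..a} = emeasure ?N {..a}" "emeasure ?D {..a} < \<infinity>" for a
  proof -
    have D: "emeasure ?D {..a} = emeasure lborel {y::real^2. (norm y)\<^sup>2 \<le> a}"
      using m by (subst emeasure_distr) (auto intro!: arg_cong[where f = "emeasure lborel"])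
    have N: "emeasure ?N {..a} = ennreal pi * emeasure lborel {0..a}"
    proof -
      have "emeasure ?N {..a} = (\<integral>\<^sup>+s. (ennreal pi * indicator {0..} s) * indicator {..a} s \<partial>lborel)"
        by (rule emeasure_density) auto
      also have "\<dots> = (\<integral>\<^sup>+s. ennreal pi * indicator {0..a} s \<partial>lborel)"
        by (rule nn_integral_cong) (auto simp: indicator_def)
      finally show ?thesis by (simp add: nn_integral_cmult)
    qed
    have "emeasure ?D {..a} = emeasure ?N {..a} \<and> emeasure ?D {..a} < \<infinity>"
    proof (cases "0 \<le> a")
      case True
      have "{y::real^2. (norm y)\<^sup>2 \<le> a} = cball 0 (sqrt a)"
        by (auto simp: real_le_rsqrt intro!: sqrt_ge_absD)
      then show ?thesis
        unfolding D N using True by (simp add: emeasure_cball unit_ball_vol_2 ennreal_mult ennreal_mult_less_top)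
    next
      case False
      then have "{y::real^2. (norm y)\<^sup>2 \<le> a} = {}"
        by (auto simp: not_le intro: less_le_trans)
      then show ?thesis unfolding D N using False by simp
    qed
    then show "emeasure ?D {..a} = emeasure ?N {..a}" "emeasure ?D {..a} < \<infinity>" by auto
  qed
  have "?D = ?N"
  proof (rule measure_eqI_generator_eq[where A = "\<lambda>i. {..real i}" and \<Omega> = UNIV and E = "range atMost"])
    show "Int_stable (range atMost :: real set set)"
      by (auto simp: Int_stable_def)
    show "(\<Union>i. {..real i}) = UNIV"
      using real_arch_simple by auto
    show "sets ?D = sigma_sets UNIV (range atMost)"
      unfolding sets_distr by (subst borel_eq_atMost) simp
    show "sets ?N = sigma_sets UNIV (range atMost)"
      unfolding sets_density sets_lborel by (subst borel_eq_atMost) simp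
    show "emeasure ?D {..real i} \<noteq> \<infinity>" for i using eq(2)[of "real i"] by simp
    show "emeasure ?D X = emeasure ?N X" if "X \<in> range atMost" for X using that eq(1) by blast
  qed auto
  have "(\<integral>\<^sup>+y. f ((norm (y::real^2))\<^sup>2) \<partial>lborel) = (\<integral>\<^sup>+s. f s \<partial>?D)"
    by (rule nn_integral_distr[symmetric]) (use m f in auto)
  also have "\<dots> = (\<integral>\<^sup>+s. (ennreal pi * indicator {0..} s) * f s \<partial>lborel)"
    unfolding \<open>?D = ?N\<close> by (rule nn_integral_density) (use f in auto)
  also have "\<dots> = (\<integral>\<^sup>+s. ennreal pi * (f s * indicator {0..} s) \<partial>lborel)"
    by (simp add: mult.commute mult.left_commute)
  also have "\<dots> = ennreal pi * (\<integral>\<^sup>+s\<in>{0..}. f s \<partial>lborel)"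
    by (rule nn_integral_cmult) (use f in auto)
  finally show ?thesis .
qed

section \<open>Logarithmic cutoffs\<close>

lemma Ck_on_norm_sq: "Ck_on n UNIV (\<lambda>y::real^2. (norm (y - b))\<^sup>2)"
proof -
  have c: "Ck_on n UNIV (\<lambda>y::real^2. y $ i + (- b $ i))" for i
    by (intro Ck_on_add Ck_on_const Ck_on_bounded_linear[OF _ bounded_linear_vec_nth Ck_on_ident]) auto
  have "(\<lambda>y::real^2. (norm (y - b))\<^sup>2) =
      (\<lambda>y. (y $ 1 + (- b $ 1)) * (y $ 1 + (- b $ 1)) + (y $ 2 + (- b $ 2)) * (y $ 2 + (- b $ 2)))"
    by (simp add: power2_norm_eq_inner inner_vec_def sum_2 fun_eq_iff)
  then show ?thesis
    using Ck_on_add[OF open_UNIV Ck_on_mult[OF open_UNIV c[of 1] c[of 1]] Ck_on_mult[OF open_UNIV c[of 2] c[of 2]]]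
    by simp
qed

lemma has_derivative_norm_sq:
  fixes y :: "'a::real_inner"
  shows "((\<lambda>y. (norm (y - b))\<^sup>2) has_derivative (\<lambda>v. 2 * ((y - b) \<bullet> v))) (at y)"
  unfolding power2_norm_eq_inner
  by (auto intro!: derivative_eq_intros simp: inner_commute)

text \<open>The term \<open>\<delta> * exp (- L)\<close> smooths the logarithm at the origin and is
  chosen so that the argument of \<open>smooth_step\<close> is exactly 1 there. The argument is
  negative once \<open>(norm y)\<^sup>2\<close> reaches \<delta>.\<close>

definition log_cutoff :: "real \<Rightarrow> real \<Rightarrow> real^2 \<Rightarrow> real" where
  "log_cutoff \<delta> L y = smooth_step ((ln \<delta> - ln ((norm y)\<^sup>2 + \<delta> * exp (- L))) / L)"

context
  fixes \<delta> L :: real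
  assumes \<delta>: "0 < \<delta>" and L: "0 < L"
begin

lemma log_cutoff_smooth: "Ck_on n UNIV (log_cutoff \<delta> L)"
proof -
  have s: "Ck_on n UNIV (\<lambda>y::real^2. (norm y)\<^sup>2 + \<delta> * exp (- L))"
    using Ck_on_add[OF open_UNIV Ck_on_norm_sq[of n 0] Ck_on_const] by simp
  have pos: "0 < (norm y)\<^sup>2 + \<delta> * exp (- L)" for y :: "real^2"
    using \<delta> by (simp add: add_nonneg_pos)
  have "Ck_on n UNIV (\<lambda>y::real^2. ln ((norm y)\<^sup>2 + \<delta> * exp (- L)))"
    by (rule Ck_on_compose[OF open_UNIV _ s Ck_on_ln]) (use pos in auto)
  then have "Ck_on n UNIV (\<lambda>y::real^2. ln \<delta> * (1 / L) + (- 1 / L) * ln ((norm y)\<^sup>2 + \<delta> * exp (- L)))"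
    by (intro Ck_on_add Ck_on_mult Ck_on_const) auto
  from Ck_on_compose[OF open_UNIV subset_UNIV this Ck_on_smooth_step]
  show ?thesis
    unfolding log_cutoff_def by (simp add: diff_divide_distrib)
qed

lemma log_cutoff_arg_le_1: "(ln \<delta> - ln (s + \<delta> * exp (- L))) / L \<le> 1" if "0 \<le> s"
proof -
  have "ln (\<delta> * exp (- L)) \<le> ln (s + \<delta> * exp (- L))"
    using \<delta> that by (subst ln_le_cancel_iff) (auto intro: add_nonneg_pos)
  then have "ln \<delta> - ln (s + \<delta> * exp (- L)) \<le> L" using \<delta> by (simp add: ln_mult)
  then show ?thesis using L by simp
qed

lemma log_cutoff_nonneg: "0 \<le> log_cutoff \<delta> L y"
  by (simp add: log_cutoff_def smooth_step_nonneg)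

lemma log_cutoff_le_1: "log_cutoff \<delta> L y \<le> 1"
  unfolding log_cutoff_def by (rule smooth_step_le_1[OF log_cutoff_arg_le_1]) simp

lemma log_cutoff_0: "log_cutoff \<delta> L 0 = 1"
  using \<delta> L by (simp add: log_cutoff_def ln_mult smooth_step_def)

lemma log_cutoff_eq_0:
  assumes "\<delta> \<le> (norm y)\<^sup>2"
  shows "log_cutoff \<delta> L y = 0"
proof -
  have "ln \<delta> \<le> ln ((norm y)\<^sup>2 + \<delta> * exp (- L))"
    using \<delta> assms by (subst ln_le_cancel_iff) (auto intro: add_nonneg_pos add_increasing2)
  then show ?thesis using L by (simp add: log_cutoff_def smooth_step_def divide_le_0_iff not_less)
qed

end

text \<open>With s = |y|^2 and \<eta> = \<delta> exp (- L), the squared gradient is at most a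
  constant times 1 / (L^2 (s + \<eta>)). Its integral over the disc s \<le> \<delta> is of order ln
  ((\<delta> + \<eta>) / \<eta>) / L^2, that is 1 / L. The constant \<open>K\<close> does not depend
  on \<delta>, so the support may be chosen freely.\<close>

lemma log_cutoff_energy_le:
  obtains K :: real where "0 < K"
    "\<And>\<delta> L. 0 < \<delta> \<Longrightarrow> 1 \<le> L \<Longrightarrow>
      (\<integral>\<^sup>+y. ennreal ((norm (euclidean_gradient (log_cutoff \<delta> L) y))\<^sup>2) \<partial>lborel) \<le> ennreal (K / L)"
proof -
  obtain D C where D: "\<And>t. (smooth_step has_real_derivative D t) (at t)"
    "\<And>t. t \<le> 0 \<Longrightarrow> D t = 0" "\<And>t. t \<le> 1 \<Longrightarrow> \<bar>D t\<bar> \<le> C" "0 \<le> C"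
    by (rule smooth_step_has_derivative) blast
  \<comment> \<open>The coefficient \<open>8 * pi * C\<^sup>2\<close> is the product of
    \<open>4 * C\<^sup>2\<close> from the gradient, \<open>pi\<close> from the radial integral and 2
    from the logarithm. The summand 1 only makes the constant positive when \<open>C\<close> is
    0.\<close>
  have bound: "(\<integral>\<^sup>+y. ennreal ((norm (euclidean_gradient (log_cutoff \<delta> L) y))\<^sup>2) \<partial>lborel)
      \<le> ennreal ((8 * pi * C\<^sup>2 + 1) / L)" if \<delta>: "0 < \<delta>" and L1: "1 \<le> L" for \<delta> L
  proof -
    have L: "0 < L" using L1 by simp
    define \<eta> where "\<eta> = \<delta> * exp (- L)"
    have \<eta>: "0 < \<eta>" "\<eta> \<le> \<delta>" using \<delta> L by (auto simp: \<eta>_def mult_le_cancel_left1)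
    define h where "h = (\<lambda>s. 4 * C\<^sup>2 / L\<^sup>2 * (1 / (s + \<eta>)))"
    have grad: "(norm (euclidean_gradient (log_cutoff \<delta> L) y))\<^sup>2 \<le> h ((norm y)\<^sup>2) * indicator {..\<delta>} ((norm y)\<^sup>2)" for y
    proof -
      define s where "s = (norm y)\<^sup>2"
      define \<tau> where "\<tau> = (ln \<delta> - ln (s + \<eta>)) / L"
      have s0: "0 \<le> s" "0 < s + \<eta>" using \<eta> by (auto simp: s_def intro: add_nonneg_pos)
      have "((\<lambda>y. (norm (y - 0))\<^sup>2 + \<eta>) has_derivative (\<lambda>v. 2 * ((y - 0) \<bullet> v) + 0)) (at y)"
        by (intro has_derivative_add has_derivative_norm_sq has_derivative_const)
      then have d1: "((\<lambda>y. (norm y)\<^sup>2 + \<eta>) has_derivative (\<lambda>v. 2 * (y \<bullet> v))) (at y)" by simp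
      have d2: "((\<lambda>s. (ln \<delta> - ln s) / L) has_real_derivative - (1 / (s + \<eta>)) / L) (at (s + \<eta>))"
        using s0 L by (auto intro!: derivative_eq_intros)
      have d3: "((\<lambda>s. smooth_step ((ln \<delta> - ln s) / L)) has_real_derivative D \<tau> * (- (1 / (s + \<eta>)) / L)) (at (s + \<eta>))"
        using DERIV_chain2[OF D(1) d2] by (simp add: \<tau>_def)
      have "(log_cutoff \<delta> L has_derivative (\<lambda>v. (D \<tau> * (- (1 / (s + \<eta>)) / L)) * (2 * (y \<bullet> v)))) (at y)"
        using has_derivative_compose[OF d1, of "\<lambda>s. smooth_step ((ln \<delta> - ln s) / L)"] d3
        unfolding has_field_derivative_def log_cutoff_def[abs_def] \<eta>_def[symmetric] s_def by blast
      then have "euclidean_gradient (log_cutoff \<delta> L) y = (- 2 * D \<tau> / ((s + \<eta>) * L)) *\<^sub>R y"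
        by (intro euclidean_gradient_eqI) (simp add: divide_simps mult.commute mult.left_commute)
      then have ng: "(norm (euclidean_gradient (log_cutoff \<delta> L) y))\<^sup>2 = 4 * (D \<tau>)\<^sup>2 / ((s + \<eta>)\<^sup>2 * L\<^sup>2) * s"
        by (simp add: power_mult_distrib power_divide s_def)
      show ?thesis
      proof (cases "s \<le> \<delta>")
        case True
        have "\<tau> \<le> 1" unfolding \<tau>_def \<eta>_def by (rule log_cutoff_arg_le_1[OF \<delta> L s0(1)])
        then have "(D \<tau>)\<^sup>2 \<le> C\<^sup>2" using D(3)[of \<tau>] D(4) by (metis abs_le_square_iff abs_of_nonneg)
        then have "4 * (D \<tau>)\<^sup>2 / ((s + \<eta>)\<^sup>2 * L\<^sup>2) * s \<le> 4 * C\<^sup>2 / ((s + \<eta>)\<^sup>2 * L\<^sup>2) * (s + \<eta>)"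
          using s0 \<eta> L by (intro mult_mono divide_right_mono) auto
        also have "\<dots> = h s" using s0(2) by (simp add: h_def power2_eq_square[of "s + \<eta>"])
        finally show ?thesis using True ng by (simp add: s_def)
      next
        case False
        then have "ln \<delta> \<le> ln (s + \<eta>)" using \<delta> \<eta> by simp
        then have "\<tau> \<le> 0" using L by (simp add: \<tau>_def divide_le_0_iff)
        then show ?thesis using ng D(2) False by (simp add: s_def)
      qed
    qed
    have "(\<integral>\<^sup>+y. ennreal ((norm (euclidean_gradient (log_cutoff \<delta> L) y))\<^sup>2) \<partial>lborel)
      \<le> (\<integral>\<^sup>+y. ennreal (h ((norm (y::real^2))\<^sup>2) * indicator {..\<delta>} ((norm y)\<^sup>2)) \<partial>lborel)"
      by (intro nn_integral_mono ennreal_leI grad)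
    also have "\<dots> = ennreal pi * (\<integral>\<^sup>+s\<in>{0..}. ennreal (h s * indicator {..\<delta>} s) \<partial>lborel)"
      by (rule nn_integral_radial[where f = "\<lambda>s. ennreal (h s * indicator {..\<delta>} s)"]) (simp add: h_def)
    also have "(\<integral>\<^sup>+s\<in>{0..}. ennreal (h s * indicator {..\<delta>} s) \<partial>lborel) = (\<integral>\<^sup>+s. ennreal (h s) * indicator {0..\<delta>} s \<partial>lborel)"
      by (rule nn_integral_cong) (auto simp: indicator_def)
    also have "\<dots> = ennreal (4 * C\<^sup>2 / L\<^sup>2 * ln (\<delta> + \<eta>) - 4 * C\<^sup>2 / L\<^sup>2 * ln (0 + \<eta>))"
    proof (rule nn_integral_FTC_Icc)
      show "h \<in> borel_measurable borel" by (simp add: h_def)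
      show "((\<lambda>s. 4 * C\<^sup>2 / L\<^sup>2 * ln (s + \<eta>)) has_real_derivative h s) (at s)" if "s \<in> {0..\<delta>}" for s
        unfolding h_def by (rule DERIV_cmult) (use that \<eta> in \<open>auto intro!: derivative_eq_intros\<close>)
      show "0 \<le> h s" if "s \<in> {0..\<delta>}" for s using that \<eta> by (simp add: h_def)
    qed (use \<delta> in simp)
    also have "\<dots> \<le> ennreal (8 * C\<^sup>2 / L)"
    proof (rule ennreal_leI)
      \<comment> \<open>The logarithm of the quotient is at most ln 2 + L, and L \<ge> 1 turns this
        into 2 L.\<close>
      have "ln (\<delta> + \<eta>) \<le> ln (2 * \<delta>)" using \<eta> \<delta> by simp
      also have "\<dots> = ln 2 + ln \<delta>" using \<delta> by (simp add: ln_mult)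
      finally have "ln (\<delta> + \<eta>) - ln \<eta> \<le> ln 2 + L"
        using \<delta> by (simp add: \<eta>_def ln_mult)
      also have "\<dots> \<le> 2 * L" using L1 ln_2_less_1 by simp
      finally have "4 * C\<^sup>2 / L\<^sup>2 * (ln (\<delta> + \<eta>) - ln \<eta>) \<le> 4 * C\<^sup>2 / L\<^sup>2 * (2 * L)"
        by (intro mult_left_mono) auto
      also have "\<dots> = 8 * C\<^sup>2 / L" using L by (simp add: field_simps power2_eq_square)
      finally show "4 * C\<^sup>2 / L\<^sup>2 * ln (\<delta> + \<eta>) - 4 * C\<^sup>2 / L\<^sup>2 * ln (0 + \<eta>) \<le> 8 * C\<^sup>2 / L"
        by (simp add: right_diff_distrib)
    qed
    also have "ennreal pi * ennreal (8 * C\<^sup>2 / L) = ennreal (pi * (8 * C\<^sup>2 / L))"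
      by (rule ennreal_mult'[OF pi_ge_zero, symmetric])
    also have "\<dots> \<le> ennreal ((8 * pi * C\<^sup>2 + 1) / L)"
      using L by (intro ennreal_leI) (simp add: field_simps)
    finally show ?thesis by (simp add: mult_left_mono)
  qed
  have "0 < 8 * pi * C\<^sup>2 + 1" by (simp add: add_nonneg_pos)
  then show thesis using bound by (rule that)
qed

text \<open>The components of \<open>y \<mapsto> \<sigma> ((y - b) / t)\<close>, where \<open>\<sigma>\<close> is the inverse of the stereographic
  projection of the unit sphere. Component \<open>0\<close> is the height. In the other two, \<open>of_nat i\<close> has the
  index type \<open>2\<close>, where \<open>2 = 0\<close>.\<close>

definition sphere_map :: "real^2 \<Rightarrow> real \<Rightarrow> nat \<Rightarrow> real^2 \<Rightarrow> real" where
  "sphere_map b t i y =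
    (if i = 0 then 1 - 2 * t\<^sup>2 * inverse ((norm (y - b))\<^sup>2 + t\<^sup>2)
     else 2 * t * (y $ of_nat i - b $ of_nat i) * inverse ((norm (y - b))\<^sup>2 + t\<^sup>2))"

lemma sum_lessThan_3: "(\<Sum>i<3. f i) = f 0 + (f 1 + f 2)" for f :: "nat \<Rightarrow> 'a::comm_monoid_add"
  by (simp add: numeral_3_eq_3 numeral_2_eq_2 add.assoc)

lemma norm_sq_2: "(norm (z::real^2))\<^sup>2 = (z $ 1)\<^sup>2 + (z $ 2)\<^sup>2"
  unfolding power2_norm_eq_inner by (simp add: inner_vec_def sum_2 power2_eq_square)

context
  fixes b :: "real^2" and t :: real
  assumes t: "0 < t"
begin

lemma sphere_map_denominator_pos: "0 < (norm (y - b))\<^sup>2 + t\<^sup>2"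
  using t by (simp add: add_nonneg_pos)

lemma sphere_map_smooth: "Ck_on n UNIV (sphere_map b t i)"
proof -
  have "Ck_on n UNIV (\<lambda>y. (norm (y - b))\<^sup>2 + t\<^sup>2)"
    by (rule Ck_on_add[OF open_UNIV Ck_on_norm_sq Ck_on_const])
  then have inv: "Ck_on n UNIV (\<lambda>y. inverse ((norm (y - b))\<^sup>2 + t\<^sup>2))"
    by (rule Ck_on_compose[OF open_UNIV _ _ Ck_on_inverse, rotated]) (use sphere_map_denominator_pos in auto)
  have c: "Ck_on n UNIV (\<lambda>y::real^2. y $ j + (- b $ j))" for j
    by (intro Ck_on_add Ck_on_const Ck_on_bounded_linear[OF _ bounded_linear_vec_nth Ck_on_ident]) auto
  have "Ck_on n UNIV (\<lambda>y. 1 + (- 2 * t\<^sup>2) * inverse ((norm (y - b))\<^sup>2 + t\<^sup>2))"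
    by (intro Ck_on_add Ck_on_mult Ck_on_const inv open_UNIV)
  moreover have "Ck_on n UNIV (\<lambda>y. (2 * t) * (y $ j + (- b $ j)) * inverse ((norm (y - b))\<^sup>2 + t\<^sup>2))" for j
    by (intro Ck_on_mult Ck_on_const inv open_UNIV c)
  ultimately show ?thesis
    unfolding sphere_map_def[abs_def] by (cases "i = 0") simp_all
qed

lemma sphere_map_norm: "(\<Sum>i<3. (sphere_map b t i y)\<^sup>2) = 1"
proof -
  define D where "D = (norm (y - b))\<^sup>2 + t\<^sup>2"
  define z1 z2 where "z1 = y $ 1 - b $ 1" and "z2 = y $ 2 - b $ 2"
  have D: "D * inverse D = 1" "D = z1\<^sup>2 + z2\<^sup>2 + t\<^sup>2"
    using sphere_map_denominator_pos[of y] by (simp_all add: D_def norm_sq_2 z1_def z2_def)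
  have "(1 - 2 * t\<^sup>2 * inverse D)\<^sup>2 + (2 * t * z1 * inverse D)\<^sup>2 + (2 * t * z2 * inverse D)\<^sup>2 = 1"
    using D by algebra
  then show ?thesis
    unfolding sum_lessThan_3 by (simp add: sphere_map_def D_def z1_def z2_def add.assoc)
qed

text \<open>The mixed terms cancel because the sphere map has constant length.\<close>

lemma sum_energy_mult_sphere_map:
  assumes f: "Ck_on (Suc 0) UNIV f"
  shows "(\<Sum>i<3. (norm (euclidean_gradient (\<lambda>y. f y * sphere_map b t i y) y))\<^sup>2) =
    (norm (euclidean_gradient f y))\<^sup>2 + (f y)\<^sup>2 * (8 * t\<^sup>2 / ((norm (y - b))\<^sup>2 + t\<^sup>2)\<^sup>2)"
proof -
  define D where "D = (norm (y - b))\<^sup>2 + t\<^sup>2"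
  define w where "w = inverse D"
  define z where "z = y - b"
  define p where "p = euclidean_gradient f y"
  have D: "D * w = 1" "D = (z $ 1)\<^sup>2 + (z $ 2)\<^sup>2 + t\<^sup>2"
    using sphere_map_denominator_pos[of y] by (simp_all add: D_def norm_sq_2 z_def w_def)
  have dw: "((\<lambda>y. inverse ((norm (y - b))\<^sup>2 + t\<^sup>2)) has_derivative (\<lambda>v. - (w * (2 * (z \<bullet> v)) * w))) (at y)"
  proof -
    have "((\<lambda>y. (norm (y - b))\<^sup>2 + t\<^sup>2) has_derivative (\<lambda>v. 2 * ((y - b) \<bullet> v) + 0)) (at y)"
      by (intro has_derivative_add has_derivative_norm_sq has_derivative_const)
    from Deriv.has_derivative_inverse[OF _ this, OF less_imp_neq[OF sphere_map_denominator_pos, symmetric]]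
    show ?thesis by (simp add: w_def D_def z_def)
  qed
  have dc: "((\<lambda>y::real^2. y $ j - b $ j) has_derivative (\<lambda>v. v $ j)) (at y)" for j
    using has_derivative_diff[OF bounded_linear_imp_has_derivative[OF bounded_linear_vec_nth] has_derivative_const]
    by simp
  define q where "q = (\<lambda>i::nat. if i = 0 then (4 * t\<^sup>2 * w\<^sup>2) *\<^sub>R z
    else (2 * t * w) *\<^sub>R axis (of_nat i) 1 - (4 * t * z $ of_nat i * w\<^sup>2) *\<^sub>R z)"
  have ds: "(sphere_map b t i has_derivative (\<lambda>v. q i \<bullet> v)) (at y)" for i
  proof (cases "i = 0")
    case True
    have "((\<lambda>y. 1 - 2 * t\<^sup>2 * inverse ((norm (y - b))\<^sup>2 + t\<^sup>2)) has_derivative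
        (\<lambda>v. 0 - 2 * t\<^sup>2 * (- (w * (2 * (z \<bullet> v)) * w)))) (at y)"
      by (rule has_derivative_diff[OF has_derivative_const has_derivative_mult_right[OF dw]])
    moreover have "(\<lambda>v. 0 - 2 * t\<^sup>2 * (- (w * (2 * (z \<bullet> v)) * w))) = (\<lambda>v. q i \<bullet> v)"
      using True by (intro ext) (simp add: q_def power2_eq_square)
    ultimately show ?thesis using True by (simp add: sphere_map_def[abs_def])
  next
    case False
    have "((\<lambda>y. 2 * t * (y $ of_nat i - b $ of_nat i) * inverse ((norm (y - b))\<^sup>2 + t\<^sup>2)) has_derivative
        (\<lambda>v. (2 * t * (y $ of_nat i - b $ of_nat i)) * (- (w * (2 * (z \<bullet> v)) * w)) +
          (2 * t * v $ of_nat i) * inverse ((norm (y - b))\<^sup>2 + t\<^sup>2))) (at y)"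
      by (rule has_derivative_mult[OF has_derivative_mult_right[OF dc] dw])
    moreover have "(\<lambda>v. (2 * t * (y $ of_nat i - b $ of_nat i)) * (- (w * (2 * (z \<bullet> v)) * w)) +
          (2 * t * v $ of_nat i) * inverse ((norm (y - b))\<^sup>2 + t\<^sup>2)) = (\<lambda>v. q i \<bullet> v)"
    proof
      fix v :: "real^2"
      have "inverse ((norm (y - b))\<^sup>2 + t\<^sup>2) = w" "y $ of_nat i - b $ of_nat i = z $ of_nat i"
        by (simp_all add: w_def D_def z_def)
      then show "(2 * t * (y $ of_nat i - b $ of_nat i)) * (- (w * (2 * (z \<bullet> v)) * w)) +
          (2 * t * v $ of_nat i) * inverse ((norm (y - b))\<^sup>2 + t\<^sup>2) = q i \<bullet> v"
        using False
        by (simp add: q_def inner_diff_left inner_axis inner_commute[of "axis _ _"] power2_eq_square algebra_simps)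
    qed
    ultimately show ?thesis using False by (simp add: sphere_map_def[abs_def])
  qed
  have grad: "euclidean_gradient (\<lambda>y. f y * sphere_map b t i y) y = f y *\<^sub>R q i + sphere_map b t i y *\<^sub>R p" for i
  proof (rule euclidean_gradient_eqI)
    have "((\<lambda>y. f y * sphere_map b t i y) has_derivative
        (\<lambda>v. f y * (q i \<bullet> v) + (p \<bullet> v) * sphere_map b t i y)) (at y)"
      unfolding p_def by (rule has_derivative_mult[OF has_derivative_euclidean_gradient[OF f] ds])
    then show "((\<lambda>y. f y * sphere_map b t i y) has_derivative
        (\<lambda>v. (f y *\<^sub>R q i + sphere_map b t i y *\<^sub>R p) \<bullet> v)) (at y)"
      by (simp add: inner_add_left mult.commute)
  qed
  define F where "F = f y"
  define z1 z2 p1 p2 where "z1 = z $ 1" and "z2 = z $ 2" and "p1 = p $ 1" and "p2 = p $ 2"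
  \<comment> \<open>With \<open>w\<close> in place of the inverse of the denominator, the claim
    becomes a polynomial identity modulo this single relation.\<close>
  have D': "(z1\<^sup>2 + z2\<^sup>2 + t\<^sup>2) * w = 1" using D by (simp add: z1_def z2_def)
  have a0: "axis (1::2) (1::real) $ 1 = 1" "axis (1::2) (1::real) $ 2 = 0"
    "axis (2::2) (1::real) $ 1 = 0" "axis (2::2) (1::real) $ 2 = 1"
    by (simp_all add: axis_def)
  have s: "sphere_map b t 0 y = 1 - 2 * t\<^sup>2 * w" "sphere_map b t 1 y = 2 * t * z1 * w"
    "sphere_map b t 2 y = 2 * t * z2 * w"
    by (simp_all add: sphere_map_def w_def D_def z1_def z2_def z_def)
  have qc: "q 0 $ 1 = 4 * t\<^sup>2 * w\<^sup>2 * z1" "q 0 $ 2 = 4 * t\<^sup>2 * w\<^sup>2 * z2"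
    "q 1 $ 1 = 2 * t * w - 4 * t * z1 * w\<^sup>2 * z1" "q 1 $ 2 = - 4 * t * z1 * w\<^sup>2 * z2"
    "q 2 $ 1 = - 4 * t * z2 * w\<^sup>2 * z1" "q 2 $ 2 = 2 * t * w - 4 * t * z2 * w\<^sup>2 * z2"
    by (simp_all add: q_def a0 z1_def z2_def)
  have "(\<Sum>i<3. (norm (euclidean_gradient (\<lambda>y. f y * sphere_map b t i y) y))\<^sup>2) =
    (F * (4 * t\<^sup>2 * w\<^sup>2 * z1) + (1 - 2 * t\<^sup>2 * w) * p1)\<^sup>2 + (F * (4 * t\<^sup>2 * w\<^sup>2 * z2) + (1 - 2 * t\<^sup>2 * w) * p2)\<^sup>2 +
    ((F * (2 * t * w - 4 * t * z1 * w\<^sup>2 * z1) + 2 * t * z1 * w * p1)\<^sup>2 + (F * (- 4 * t * z1 * w\<^sup>2 * z2) + 2 * t * z1 * w * p2)\<^sup>2) +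
    ((F * (- 4 * t * z2 * w\<^sup>2 * z1) + 2 * t * z2 * w * p1)\<^sup>2 + (F * (2 * t * w - 4 * t * z2 * w\<^sup>2 * z2) + 2 * t * z2 * w * p2)\<^sup>2)"
    unfolding sum_lessThan_3 grad norm_sq_2
    by (simp only: vector_add_component vector_scaleR_component real_scaleR_def qc s
        F_def[symmetric] p1_def[symmetric] p2_def[symmetric] add.assoc)
  also have "\<dots> = p1\<^sup>2 + p2\<^sup>2 + F\<^sup>2 * (8 * t\<^sup>2 * w\<^sup>2)"
    using D' by algebra
  finally show ?thesis
    by (simp add: p1_def p2_def F_def w_def D_def p_def norm_sq_2[of "euclidean_gradient f y"] divide_inverse power_inverse)
qed

text \<open>The integrand is twice the area element of the unit sphere, pulled back by the conformal
  map. The value is therefore the same for all \<open>b\<close> and \<open>t\<close>.\<close>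

lemma nn_integral_sphere_area:
  "(\<integral>\<^sup>+y. ennreal (8 * t\<^sup>2 / ((norm (y - b))\<^sup>2 + t\<^sup>2)\<^sup>2) \<partial>lborel) = ennreal (8 * pi)"
proof -
  define h where "h = (\<lambda>s. 8 * t\<^sup>2 / (s + t\<^sup>2)\<^sup>2)"
  have h: "h \<in> borel_measurable borel" by (simp add: h_def)
  have "(\<integral>\<^sup>+y. ennreal (h ((norm (y - b))\<^sup>2)) \<partial>lborel) =
      (\<integral>\<^sup>+y. ennreal (h ((norm (y - b))\<^sup>2)) \<partial>distr lborel borel ((+) b))"
    by (simp add: lborel_distr_plus)
  also have "\<dots> = (\<integral>\<^sup>+y. ennreal (h ((norm (b + y - b))\<^sup>2)) \<partial>lborel)"
    by (rule nn_integral_distr) (use h in measurable)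
  also have "\<dots> = (\<integral>\<^sup>+y. ennreal (h ((norm (y::real^2))\<^sup>2)) \<partial>lborel)" by simp
  also have "\<dots> = ennreal pi * (\<integral>\<^sup>+s\<in>{0..}. ennreal (h s) \<partial>lborel)"
    by (rule nn_integral_radial) (use h in measurable)
  also have "(\<integral>\<^sup>+s\<in>{0..}. ennreal (h s) \<partial>lborel) = ennreal (0 - (- 8 * t\<^sup>2 * inverse (0 + t\<^sup>2)))"
  proof (rule nn_integral_FTC_atLeast[OF h])
    fix s :: real assume s: "0 \<le> s"
    have pos: "0 < s + t\<^sup>2" using s t by (simp add: add_nonneg_pos)
    show "((\<lambda>s. - 8 * t\<^sup>2 * inverse (s + t\<^sup>2)) has_real_derivative h s) (at s)"
      using pos by (auto intro!: derivative_eq_intros simp: h_def power2_eq_square divide_inverse)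
    show "0 \<le> h s" by (simp add: h_def)
  next
    have "filterlim (\<lambda>s. t\<^sup>2 + s) at_top at_top"
      by (rule filterlim_tendsto_add_at_top[OF tendsto_const filterlim_ident])
    then have "filterlim (\<lambda>s. s + t\<^sup>2) at_top at_top" by (simp add: add.commute)
    then have "((\<lambda>s. inverse (s + t\<^sup>2)) \<longlongrightarrow> 0) at_top"
      by (rule tendsto_inverse_0_at_top)
    from tendsto_mult_left[OF this, of "- 8 * t\<^sup>2"]
    show "((\<lambda>s. - 8 * t\<^sup>2 * inverse (s + t\<^sup>2)) \<longlongrightarrow> 0) at_top" by simp
  qed
  also have "0 - (- 8 * t\<^sup>2 * inverse (0 + t\<^sup>2)) = 8" using t by simp
  also have "ennreal pi * ennreal 8 = ennreal (8 * pi)" by (simp only: ennreal_mult'[OF pi_ge_zero, symmetric] mult.commute)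
  finally show ?thesis by (simp add: h_def)
qed

lemma sum_energy_mult_sphere_map_le:
  assumes f: "Ck_on (Suc 0) UNIV f" "\<And>y. 0 \<le> f y" "\<And>y. f y \<le> 1"
  shows "(\<Sum>i<3. \<integral>\<^sup>+y. ennreal ((norm (euclidean_gradient (\<lambda>y. f y * sphere_map b t i y) y))\<^sup>2) \<partial>lborel) \<le>
    (\<integral>\<^sup>+y. ennreal ((norm (euclidean_gradient f y))\<^sup>2) \<partial>lborel) + ennreal (8 * pi)"
proof -
  have sm: "Ck_on (Suc 0) UNIV (\<lambda>y. f y * sphere_map b t i y)" for i
    by (rule Ck_on_mult[OF open_UNIV f(1) sphere_map_smooth])
  have "(\<Sum>i<3. \<integral>\<^sup>+y. ennreal ((norm (euclidean_gradient (\<lambda>y. f y * sphere_map b t i y) y))\<^sup>2) \<partial>lborel) =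
      (\<integral>\<^sup>+y. (\<Sum>i<3. ennreal ((norm (euclidean_gradient (\<lambda>y. f y * sphere_map b t i y) y))\<^sup>2)) \<partial>lborel)"
    by (rule nn_integral_sum[symmetric]) (use borel_measurable_gradient[OF sm] in measurable)
  also have "\<dots> = (\<integral>\<^sup>+y. ennreal ((norm (euclidean_gradient f y))\<^sup>2) +
      ennreal ((f y)\<^sup>2 * (8 * t\<^sup>2 / ((norm (y - b))\<^sup>2 + t\<^sup>2)\<^sup>2)) \<partial>lborel)"
    by (rule nn_integral_cong) (simp add: sum_energy_mult_sphere_map[OF f(1)])
  also have "\<dots> \<le> (\<integral>\<^sup>+y. ennreal ((norm (euclidean_gradient f y))\<^sup>2) +
      ennreal (8 * t\<^sup>2 / ((norm (y - b))\<^sup>2 + t\<^sup>2)\<^sup>2) \<partial>lborel)"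
  proof (intro nn_integral_mono add_left_mono ennreal_leI)
    fix y
    have "(f y)\<^sup>2 \<le> 1" using f(2,3) by (simp add: power_le_one)
    then show "(f y)\<^sup>2 * (8 * t\<^sup>2 / ((norm (y - b))\<^sup>2 + t\<^sup>2)\<^sup>2) \<le> 8 * t\<^sup>2 / ((norm (y - b))\<^sup>2 + t\<^sup>2)\<^sup>2"
      by (intro mult_left_le_one_le) auto
  qed
  also have "\<dots> = (\<integral>\<^sup>+y. ennreal ((norm (euclidean_gradient f y))\<^sup>2) \<partial>lborel) + ennreal (8 * pi)"
    unfolding nn_integral_sphere_area[symmetric]
    by (rule nn_integral_add) (use borel_measurable_gradient[OF f(1)] in measurable)
  finally show ?thesis .
qed

end

section \<open>The conformal barycentre\<close>

text \<open>Every point has a ball of small measure, by continuity from above; the radius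
  \<open>d\<close> is a Lebesgue number of this cover of \<open>S\<close>.\<close>

lemma nonatomic_measure_small_balls:
  fixes \<nu> :: "'a::metric_space measure"
  assumes "finite_measure \<nu>" "sets \<nu> = sets borel" "\<And>y. emeasure \<nu> {y} = 0" "compact S" "0 < \<eta>"
  obtains d where "0 < d" "\<And>b. b \<in> S \<Longrightarrow> measure \<nu> (ball b d) < \<eta>"
proof -
  interpret finite_measure \<nu> by fact
  define \<G> where "\<G> = {ball y e | y e. measure \<nu> (ball y e) < \<eta>}"
  have "S \<subseteq> \<Union>\<G>"
  proof
    fix y assume "y \<in> S"
    have "(\<lambda>n. measure \<nu> (ball y (1 / real (Suc n)))) \<longlonglongrightarrow> measure \<nu> (\<Inter>n. ball y (1 / real (Suc n)))"
    proof (rule finite_Lim_measure_decseq)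
      show "decseq (\<lambda>n. ball y (1 / real (Suc n)))"
      proof (rule decseq_SucI)
        show "ball y (1 / real (Suc (Suc n))) \<subseteq> ball y (1 / real (Suc n))" for n
          by (rule subset_ball, rule divide_left_mono) simp_all
      qed
      show "range (\<lambda>n. ball y (1 / real (Suc n))) \<subseteq> sets \<nu>"
        unfolding assms(2) by (rule image_subsetI) simp
    qed
    moreover have "(\<Inter>n. ball y (1 / real (Suc n))) = {y}"
    proof -
      have "z = y" if "\<forall>n. dist y z < 1 / real (Suc n)" for z
      proof (rule ccontr)
        assume "z \<noteq> y"
        then obtain n where "1 / real (Suc n) < dist y z" using nat_approx_posE[of "dist y z"] by auto
        then show False using that by (meson less_asym)
      qed
      then show ?thesis by (intro set_eqI) (auto simp del: of_nat_Suc)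
    qed
    ultimately have "(\<lambda>n. measure \<nu> (ball y (1 / real (Suc n)))) \<longlonglongrightarrow> 0"
      using assms(3)[of y] by (simp add: measure_def)
    then have "\<forall>\<^sub>F n in sequentially. measure \<nu> (ball y (1 / real (Suc n))) < \<eta>"
      using assms(5) by (rule order_tendstoD)
    then obtain n where "measure \<nu> (ball y (1 / real (Suc n))) < \<eta>"
      using eventually_happens'[OF sequentially_bot] by blast
    then have "ball y (1 / real (Suc n)) \<in> \<G>" unfolding \<G>_def by blast
    moreover have "y \<in> ball y (1 / real (Suc n))" by simp
    ultimately show "y \<in> \<Union>\<G>" by blast
  qed
  moreover have "open G" if "G \<in> \<G>" for G using that unfolding \<G>_def by auto
  ultimately obtain d where d: "0 < d" "\<And>x. x \<in> S \<Longrightarrow> \<exists>G\<in>\<G>. ball x d \<subseteq> G"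
    using Heine_Borel_lemma[OF assms(4)] by metis
  have "measure \<nu> (ball b d) < \<eta>" if b: "b \<in> S" for b
  proof -
    obtain y e where "ball b d \<subseteq> ball y e" "measure \<nu> (ball y e) < \<eta>"
      using d(2)[OF b] unfolding \<G>_def by blast
    moreover have "measure \<nu> (ball b d) \<le> measure \<nu> (ball y e)"
      by (rule finite_measure_mono) (use calculation assms(2) in auto)
    ultimately show ?thesis by linarith
  qed
  with d(1) show thesis by (rule that)
qed

text \<open>Replaces the vanishing of a derivative at a minimum. Only |s| < 1 is demanded, because
  one of the variations multiplies a positive parameter by 1 + s.\<close>

lemma linear_term_zero:
  fixes A B :: real
  assumes "\<And>s. \<bar>s\<bar> < 1 \<Longrightarrow> 0 \<le> s * A + s\<^sup>2 * B"
  shows "A = 0"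
proof (rule ccontr)
  assume A: "A \<noteq> 0"
  \<comment> \<open>At s = - A / K the condition K > |A| keeps |s| below 1, and K > B makes the
    linear term win.\<close>
  define K where "K = \<bar>A\<bar> + \<bar>B\<bar> + 1"
  have K: "\<bar>A\<bar> < K" "B < K" "0 < K" unfolding K_def by linarith+
  then have "0 \<le> (- A / K) * A + (- A / K)\<^sup>2 * B" by (intro assms) simp
  also have "\<dots> = A\<^sup>2 / K\<^sup>2 * (B - K)" using K by (simp add: field_simps power2_eq_square)
  also have "\<dots> < 0" using A K by (intro mult_pos_neg) auto
  finally show False by simp
qed

text \<open>The family of conformal maps \<open>y \<mapsto> \<sigma> ((y - b) / t)\<close> suffices in Hersch's lemma, since
  rotations of the sphere preserve the condition. The barycentre is found by minimising
  \<open>\<integral> ln ((\<bar>y - b\<bar>\<^sup>2 + t\<^sup>2) / t) d\<nu>\<close>, which is coercive when \<open>\<nu>\<close> has no atoms. By \<open>ln z \<le> z - 1\<close>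
  its increments are dominated by rational functions of \<open>b\<close> and \<open>t\<close>, so that no differentiation
  under the integral is needed.\<close>

theorem conformal_barycentre_exists:
  fixes \<nu> :: "(real^2) measure"
  assumes fin: "finite_measure \<nu>" and sets: "sets \<nu> = sets borel"
    and supp: "AE y in \<nu>. norm y \<le> r" and r: "0 \<le> r"
    and atoms: "\<And>y. emeasure \<nu> {y} = 0"
    and pos: "0 < measure \<nu> UNIV"
  obtains b t where "0 < t" "\<And>i. i < 3 \<Longrightarrow> (\<integral>y. sphere_map b t i y \<partial>\<nu>) = 0"
proof -
  interpret finite_measure \<nu> by fact
  have sp: "space \<nu> = UNIV" using sets_eq_imp_space_eq[OF sets] by simp
  define m where "m = measure \<nu> UNIV"
  have m: "0 < m" using pos by (simp add: m_def)
  define q where "q = (\<lambda>b t y::real^2. (norm (y - b))\<^sup>2 + t\<^sup>2)"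
  \<comment> \<open>Up to normalisation this is the Busemann function of hyperbolic 3-space in the
    upper half-space model, at the point (b, t) and for the boundary point y. Minimising its mean
    gives the conformal barycentre.\<close>
  define G where "G = (\<lambda>b t y. ln (q b t y / t))"
  define F where "F = (\<lambda>b t. \<integral>y. G b t y \<partial>\<nu>)"
  have qpos: "0 < q b t y" if "0 < t" for b t y using that by (simp add: q_def add_nonneg_pos)
  have G_meas [measurable]: "G b t \<in> borel_measurable \<nu>" for b t
    unfolding G_def q_def by (simp cong: measurable_cong_sets add: sets)
  \<comment> \<open>Bounds |G| on a box of parameters, from \<tau> \<le> q / t \<le> ((r + R)^2 +
    T^2) / \<tau>. It is the dominating constant in the proof that F is continuous.\<close>
  define W where "W = (\<lambda>R \<tau> T. \<bar>ln \<tau>\<bar> + \<bar>ln (((r + R)\<^sup>2 + T\<^sup>2) / \<tau>)\<bar>)"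
  have G_bound: "\<bar>G b t y\<bar> \<le> W R \<tau> T"
    if "norm y \<le> r" "norm b \<le> R" "0 < \<tau>" "\<tau> \<le> t" "t \<le> T" for b t y R \<tau> T
  proof -
    have t: "0 < t" using that by linarith
    have "t\<^sup>2 / t \<le> q b t y / t" using t by (intro divide_right_mono) (auto simp: q_def)
    then have l: "\<tau> \<le> q b t y / t" using that t by (simp add: power2_eq_square)
    have "norm (y - b) \<le> r + R" using that norm_triangle_ineq4[of y b] by linarith
    then have "q b t y \<le> (r + R)\<^sup>2 + T\<^sup>2"
      unfolding q_def using that t by (intro add_mono power_mono) auto
    then have u: "q b t y / t \<le> ((r + R)\<^sup>2 + T\<^sup>2) / \<tau>"
      using that qpos[OF t, of b y] by (intro frac_le) auto
    have "ln \<tau> \<le> G b t y" "G b t y \<le> ln (((r + R)\<^sup>2 + T\<^sup>2) / \<tau>)"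
      unfolding G_def using l u that(3) by (auto intro: ln_mono)
    then show ?thesis unfolding W_def by linarith
  qed
  have G_int: "integrable \<nu> (G b t)" if "0 < t" for b t
  proof (rule integrable_const_bound)
    show "AE y in \<nu>. norm (G b t y) \<le> W (norm b) t t"
      using supp by eventually_elim (use G_bound[of _ b "norm b" t t t] that in simp)
  qed simp
  have F_ge_const: "m * k \<le> F b t" if "AE y in \<nu>. k \<le> G b t y" "0 < t" for b t k
  proof -
    have "(\<integral>y. k \<partial>\<nu>) \<le> F b t"
      unfolding F_def by (rule integral_mono_AE) (use that G_int in auto)
    then show ?thesis by (simp add: m_def sp)
  qed
  define F0 where "F0 = F 0 1"
  \<comment> \<open>Since q / t \<ge> t, the mean is at least m ln t, which exceeds
    \<open>F0\<close> for t > T.\<close>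
  define T where "T = exp (F0 / m)"
  define R where "R = r + T"
  have T: "0 < T" "ln T = F0 / m" by (simp_all add: T_def)
  have R: "0 \<le> R" using r T by (simp add: R_def)
  \<comment> \<open>A share of the mass below one half is needed in small balls. As t tends to 0, G
    tends to minus infinity like ln t close to \<open>b\<close> and to plus infinity like - ln t
    away from it, and the second must outweigh the first.\<close>
  have "0 < m / 4" using m by simp
  then obtain d0 where d0: "0 < d0" "\<And>b. b \<in> cball 0 R \<Longrightarrow> measure \<nu> (ball b d0) < m / 4"
    using nonatomic_measure_small_balls[OF fin sets atoms compact_cball] by blast
  define d where "d = min d0 1"
  have d: "0 < d" "d \<le> 1" using d0 by (auto simp: d_def)
  have d_small: "measure \<nu> (ball b d) \<le> m / 4" if "norm b \<le> R" for b
  proof -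
    have "measure \<nu> (ball b d) \<le> measure \<nu> (ball b d0)"
      by (rule finite_measure_mono) (use sets in \<open>auto simp: d_def\<close>)
    then show ?thesis using d0(2)[of b] that by simp
  qed
  \<comment> \<open>With a quarter of the mass within distance d of b, the mean is at least m (3 ln
    d - ln t) / 2; this exceeds \<open>F0\<close> when ln t < 3 ln d - 2 F0 / m. The other term,
    d^2, makes ln t negative and the bound \<open>k\<close> away from \<open>b\<close>
    positive.\<close>
  define \<tau> where "\<tau> = min (d\<^sup>2) (exp (3 * ln d - 2 * F0 / m))"
  have \<tau>: "0 < \<tau>" using d by (simp add: \<tau>_def)
  have coercive: "t \<le> T \<and> norm b \<le> R \<and> \<tau> \<le> t" if t: "0 < t" and le: "F b t \<le> F0" for b t
  proof -
    have "t \<le> T"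
    proof (rule ccontr)
      assume "\<not> t \<le> T"
      then have "F0 / m < ln t" unfolding T(2)[symmetric] using T(1) by simp
      then have "F0 < m * ln t" using m by (simp add: field_simps)
      also have "m * ln t \<le> F b t"
      proof (rule F_ge_const[OF AE_I2 t])
        fix y
        have "t \<le> q b t y / t" using t by (simp add: q_def field_simps power2_eq_square)
        then show "ln t \<le> G b t y" unfolding G_def using t by (rule ln_mono)
      qed
      finally show False using le by simp
    qed
    moreover have "norm b \<le> R"
    proof (rule ccontr)
      assume b: "\<not> norm b \<le> R"
      \<comment> \<open>A lower bound for the distance from \<open>b\<close> to the support. It
        exceeds T, so e^2 / T exceeds T as well.\<close>
      define e where "e = norm b - r"
      have e: "T < e" using b by (simp add: e_def R_def)
      have "F0 / m = ln T" by (rule T(2)[symmetric])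
      also have "\<dots> < ln (e\<^sup>2 / T)"
      proof -
        have "T * T < e * e" using e T(1) by (intro mult_strict_mono) auto
        then have "T < e\<^sup>2 / T" using T(1) by (simp add: field_simps power2_eq_square)
        then show ?thesis using T(1) by (subst ln_less_cancel_iff) auto
      qed
      finally have "F0 < m * ln (e\<^sup>2 / T)" using m by (simp add: field_simps)
      also have "\<dots> \<le> F b t"
      proof (rule F_ge_const[OF _ t])
        show "AE y in \<nu>. ln (e\<^sup>2 / T) \<le> G b t y"
          using supp
        proof eventually_elim
          case (elim y)
          have "e \<le> norm (y - b)" using elim norm_triangle_ineq2[of b y] by (simp add: e_def norm_minus_commute)
          then have "e\<^sup>2 \<le> q b t y" unfolding q_def using e T(1) power_mono[of e "norm (y - b)" 2]
            by (simp add: add_increasing2)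
          then have "e\<^sup>2 / T \<le> q b t y / t"
            using \<open>t \<le> T\<close> t qpos[OF t, of b y] by (intro frac_le) auto
          then show ?case unfolding G_def using e T(1) by (intro ln_mono) auto
        qed
      qed
      finally show False using le by simp
    qed
    moreover have "\<tau> \<le> t"
    proof (rule ccontr)
      assume "\<not> \<tau> \<le> t"
      then have t_small: "t < d\<^sup>2" "t < exp (3 * ln d - 2 * F0 / m)" by (auto simp: \<tau>_def)
      have "d\<^sup>2 \<le> 1" using d by (simp add: power_le_one)
      then have lnt: "ln t < 0" "ln t < 3 * ln d - 2 * F0 / m"
        using t t_small ln_less_cancel_iff[OF t, of "exp (3 * ln d - 2 * F0 / m)"] by auto
      define k where "k = 2 * ln d - ln t"
      have k: "0 < k"
        using t t_small(1) d ln_less_cancel_iff[OF t, of "d\<^sup>2"] by (simp add: k_def ln_realpow)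
      have B: "ball b d \<in> sets \<nu>" "- ball b d \<in> sets \<nu>" using sets by auto
      have ind: "integrable \<nu> (\<lambda>y. a * indicator X y :: real)" if "X \<in> sets \<nu>" for a X
        using that emeasure_finite[of X]
        by (intro integrable_mult_right integrable_real_indicator) (simp_all add: less_top[symmetric])
      have "ln t * measure \<nu> (ball b d) + k * measure \<nu> (- ball b d) =
          (\<integral>y. ln t * indicator (ball b d) y + k * indicator (- ball b d) y \<partial>\<nu>)"
        using Bochner_Integration.integral_add[OF ind[OF B(1), of "ln t"] ind[OF B(2), of k]] B sp by simp
      also have "\<dots> \<le> F b t"
        unfolding F_def
      proof (rule integral_mono)
        show "integrable \<nu> (\<lambda>y. ln t * indicator (ball b d) y + k * indicator (- ball b d) y)"
          by (rule Bochner_Integration.integrable_add[OF ind[OF B(1)] ind[OF B(2)]])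
        fix y
        show "ln t * indicator (ball b d) y + k * indicator (- ball b d) y \<le> G b t y"
        proof (cases "y \<in> ball b d")
          case True
          have "t \<le> q b t y / t" using t by (simp add: q_def field_simps power2_eq_square)
          then have "ln t \<le> G b t y" unfolding G_def using t by (rule ln_mono)
          then show ?thesis using True by simp
        next
          case False
          then have "d \<le> norm (y - b)" by (simp add: dist_norm norm_minus_commute)
          then have "d\<^sup>2 \<le> q b t y" unfolding q_def using d power_mono[of d "norm (y - b)" 2]
            by (simp add: add_increasing2)
          then have "ln (d\<^sup>2 / t) \<le> G b t y"
            unfolding G_def using t d by (intro ln_mono divide_right_mono) auto
          then have "k \<le> G b t y" using t d by (simp add: k_def ln_div ln_realpow)
          then show ?thesis using False by simp
        qed
      qed (rule G_int[OF t])
      finally have "ln t * measure \<nu> (ball b d) + k * measure \<nu> (- ball b d) \<le> F0" using le by simp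
      moreover have "measure \<nu> (- ball b d) = m - measure \<nu> (ball b d)"
        using finite_measure_compl[OF B(1)] by (simp add: sp m_def Compl_eq_Diff_UNIV)
      moreover have "ln t * (m / 4) \<le> ln t * measure \<nu> (ball b d)"
        using lnt(1) d_small[OF \<open>norm b \<le> R\<close>] by (intro mult_left_mono_neg) auto
      moreover have "k * (3 * m / 4) \<le> k * (m - measure \<nu> (ball b d))"
        using k d_small[OF \<open>norm b \<le> R\<close>] by (intro mult_left_mono) auto
      ultimately have "ln t * (m / 4) + k * (3 * m / 4) \<le> F0" by simp
      then have "m * (3 * ln d - ln t) \<le> 2 * F0" by (simp add: k_def algebra_simps)
      then have "3 * ln d - 2 * F0 / m \<le> ln t" using m by (simp add: field_simps)
      then show False using lnt(2) by simp
    qed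
    ultimately show ?thesis by blast
  qed
  define K where "K = cball (0::real^2) R \<times> {\<tau>..T}"
  have K: "compact K" unfolding K_def by (intro compact_Times) auto
  \<comment> \<open>The level \<open>F0\<close> is the value at this point, so a minimum over
    \<open>K\<close> is a minimum over all admissible parameters.\<close>
  have "(0, 1) \<in> K" using coercive[of 1 0] R by (auto simp: K_def F0_def)
  have contF: "continuous_on K (\<lambda>(b, t). F b t)"
    unfolding continuous_on_sequentially
  proof (intro allI ballI impI)
    fix p x assume "x \<in> K" and *: "(\<forall>n. p n \<in> K) \<and> p \<longlonglongrightarrow> x"
    obtain b t where x: "x = (b, t)" by (cases x)
    have t: "0 < t" using \<open>x \<in> K\<close> \<tau> by (auto simp: x K_def)
    have b_lim: "(\<lambda>n. fst (p n)) \<longlonglongrightarrow> b" and t_lim: "(\<lambda>n. snd (p n)) \<longlonglongrightarrow> t"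
      using tendsto_fst[of p x] tendsto_snd[of p x] * by (auto simp: x)
    have "(\<lambda>n. \<integral>y. G (fst (p n)) (snd (p n)) y \<partial>\<nu>) \<longlonglongrightarrow> (\<integral>y. G b t y \<partial>\<nu>)"
    proof (rule integral_dominated_convergence[where w = "\<lambda>y. W R \<tau> T"])
      show "AE y in \<nu>. (\<lambda>n. G (fst (p n)) (snd (p n)) y) \<longlonglongrightarrow> G b t y"
      proof (rule AE_I2)
        fix y
        show "(\<lambda>n. G (fst (p n)) (snd (p n)) y) \<longlonglongrightarrow> G b t y"
          unfolding G_def q_def
        proof (rule tendsto_ln)
          show "(\<lambda>n. ((norm (y - fst (p n)))\<^sup>2 + (snd (p n))\<^sup>2) / snd (p n)) \<longlonglongrightarrow> ((norm (y - b))\<^sup>2 + t\<^sup>2) / t"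
            by (intro tendsto_intros b_lim t_lim) (use t in auto)
          show "((norm (y - b))\<^sup>2 + t\<^sup>2) / t \<noteq> 0" using qpos[OF t, of b y] t by (simp add: q_def)
        qed
      qed
      show "AE y in \<nu>. norm (G (fst (p n)) (snd (p n)) y) \<le> W R \<tau> T" for n
        using supp
      proof eventually_elim
        case (elim y)
        have "p n \<in> K" using * by blast
        then show ?case
          using G_bound[OF elim, of "fst (p n)" R \<tau> "snd (p n)" T] \<tau> by (auto simp: K_def mem_Times_iff)
      qed
    qed auto
    then show "((\<lambda>(b, t). F b t) \<circ> p) \<longlonglongrightarrow> (case x of (b, t) \<Rightarrow> F b t)"
      by (simp add: F_def x comp_def case_prod_beta)
  qed
  obtain b0 t0 where "(b0, t0) \<in> K" and min_K: "\<And>b t. (b, t) \<in> K \<Longrightarrow> F b0 t0 \<le> F b t"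
    using continuous_attains_inf[OF K _ contF] \<open>(0, 1) \<in> K\<close> by force
  have t0: "0 < t0" using \<open>(b0, t0) \<in> K\<close> \<tau> by (auto simp: K_def)
  have min: "F b0 t0 \<le> F b t" if "0 < t" for b t
  proof (cases "F b t \<le> F0")
    case True
    then have "(b, t) \<in> K" using coercive[OF that True] by (simp add: K_def)
    then show ?thesis by (rule min_K)
  next
    case False
    then show ?thesis using min_K[OF \<open>(0, 1) \<in> K\<close>] by (simp add: F0_def)
  qed
  define w where "w = (\<lambda>y. inverse (q b0 t0 y))"
  have qw: "q b0 t0 y * w y = 1" for y using qpos[OF t0, of b0 y] by (simp add: w_def)
  have bounded_int: "integrable \<nu> f" if "continuous_on UNIV f" for f :: "real^2 \<Rightarrow> real"
  proof -
    have "bounded (f ` cball 0 r)"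
      by (intro compact_imp_bounded compact_continuous_image continuous_on_subset[OF that]) auto
    then obtain C where C: "\<And>y. y \<in> cball 0 r \<Longrightarrow> norm (f y) \<le> C" unfolding bounded_iff by blast
    show ?thesis
    proof (rule integrable_const_bound)
      show "AE y in \<nu>. norm (f y) \<le> C" using supp by eventually_elim (use C in simp)
      show "f \<in> borel_measurable \<nu>"
        using borel_measurable_continuous_onI[OF that] by (simp cong: measurable_cong_sets add: sets)
    qed
  qed
  have cw: "continuous_on UNIV w"
    unfolding w_def q_def
    by (intro continuous_intros) (use qpos[OF t0, of b0] t0 in \<open>auto simp: q_def less_imp_neq[symmetric]\<close>)
  \<comment> \<open>The logarithmic inequality is an equality at the minimiser, so this upper bound
    also has its minimum 0 there and yields the first-order conditions.\<close>
  have variation: "0 \<le> (\<integral>y. q b t y * w y * (t0 / t) - 1 \<partial>\<nu>)" if t: "0 < t" for b t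
  proof -
    have cq: "continuous_on UNIV (\<lambda>y. q b t y * w y * (t0 / t) - 1)"
      unfolding q_def by (intro continuous_intros cw)
    have "0 \<le> F b t - F b0 t0" using min[OF t] by simp
    also have "\<dots> = (\<integral>y. G b t y - G b0 t0 y \<partial>\<nu>)"
      unfolding F_def by (rule Bochner_Integration.integral_diff[symmetric]) (rule G_int; fact)+
    also have "\<dots> \<le> (\<integral>y. q b t y * w y * (t0 / t) - 1 \<partial>\<nu>)"
    proof (rule integral_mono)
      show "integrable \<nu> (\<lambda>y. G b t y - G b0 t0 y)" using G_int t t0 by auto
      show "integrable \<nu> (\<lambda>y. q b t y * w y * (t0 / t) - 1)" by (rule bounded_int[OF cq])
      fix y
      have "G b t y - G b0 t0 y = ln ((q b t y / t) / (q b0 t0 y / t0))"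
        unfolding G_def using qpos[OF t, of b y] qpos[OF t0, of b0 y] t t0 by (subst ln_divide_pos) auto
      also have "\<dots> \<le> (q b t y / t) / (q b0 t0 y / t0) - 1"
        using qpos[OF t, of b y] qpos[OF t0, of b0 y] t t0 by (intro ln_le_minus_one) simp
      also have "\<dots> = q b t y * w y * (t0 / t) - 1" by (simp add: w_def divide_inverse mult_ac)
      finally show "G b t y - G b0 t0 y \<le> q b t y * w y * (t0 / t) - 1" .
    qed
    finally show ?thesis .
  qed
  have Iw: "integrable \<nu> w" by (rule bounded_int[OF cw])
  \<comment> \<open>Moving \<open>b0\<close> along a coordinate axis gives the mean of a horizontal
    component of the sphere map.\<close>
  have coordinate: "(\<integral>y. (y $ j - b0 $ j) * w y \<partial>\<nu>) = 0" for j
  proof -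
    have cj: "continuous_on UNIV (\<lambda>y. (y $ j - b0 $ j) * w y)"
      by (intro continuous_intros cw)
    have "0 \<le> s * (- 2 * (\<integral>y. (y $ j - b0 $ j) * w y \<partial>\<nu>)) + s\<^sup>2 * (\<integral>y. w y \<partial>\<nu>)" for s :: real
    proof -
      have "q (b0 + s *\<^sub>R axis j 1) t0 y * w y * (t0 / t0) - 1 =
          s * (- 2 * ((y $ j - b0 $ j) * w y)) + s\<^sup>2 * w y" for y
      proof -
        have n: "(norm (axis j s :: real^2))\<^sup>2 = s\<^sup>2"
          unfolding power2_norm_eq_inner by (simp add: inner_axis_axis power2_eq_square)
        have "y - (b0 + s *\<^sub>R axis j 1) = (y - b0) - axis j s"
          by (simp add: vec_eq_iff axis_def)
        then have qe: "q (b0 + s *\<^sub>R axis j 1) t0 y = q b0 t0 y - 2 * s * (y $ j - b0 $ j) + s\<^sup>2"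
          using n by (simp add: q_def power2_norm_eq_inner inner_diff_left inner_diff_right inner_commute
              inner_axis power2_eq_square[of s] algebra_simps)
        have "q (b0 + s *\<^sub>R axis j 1) t0 y * w y =
            q b0 t0 y * w y + (s * (- 2 * ((y $ j - b0 $ j) * w y)) + s\<^sup>2 * w y)"
          unfolding qe by (simp add: algebra_simps)
        then show ?thesis using t0 by (simp add: qw)
      qed
      then have "0 \<le> (\<integral>y. s * (- 2 * ((y $ j - b0 $ j) * w y)) + s\<^sup>2 * w y \<partial>\<nu>)"
        using variation[OF t0, of "b0 + s *\<^sub>R axis j 1"] by simp
      also have "\<dots> = s * (- 2 * (\<integral>y. (y $ j - b0 $ j) * w y \<partial>\<nu>)) + s\<^sup>2 * (\<integral>y. w y \<partial>\<nu>)"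
        using bounded_int[OF cj] Iw by simp
      finally show ?thesis .
    qed
    then have "- 2 * (\<integral>y. (y $ j - b0 $ j) * w y \<partial>\<nu>) = 0" by (rule linear_term_zero)
    then show ?thesis by simp
  qed
  \<comment> \<open>Multiplying \<open>t0\<close> by 1 + s gives the mean of the height.\<close>
  have scale: "m = 2 * t0\<^sup>2 * (\<integral>y. w y \<partial>\<nu>)"
  proof -
    have "0 \<le> s * (2 * t0\<^sup>2 * (\<integral>y. w y \<partial>\<nu>) - m) + s\<^sup>2 * (t0\<^sup>2 * (\<integral>y. w y \<partial>\<nu>))" if s: "\<bar>s\<bar> < 1" for s :: real
    proof -
      define t where "t = t0 * (1 + s)"
      have t: "0 < t" using s t0 by (simp add: t_def)
      have eq: "q b0 t y * w y * (t0 / t) - 1 = (1 / (1 + s)) * (s * (2 * t0\<^sup>2 * w y - 1) + s\<^sup>2 * (t0\<^sup>2 * w y))" for y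
      proof -
        have "q b0 t y = q b0 t0 y + t0\<^sup>2 * (2 * s + s\<^sup>2)"
          by (simp add: q_def t_def power2_eq_square algebra_simps)
        then have "q b0 t y * w y = 1 + t0\<^sup>2 * (2 * s + s\<^sup>2) * w y" by (simp add: distrib_right qw)
        moreover have "t0 / t = 1 / (1 + s)" using t0 by (simp add: t_def)
        moreover have "1 = (1 / (1 + s)) * (1 + s)" using s by simp
        ultimately have "q b0 t y * w y * (t0 / t) - 1 =
            (1 / (1 + s)) * (1 + t0\<^sup>2 * (2 * s + s\<^sup>2) * w y) - (1 / (1 + s)) * (1 + s)" by (simp add: mult.commute)
        also have "\<dots> = (1 / (1 + s)) * (s * (2 * t0\<^sup>2 * w y - 1) + s\<^sup>2 * (t0\<^sup>2 * w y))"
          unfolding right_diff_distrib[symmetric] by (simp add: algebra_simps)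
        finally show ?thesis .
      qed
      have "0 \<le> (\<integral>y. (1 / (1 + s)) * (s * (2 * t0\<^sup>2 * w y - 1) + s\<^sup>2 * (t0\<^sup>2 * w y)) \<partial>\<nu>)"
        using variation[OF t, of b0] unfolding eq .
      also have "\<dots> = (1 / (1 + s)) * (s * (2 * t0\<^sup>2 * (\<integral>y. w y \<partial>\<nu>) - m) + s\<^sup>2 * (t0\<^sup>2 * (\<integral>y. w y \<partial>\<nu>)))"
      proof -
        have "(\<integral>y. 2 * t0\<^sup>2 * w y - 1 \<partial>\<nu>) = 2 * t0\<^sup>2 * (\<integral>y. w y \<partial>\<nu>) - m"
          using Iw by (simp add: m_def sp)
        moreover have "integrable \<nu> (\<lambda>y. s * (2 * t0\<^sup>2 * w y - 1))" "integrable \<nu> (\<lambda>y. s\<^sup>2 * (t0\<^sup>2 * w y))"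
          using Iw by auto
        ultimately show ?thesis by (simp del: distrib_left_numeral)
      qed
      finally have "0 \<le> (1 / (1 + s)) *
          (s * (2 * t0\<^sup>2 * (\<integral>y. w y \<partial>\<nu>) - m) + s\<^sup>2 * (t0\<^sup>2 * (\<integral>y. w y \<partial>\<nu>)))" .
      moreover have "0 < 1 / (1 + s)" using s by (simp add: abs_less_iff)
      ultimately show ?thesis by (meson mult_pos_neg not_less)
    qed
    then have "2 * t0\<^sup>2 * (\<integral>y. w y \<partial>\<nu>) - m = 0" by (rule linear_term_zero)
    then show ?thesis by simp
  qed
  show thesis
  proof (rule that[OF t0])
    fix i :: nat assume "i < 3"
    show "(\<integral>y. sphere_map b0 t0 i y \<partial>\<nu>) = 0"
    proof (cases "i = 0")
      case True
      have "(\<integral>y. 1 - 2 * t0\<^sup>2 * w y \<partial>\<nu>) = m - 2 * t0\<^sup>2 * (\<integral>y. w y \<partial>\<nu>)"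
        using Iw by (simp add: m_def sp)
      then show ?thesis using True scale by (simp add: sphere_map_def w_def q_def)
    next
      case False
      have "(\<integral>y. 2 * t0 * ((y $ of_nat i - b0 $ of_nat i) * w y) \<partial>\<nu>) = 0"
        using coordinate[of "of_nat i"] by simp
      moreover have "sphere_map b0 t0 i = (\<lambda>y. 2 * t0 * ((y $ of_nat i - b0 $ of_nat i) * w y))"
        using False by (intro ext) (simp only: sphere_map_def w_def q_def if_False mult.assoc)
      ultimately show ?thesis by simp
    qed
  qed
qed

section \<open>Weak compactness of probability measures on a compact surface\<close>

text \<open>With base 2 instead of 3, points with different digits could have equal codes.\<close>

definition digit_code :: "(nat \<Rightarrow> 'a set) \<Rightarrow> 'a \<Rightarrow> real" where
  "digit_code U x = (\<Sum>i. indicator (U i) x * (1 / 3) ^ i)"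

lemma summable_digit_code: "summable (\<lambda>i. indicator (U i) x * (1 / 3) ^ i :: real)"
  by (rule summable_comparison_test[OF _ summable_geometric[of "1 / 3 :: real"]])
    (auto simp: indicator_def)

lemma digit_code_nonneg: "0 \<le> digit_code U x"
  unfolding digit_code_def by (rule suminf_nonneg[OF summable_digit_code]) simp

lemma digit_code_le: "digit_code U x \<le> 2"
proof -
  have "digit_code U x \<le> (\<Sum>i. (1 / 3) ^ i)"
    unfolding digit_code_def
    by (rule suminf_le[OF _ summable_digit_code summable_geometric]) (auto simp: indicator_def)
  also have "\<dots> = 3 / 2" by (subst suminf_geometric) auto
  finally show ?thesis by simp
qed

text \<open>The first digit j where the codes differ contributes 3^(-j), and all later digits
  together at most half of that. The bound depends on \<open>i\<close> alone since j \<le>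
  i.\<close>

lemma digit_code_separated:
  assumes "x \<in> U i" "y \<notin> U i"
  shows "1 / (2 * 3 ^ i) \<le> \<bar>digit_code U x - digit_code U y\<bar>"
proof -
  define d where "d = (\<lambda>l. indicator (U l) x - indicator (U l) y :: real)"
  define f where "f = (\<lambda>l. d l * (1 / 3) ^ l)"
  have sf: "summable f"
    unfolding f_def d_def left_diff_distrib by (intro summable_diff summable_digit_code)
  have eq: "digit_code U x - digit_code U y = suminf f"
    unfolding digit_code_def f_def d_def left_diff_distrib
    by (rule suminf_diff[OF summable_digit_code summable_digit_code])
  define j where "j = (LEAST l. d l \<noteq> 0)"
  have "d i \<noteq> 0" using assms by (simp add: d_def)
  then have dj: "d j \<noteq> 0" and ji: "j \<le> i"
    unfolding j_def by (rule LeastI, rule Least_le)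
  have d0: "d l = 0" if "l < j" for l using not_less_Least[of l "\<lambda>l. d l \<noteq> 0"] that by (auto simp: j_def)
  have d1: "\<bar>d l\<bar> \<le> 1" for l by (simp add: d_def indicator_def)
  have dj1: "\<bar>d j\<bar> = 1" using dj by (auto simp: d_def indicator_def split: if_splits)
  have "suminf f = (\<Sum>l. f (l + Suc j)) + (\<Sum>l<Suc j. f l)"
    by (rule suminf_split_initial_segment[OF sf])
  also have "(\<Sum>l<Suc j. f l) = f j" using d0 by (simp add: f_def)
  finally have split: "suminf f = (\<Sum>l. f (l + Suc j)) + f j" .
  have "\<bar>\<Sum>l. f (l + Suc j)\<bar> \<le> (\<Sum>l. (1 / 3) ^ Suc j * (1 / 3) ^ l)"
  proof -
    have le: "norm (f (l + Suc j)) \<le> (1 / 3) ^ Suc j * (1 / 3) ^ l" for l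
      using d1[of "l + Suc j"] unfolding f_def by (simp add: abs_mult power_add divide_right_mono mult_ac)
    have "norm (\<Sum>l. f (l + Suc j)) \<le> (\<Sum>l. (1 / 3) ^ Suc j * (1 / 3) ^ l)"
      by (rule norm_suminf_le[OF le]) (intro summable_mult summable_geometric, simp)
    then show ?thesis by simp
  qed
  also have "\<dots> = (1 / 3) ^ Suc j * (3 / 2)"
    by (subst suminf_mult) (auto simp: suminf_geometric summable_geometric)
  finally have tail: "\<bar>\<Sum>l. f (l + Suc j)\<bar> \<le> (1 / 3) ^ j / 2" by simp
  have "\<bar>f j\<bar> = (1 / 3) ^ j" using dj1 by (simp add: f_def abs_mult)
  then have "(1 / 3) ^ j / 2 \<le> \<bar>suminf f\<bar>" using tail split by linarith
  moreover have "(1 / 3 :: real) ^ i \<le> (1 / 3) ^ j" by (rule power_decreasing[OF ji]) auto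
  ultimately show ?thesis by (simp add: eq power_one_over)
qed

context riemannian_surface
begin

lemma Hausdorff: "Hausdorff_space (top_of_set M)"
  using smooth_surface unfolding smooth_surface_def by blast

text \<open>Taken from a countable base. The open set \<open>Q\<close> around y, rather than just y
  outside \<open>U i\<close>, is what makes the separation of codes persist under limits.\<close>

lemma separating_open_sets:
  obtains U :: "nat \<Rightarrow> 'a set" where "\<And>i. openin (top_of_set M) (U i)"
    "\<And>x y. x \<in> M \<Longrightarrow> y \<in> M \<Longrightarrow> x \<noteq> y \<Longrightarrow>
      \<exists>i Q. x \<in> U i \<and> openin (top_of_set M) Q \<and> y \<in> Q \<and> Q \<inter> U i = {}"
proof -
  obtain \<B> where \<B>: "countable \<B>" "\<And>V. V \<in> \<B> \<Longrightarrow> openin (top_of_set M) V"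
    "\<And>U x. openin (top_of_set M) U \<Longrightarrow> x \<in> U \<Longrightarrow> \<exists>V\<in>\<B>. x \<in> V \<and> V \<subseteq> U"
    using smooth_surface unfolding smooth_surface_def second_countable_def by metis
  obtain x0 where "x0 \<in> M" using smooth_surface unfolding smooth_surface_def by blast
  then have "\<B> \<noteq> {}" using \<B>(3)[of M x0] by auto
  then have ran: "range (from_nat_into \<B>) = \<B>" by (rule range_from_nat_into[OF _ \<B>(1)])
  show thesis
  proof
    show "openin (top_of_set M) (from_nat_into \<B> i)" for i using \<B>(2) ran by blast
    fix x y assume "x \<in> M" "y \<in> M" "x \<noteq> y"
    then obtain P Q where PQ: "openin (top_of_set M) P" "openin (top_of_set M) Q" "x \<in> P" "y \<in> Q" "disjnt P Q"
      using Hausdorff unfolding Hausdorff_space_def by (metis topspace_euclidean_subtopology)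
    obtain V where "V \<in> \<B>" "x \<in> V" "V \<subseteq> P" using \<B>(3)[OF PQ(1,3)] by blast
    moreover obtain i where "V = from_nat_into \<B> i" using \<open>V \<in> \<B>\<close> ran by blast
    moreover have "Q \<inter> V = {}" using PQ(5) \<open>V \<subseteq> P\<close> by (auto simp: disjnt_def)
    ultimately show "\<exists>i Q. x \<in> from_nat_into \<B> i \<and> openin (top_of_set M) Q \<and> y \<in> Q \<and> Q \<inter> from_nat_into \<B> i = {}"
      using PQ(2,4) by blast
  qed
qed

text \<open>\<open>M\<close> is coded injectively by real numbers. The code is only Borel, but it has a continuous
  inverse on the closure of its range, so Helly's selection theorem carries over from the line.\<close>

lemma continuous_decoding:
  obtains s :: "'a \<Rightarrow> real" and p :: "real \<Rightarrow> 'a" where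
    "s \<in> borel_measurable borel_M" "\<And>x. 0 \<le> s x" "\<And>x. s x \<le> 2"
    "continuous_on (closure (s ` M)) p" "\<And>k. k \<in> closure (s ` M) \<Longrightarrow> p k \<in> M"
    "\<And>x. x \<in> M \<Longrightarrow> p (s x) = x"
proof -
  let ?X = "top_of_set M"
  obtain U :: "nat \<Rightarrow> 'a set" where U: "\<And>i. openin ?X (U i)"
    "\<And>x y. x \<in> M \<Longrightarrow> y \<in> M \<Longrightarrow> x \<noteq> y \<Longrightarrow> \<exists>i Q. x \<in> U i \<and> openin ?X Q \<and> y \<in> Q \<and> Q \<inter> U i = {}"
    by (rule separating_open_sets) blast
  define s where "s = digit_code U"
  \<comment> \<open>Says that \<open>k\<close> is a cluster value of the code at \<open>x\<close>;
    the code itself need not be continuous.\<close>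
  define near where "near = (\<lambda>k x. \<forall>N \<epsilon>. openin ?X N \<longrightarrow> x \<in> N \<longrightarrow> 0 < \<epsilon> \<longrightarrow> (\<exists>z\<in>N. \<bar>s z - k\<bar> < \<epsilon>))"
  have near_s: "near (s x) x" for x unfolding near_def by (metis abs_zero diff_self)
  \<comment> \<open>Codes of points in \<open>U i\<close> and in \<open>Q\<close> differ by at least
    \<open>1 / (2 * 3 ^ i)\<close>, so they cannot both come within half of this of
    \<open>k\<close>.\<close>
  have unique: "x = y" if xy: "near k x" "near k y" "x \<in> M" "y \<in> M" for k x y
  proof (rule ccontr)
    assume "x \<noteq> y"
    then obtain i Q where Q: "x \<in> U i" "openin ?X Q" "y \<in> Q" "Q \<inter> U i = {}" using U(2) xy(3,4) by blast
    have e: "0 < 1 / (4 * 3 ^ i :: real)" by simp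
    obtain z where z: "z \<in> U i" "\<bar>s z - k\<bar> < 1 / (4 * 3 ^ i)"
      using xy(1) U(1) Q(1) e unfolding near_def by blast
    obtain z' where z': "z' \<in> Q" "\<bar>s z' - k\<bar> < 1 / (4 * 3 ^ i)"
      using xy(2) Q(2,3) e unfolding near_def by blast
    have "1 / (2 * 3 ^ i) \<le> \<bar>s z - s z'\<bar>"
      unfolding s_def by (rule digit_code_separated[of z U i]) (use z(1) z'(1) Q(4) in blast)+
    moreover have "1 / (2 * 3 ^ i :: real) = 1 / (4 * 3 ^ i) + 1 / (4 * 3 ^ i)" by simp
    ultimately show False using z(2) z'(2) by linarith
  qed
  \<comment> \<open>Compactness makes the gap between codes and \<open>k\<close> uniform. With C = M
    this yields a decoded point for every \<open>k\<close> in the closure, with the complement of a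
    neighbourhood the continuity of the decoding.\<close>
  have far: "\<exists>O' \<epsilon>. openin ?X O' \<and> C \<subseteq> O' \<and> 0 < \<epsilon> \<and> (\<forall>z\<in>O'. \<epsilon> \<le> \<bar>s z - k\<bar>)"
    if C: "closedin ?X C" "\<And>x. x \<in> C \<Longrightarrow> \<not> near k x" for C k
  proof -
    have "compactin ?X C"
      by (rule closedin_compact_space[OF _ C(1)]) (use compact in \<open>simp add: compact_space_subtopology\<close>)
    define \<U> where "\<U> = {N. openin ?X N \<and> (\<exists>\<epsilon>>0. \<forall>z\<in>N. \<epsilon> \<le> \<bar>s z - k\<bar>)}"
    have "C \<subseteq> \<Union>\<U>"
    proof
      fix x assume "x \<in> C"
      then obtain N \<epsilon> where "openin ?X N" "x \<in> N" "0 < \<epsilon>" "\<forall>z\<in>N. \<epsilon> \<le> \<bar>s z - k\<bar>"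
        using C(2) unfolding near_def by (metis not_less)
      then show "x \<in> \<Union>\<U>" unfolding \<U>_def by blast
    qed
    moreover have "openin ?X N" if "N \<in> \<U>" for N using that unfolding \<U>_def by blast
    ultimately obtain \<F> where \<F>: "finite \<F>" "\<F> \<subseteq> \<U>" "C \<subseteq> \<Union>\<F>"
      using compactinD[OF \<open>compactin ?X C\<close>, of \<U>] by blast
    have "\<exists>\<epsilon>>0. \<forall>z\<in>\<Union>\<F>. \<epsilon> \<le> \<bar>s z - k\<bar>"
      using \<F>(1,2)
    proof (induction \<F> rule: finite_induct)
      case empty
      then show ?case by (intro exI[of _ 1]) simp
    next
      case (insert N \<F>)
      obtain \<epsilon>1 where e1: "0 < \<epsilon>1" "\<forall>z\<in>\<Union>\<F>. \<epsilon>1 \<le> \<bar>s z - k\<bar>" using insert by blast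
      obtain \<epsilon>2 where e2: "0 < \<epsilon>2" "\<forall>z\<in>N. \<epsilon>2 \<le> \<bar>s z - k\<bar>" using insert.prems unfolding \<U>_def by blast
      show ?case
        by (intro exI[of _ "min \<epsilon>1 \<epsilon>2"]) (use e1 e2 in \<open>auto simp: min_le_iff_disj\<close>)
    qed
    moreover have "openin ?X (\<Union>\<F>)" using \<F>(2) unfolding \<U>_def by (intro openin_Union) blast
    ultimately show ?thesis using \<F>(3) by blast
  qed
  have exists: "\<exists>x. x \<in> M \<and> near k x" if k: "k \<in> closure (s ` M)" for k
  proof (rule ccontr)
    assume "\<nexists>x. x \<in> M \<and> near k x"
    then obtain O' \<epsilon> where "M \<subseteq> O'" "0 < \<epsilon>" "\<forall>z\<in>O'. \<epsilon> \<le> \<bar>s z - k\<bar>"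
      using far[of M k] closedin_subtopology_refl[of euclidean M] by (metis subset_UNIV topspace_euclidean)
    moreover obtain z where "z \<in> M" "\<bar>s z - k\<bar> < \<epsilon>"
      using k \<open>0 < \<epsilon>\<close> unfolding closure_approachable by (auto simp: dist_real_def)
    ultimately show False by (meson not_less subsetD)
  qed
  define p where "p = (\<lambda>k. SOME x. x \<in> M \<and> near k x)"
  have pk: "p k \<in> M \<and> near k (p k)" if "k \<in> closure (s ` M)" for k
    unfolding p_def by (rule someI_ex[OF exists[OF that]])
  have p: "p k \<in> M" "near k (p k)" if "k \<in> closure (s ` M)" for k
    by (rule conjunct1[OF pk[OF that]], rule conjunct2[OF pk[OF that]])
  have ps: "p (s x) = x" if "x \<in> M" for x
  proof -
    have k: "s x \<in> closure (s ` M)" by (rule subsetD[OF closure_subset imageI[OF that]])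
    show ?thesis by (rule unique[OF p(2)[OF k] near_s p(1)[OF k] that])
  qed
  have cont: "continuous_on (closure (s ` M)) p"
    unfolding continuous_on_topological
  proof (intro ballI allI impI)
    fix k B assume k: "k \<in> closure (s ` M)" and B: "open B" "p k \<in> B"
    have cl: "closedin ?X (M - M \<inter> B)"
      by (rule closedin_diff[OF closedin_subtopology_refl[THEN iffD2]]) (use B(1) in \<open>auto simp: openin_open_Int\<close>)
    have far_k: "\<not> near k x" if "x \<in> M - M \<inter> B" for x
      using unique[OF _ p(2)[OF k] _ p(1)[OF k], of x] that B(2) by blast
    obtain O' \<epsilon> where O': "openin ?X O'" "M - M \<inter> B \<subseteq> O'" "0 < \<epsilon>" "\<forall>z\<in>O'. \<epsilon> \<le> \<bar>s z - k\<bar>"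
      using far[OF cl far_k] by blast
    show "\<exists>A. open A \<and> k \<in> A \<and> (\<forall>k'\<in>closure (s ` M). k' \<in> A \<longrightarrow> p k' \<in> B)"
    proof (intro exI conjI ballI impI)
      show "open (ball k (\<epsilon> / 2))" "k \<in> ball k (\<epsilon> / 2)" using O'(3) by auto
      fix k' assume k': "k' \<in> closure (s ` M)" "k' \<in> ball k (\<epsilon> / 2)"
      show "p k' \<in> B"
      proof (rule ccontr)
        assume "p k' \<notin> B"
        then have "p k' \<in> O'" using p(1)[OF k'(1)] O'(2) by blast
        then obtain z where "z \<in> O'" "\<bar>s z - k'\<bar> < \<epsilon> / 2"
          using p(2)[OF k'(1), unfolded near_def, rule_format, OF O'(1) _ half_gt_zero[OF O'(3)]] by blast
        moreover have "\<epsilon> \<le> \<bar>s z - k\<bar>" using O'(4) \<open>z \<in> O'\<close> by blast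
        moreover have "\<bar>k - k'\<bar> < \<epsilon> / 2" using k'(2) by (simp add: dist_real_def)
        ultimately show False by linarith
      qed
    qed
  qed
  have meas: "s \<in> borel_measurable borel_M"
    unfolding s_def digit_code_def[abs_def]
    by (intro borel_measurable_suminf borel_measurable_times borel_measurable_indicator sets_borel_M_openin U(1)
        borel_measurable_const)
  show thesis
    by (rule that[OF meas _ _ cont p(1) ps]) (simp_all add: s_def digit_code_nonneg digit_code_le)
qed

lemma compact_sets_borel_M:
  assumes "compact C" "C \<subseteq> M"
  shows "C \<in> sets borel_M"
proof -
  have "compactin (top_of_set M) C" using assms by (simp add: compactin_subtopology)
  then have "closedin (top_of_set M) C" by (rule compactin_imp_closedin[OF Hausdorff])
  then have "openin (top_of_set M) (M - C)" by (simp add: closedin_def)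
  then have "M - C \<in> sets borel_M" by (rule sets_borel_M_openin)
  then have "M - (M - C) \<in> sets borel_M"
    using sets.compl_sets[of "M - C" borel_M] by (simp add: space_restrict_space)
  moreover have "M - (M - C) = C" using assms(2) by blast
  ultimately show ?thesis by simp
qed

text \<open>The measures are pushed to the line by the code, and a limit there is pulled back by the
  decoding. The limit may charge points of the closure that are not codes; the decoding still sends
  these to \<open>M\<close>.\<close>

theorem weakly_convergent_subsequence:
  assumes \<mu>: "\<And>n. sets (\<mu> n) = sets borel_M" "\<And>n. emeasure (\<mu> n) M = 1"
  obtains r :: "nat \<Rightarrow> nat" and \<mu>' where "strict_mono r" "radon_measure M \<mu>'" "emeasure \<mu>' M = 1"
    "weakly_converges M (\<lambda>n. \<mu> (r n)) \<mu>'"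
proof -
  obtain s :: "'a \<Rightarrow> real" and p :: "real \<Rightarrow> 'a" where
    s: "s \<in> borel_measurable borel_M" "\<And>x. 0 \<le> s x" "\<And>x. s x \<le> 2"
    and p: "continuous_on (closure (s ` M)) p" "\<And>k. k \<in> closure (s ` M) \<Longrightarrow> p k \<in> M"
      "\<And>x. x \<in> M \<Longrightarrow> p (s x) = x"
    by (rule continuous_decoding) blast
  define K where "K = closure (s ` M)"
  have K: "closed K" "K \<in> sets borel" by (simp_all add: K_def)
  have sK: "s x \<in> K" if "x \<in> M" for x unfolding K_def by (rule subsetD[OF closure_subset imageI[OF that]])
  have K_ne: "K \<noteq> {}" using sK smooth_surface unfolding smooth_surface_def by blast
  have sp: "space (\<mu> n) = M" for n
    using sets_eq_imp_space_eq[OF \<mu>(1)] by (simp add: space_restrict_space)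
  have s_meas: "s \<in> measurable (\<mu> n) borel" for n
    using s(1) by (simp cong: measurable_cong_sets add: \<mu>(1))
  have prob: "prob_space (\<mu> n)" for n by (rule prob_spaceI) (simp add: sp \<mu>(2))
  define \<nu> where "\<nu> = (\<lambda>n. distr (\<mu> n) borel s)"
  have rd: "real_distribution (\<nu> n)" for n
    unfolding \<nu>_def by (rule prob_space.real_distribution_distr[OF prob s_meas])
  have "tight \<nu>"
    unfolding tight_def
  proof (intro conjI allI impI)
    fix \<epsilon> :: real assume "0 < \<epsilon>"
    \<comment> \<open>Codes may equal 0 and the interval is open on the left, so it has to start
      below 0.\<close>
    have "measure (\<nu> n) {-1<..2} = 1" for n
    proof -
      have "s -` {-1<..2} \<inter> space (\<mu> n) = space (\<mu> n)"
      proof -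
        have "- 1 < s x" for x using s(2)[of x] by linarith
        then show ?thesis using s(3) by auto
      qed
      then show ?thesis
        unfolding \<nu>_def by (subst measure_distr[OF s_meas]) (auto simp: prob_space.prob_space[OF prob])
    qed
    then show "\<exists>a b. a < b \<and> (\<forall>n. 1 - \<epsilon> < measure (\<nu> n) {a<..b})"
      using \<open>0 < \<epsilon>\<close> by (intro exI[of _ "-1"] exI[of _ 2]) simp
  qed (rule rd)
  from tight_imp_convergent_subsubsequence[OF this strict_mono_id]
  obtain r \<nu>' where r: "strict_mono (r :: nat \<Rightarrow> nat)" "real_distribution \<nu>'" "weak_conv_m (\<nu> \<circ> id \<circ> r) \<nu>'"
    by blast
  interpret \<nu>': real_distribution \<nu>' by (rule r(2))
  have conv: "(\<lambda>n. \<integral>k. h k \<partial>\<nu> (r n)) \<longlonglongrightarrow> (\<integral>k. h k \<partial>\<nu>')"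
    if "continuous_on UNIV h" "\<And>k. \<bar>h k\<bar> \<le> B" for h :: "real \<Rightarrow> real" and B
  proof -
    have "(\<lambda>n. integral\<^sup>L ((\<nu> \<circ> id \<circ> r) n) h) \<longlonglongrightarrow> integral\<^sup>L \<nu>' h"
      by (rule weak_conv_imp_integral_bdd_continuous_conv[OF _ r(2,3)])
        (use that rd in \<open>auto simp: continuous_on_eq_continuous_at\<close>)
    then show ?thesis by simp
  qed
  have int_\<nu>: "(\<integral>k. h k \<partial>\<nu> n) = (\<integral>x. h (s x) \<partial>\<mu> n)" if "continuous_on UNIV h" for h :: "real \<Rightarrow> real" and n
    unfolding \<nu>_def by (rule integral_distr[OF s_meas borel_measurable_continuous_onI[OF that]])
  have AE_K: "AE k in \<nu>'. k \<in> K"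
  proof -
    \<comment> \<open>The distance to \<open>K\<close> has integral 0 along the sequence; truncating
      it makes it an admissible test function for the limit.\<close>
    define h where "h = (\<lambda>k. min 1 (infdist k K))"
    have h: "continuous_on UNIV h" "\<And>k. \<bar>h k\<bar> \<le> 1" "\<And>k. 0 \<le> h k"
      unfolding h_def by (auto intro!: continuous_intros simp: infdist_nonneg)
    have "(\<integral>k. h k \<partial>\<nu> n) = 0" for n
    proof -
      have "(\<integral>x. h (s x) \<partial>\<mu> n) = (\<integral>x. 0 \<partial>\<mu> n)"
        by (rule Bochner_Integration.integral_cong) (auto simp: sp h_def sK)
      then show ?thesis using int_\<nu>[OF h(1)] by simp
    qed
    then have "(\<integral>k. h k \<partial>\<nu>') = 0"
      using LIMSEQ_unique[OF conv[OF h(1,2)]] by simp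
    moreover have "integrable \<nu>' h"
      by (rule \<nu>'.integrable_const_bound[where B = 1])
        (use h borel_measurable_continuous_onI[OF h(1)] in auto)
    ultimately have "AE k in \<nu>'. h k = 0"
      using integral_nonneg_eq_0_iff_AE[of \<nu>' h] h(3) by simp
    then show ?thesis
    proof eventually_elim
      case (elim k)
      then have "infdist k K = 0" by (auto simp: h_def min_def split: if_splits)
      then show ?case using in_closed_iff_infdist_zero[OF K(1) K_ne] by simp
    qed
  qed
  let ?R = "restrict_space \<nu>' K"
  have KS: "K \<inter> space \<nu>' \<in> sets \<nu>'" using K(2) by simp
  have p_meas: "p \<in> measurable ?R borel_M"
  proof (rule measurable_restrict_space2)
    have "sets ?R = sets (restrict_space borel K)"
      by (rule sets_restrict_space_cong) simp
    then show "p \<in> measurable ?R borel"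
      using borel_measurable_continuous_on_restrict[OF p(1)] unfolding K_def
      by (simp cong: measurable_cong_sets)
  qed (use p(2) in \<open>auto simp: K_def space_restrict_space\<close>)
  define \<mu>' where "\<mu>' = distr ?R borel_M p"
  have \<mu>'_sets: "sets \<mu>' = sets borel_M" by (simp add: \<mu>'_def)
  have em: "emeasure \<mu>' B = emeasure \<nu>' {k \<in> K. p k \<in> B}" if "B \<in> sets borel_M" for B
  proof -
    have "emeasure \<mu>' B = emeasure ?R (p -` B \<inter> space ?R)"
      unfolding \<mu>'_def by (rule emeasure_distr[OF p_meas that])
    also have "p -` B \<inter> space ?R = {k \<in> K. p k \<in> B}" by (auto simp: space_restrict_space)
    also have "emeasure ?R {k \<in> K. p k \<in> B} = emeasure \<nu>' {k \<in> K. p k \<in> B}"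
      by (rule emeasure_restrict_space[OF KS]) auto
    finally show ?thesis .
  qed
  have pre_sets: "{k \<in> K. p k \<in> B} \<in> sets borel" if "B \<in> sets borel_M" for B
  proof -
    have "p -` B \<inter> space ?R \<in> sets ?R" by (rule measurable_sets[OF p_meas that])
    moreover have "p -` B \<inter> space ?R = {k \<in> K. p k \<in> B}" by (auto simp: space_restrict_space)
    ultimately show ?thesis using KS by (simp add: sets_restrict_space_iff)
  qed
  have M_sets: "M \<in> sets borel_M" by (rule compact_sets_borel_M[OF compact order_refl])
  have mass: "emeasure \<mu>' M = 1"
  proof -
    have "{k \<in> K. p k \<in> M} = K" using p(2) by (auto simp: K_def)
    then have "emeasure \<mu>' M = emeasure \<nu>' K" using em[OF M_sets] by simp
    also have "\<dots> = 1" by (rule \<nu>'.emeasure_eq_1_AE[OF _ AE_K]) (use K(2) in simp)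
    finally show ?thesis .
  qed
  have sp': "space \<mu>' = M" using sets_eq_imp_space_eq[OF \<mu>'_sets] by (simp add: space_restrict_space)
  have radon: "radon_measure M \<mu>'"
    unfolding radon_measure_def
  proof (intro conjI allI impI ballI)
    show "emeasure \<mu>' C < \<infinity>" if "compact C \<and> C \<subseteq> M" for C
    proof -
      have "emeasure \<mu>' C \<le> emeasure \<mu>' (space \<mu>')" by (rule emeasure_space)
      then show ?thesis using mass sp' by (simp add: le_less_trans)
    qed
    fix B assume "B \<in> sets \<mu>'"
    then have B: "B \<in> sets borel_M" by (simp add: \<mu>'_sets)
    have BM: "B \<subseteq> M" using sets.sets_into_space[OF B] by (simp add: space_restrict_space)
    show "emeasure \<mu>' B = (SUP C\<in>{C. compact C \<and> C \<subseteq> B}. emeasure \<mu>' C)"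
    proof (rule antisym)
      \<comment> \<open>Inner regularity comes from the line: the image under \<open>p\<close> of a
        compact set of codes is a compact subset of \<open>B\<close> with at least the same
        mass.\<close>
      have "emeasure \<mu>' B = (SUP C\<in>{C. C \<subseteq> {k \<in> K. p k \<in> B} \<and> compact C}. emeasure \<nu>' C)"
        unfolding em[OF B] by (rule inner_regular) (use pre_sets[OF B] in auto)
      also have "\<dots> \<le> (SUP C\<in>{C. compact C \<and> C \<subseteq> B}. emeasure \<mu>' C)"
      proof (rule SUP_least)
        fix C assume "C \<in> {C. C \<subseteq> {k \<in> K. p k \<in> B} \<and> compact C}"
        then have C: "C \<subseteq> {k \<in> K. p k \<in> B}" "compact C" by auto
        have pC: "compact (p ` C)"
          by (rule compact_continuous_image[OF continuous_on_subset[OF p(1)] C(2)]) (use C(1) in \<open>auto simp: K_def\<close>)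
        have sub: "p ` C \<subseteq> B" using C(1) by blast
        have pC_sets: "p ` C \<in> sets borel_M" by (rule compact_sets_borel_M[OF pC]) (use sub BM in blast)
        have "emeasure \<nu>' C \<le> emeasure \<nu>' {k \<in> K. p k \<in> p ` C}"
          by (rule emeasure_mono) (use C(1) pre_sets[OF pC_sets] in auto)
        also have "\<dots> = emeasure \<mu>' (p ` C)" by (rule em[OF pC_sets, symmetric])
        also have "\<dots> \<le> (SUP C\<in>{C. compact C \<and> C \<subseteq> B}. emeasure \<mu>' C)"
          by (rule SUP_upper) (use pC sub in blast)
        finally show "emeasure \<nu>' C \<le> (SUP C\<in>{C. compact C \<and> C \<subseteq> B}. emeasure \<mu>' C)" .
      qed
      finally show "emeasure \<mu>' B \<le> (SUP C\<in>{C. compact C \<and> C \<subseteq> B}. emeasure \<mu>' C)" .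
      show "(SUP C\<in>{C. compact C \<and> C \<subseteq> B}. emeasure \<mu>' C) \<le> emeasure \<mu>' B"
        by (rule SUP_least) (use B \<mu>'_sets in \<open>auto intro: emeasure_mono\<close>)
    qed
  qed (rule \<mu>'_sets)
  have weak: "weakly_converges M (\<lambda>n. \<mu> (r n)) \<mu>'"
    unfolding weakly_converges_def
  proof (intro allI impI)
    fix f :: "'a \<Rightarrow> real" assume f: "continuous_on M f"
    have "bounded (f ` M)" by (rule compact_imp_bounded[OF compact_continuous_image[OF f compact]])
    then obtain B where B: "\<And>x. x \<in> M \<Longrightarrow> norm (f x) \<le> B" unfolding bounded_iff by blast
    have "0 \<le> B" using B[OF p(2)] K_ne norm_ge_zero order_trans unfolding K_def by (metis all_not_in_conv)
    have fp: "continuous_on K (\<lambda>k. f (p k))"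
      unfolding K_def by (rule continuous_on_compose2[OF f p(1)]) (use p(2) in blast)
    \<comment> \<open>Weak convergence on the line needs test functions defined everywhere, but
      \<open>p\<close> is continuous only on the closed set \<open>K\<close>; hence Tietze's
      theorem, which also preserves the bound.\<close>
    obtain h where h: "continuous_on UNIV h" "\<And>k. k \<in> K \<Longrightarrow> h k = f (p k)" "\<And>k. norm (h k) \<le> B"
      using Tietze[OF fp, of UNIV B] K(1) \<open>0 \<le> B\<close> B p(2) unfolding K_def by auto
    have 1: "(\<integral>x. f x \<partial>\<mu> n) = (\<integral>k. h k \<partial>\<nu> n)" for n
      unfolding int_\<nu>[OF h(1)]
      by (rule Bochner_Integration.integral_cong) (auto simp: sp h(2)[OF sK] p(3))
    have f_meas: "f \<in> borel_measurable borel_M" by (rule borel_measurable_continuous_on_restrict[OF f])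
    have "(\<integral>x. f x \<partial>\<mu>') = (\<integral>k. f (p k) \<partial>?R)"
      unfolding \<mu>'_def by (rule integral_distr[OF p_meas f_meas])
    also have "\<dots> = (\<integral>k. h k \<partial>?R)"
      by (rule Bochner_Integration.integral_cong) (auto simp: space_restrict_space h(2))
    also have "\<dots> = (\<integral>k. indicator K k *\<^sub>R h k \<partial>\<nu>')"
      by (rule integral_restrict_space[OF KS])
    also have "\<dots> = (\<integral>k. h k \<partial>\<nu>')"
    proof (rule integral_cong_AE)
      show "AE k in \<nu>'. indicator K k *\<^sub>R h k = h k" using AE_K by eventually_elim simp
    qed (use K(2) borel_measurable_continuous_onI[OF h(1)] in auto)
    finally have 2: "(\<integral>x. f x \<partial>\<mu>') = (\<integral>k. h k \<partial>\<nu>')" .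
    show "(\<lambda>n. \<integral>x. f x \<partial>\<mu> (r n)) \<longlonglongrightarrow> (\<integral>x. f x \<partial>\<mu>')"
      unfolding 1 2 by (rule conv[OF h(1)]) (use h(3) in simp)
  qed
  show thesis by (rule that[OF r(1) radon mass weak])
qed

end

section \<open>Concentration of measures and the first eigenvalue\<close>

context almost_euclidean_chart
begin

lemma supported_log_cutoff:
  assumes "0 < \<delta>" "\<delta> \<le> r\<^sup>2" "0 < L" "0 < r"
  shows "supported (log_cutoff \<delta> L)"
  unfolding supported_def
proof (intro conjI allI impI)
  show "Ck_on n UNIV (log_cutoff \<delta> L)" for n by (rule log_cutoff_smooth[OF assms(1,3)])
  fix y :: "real^2" assume "r < norm y"
  then have "r\<^sup>2 \<le> (norm y)\<^sup>2" using assms(4) by (intro power_mono) auto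
  then show "log_cutoff \<delta> L y = 0"
    by (rule log_cutoff_eq_0[OF assms(1,3) order_trans[OF assms(2)]])
qed

lemma supported_mult:
  assumes "supported f" "\<And>n. Ck_on n UNIV h"
  shows "supported (\<lambda>y. f y * h y)"
  unfolding supported_def
proof (intro conjI allI impI)
  show "Ck_on n UNIV (\<lambda>y. f y * h y)" for n
    by (rule Ck_on_mult[OF open_UNIV supported_smooth[OF assms(1)] assms(2)])
qed (use assms(1) in \<open>simp add: supported_def\<close>)

text \<open>Made total so that measures on \<open>M\<close> can be pushed to the plane. Its value 0
  off the chart is harmless, since it occurs with the factor or density \<open>extend f\<close>,
  which vanishes there.\<close>

definition total_coord :: "'a \<Rightarrow> real^2" where
  "total_coord x = indicator (fst \<kappa>) x *\<^sub>R coord x"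

lemma extend_mult: "extend (\<lambda>y. f y * h y) x = extend f x * h (total_coord x)"
  by (simp add: extend_def total_coord_def)

lemma total_coord_measurable:
  assumes "sets \<mu> = sets borel_M"
  shows "total_coord \<in> borel_measurable \<mu>"
proof -
  have "sets (restrict_space borel_M (fst \<kappa>)) = sets (restrict_space borel (fst \<kappa>))"
    using chart_subset[OF chart] by (simp add: sets_restrict_restrict_space Int_absorb1)
  then have "coord \<in> borel_measurable (restrict_space borel_M (fst \<kappa>))"
    using borel_measurable_continuous_on_restrict[OF continuous_on_coord] by (simp cong: measurable_cong_sets)
  moreover have "fst \<kappa> \<inter> space borel_M \<in> sets borel_M" by (rule sets.Int[OF sets_borel_M_chart[OF chart] sets.top])
  ultimately have "total_coord \<in> borel_measurable borel_M"
    unfolding total_coord_def[abs_def] by (simp add: borel_measurable_restrict_space_iff)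
  then show ?thesis by (simp cong: measurable_cong_sets add: assms)
qed

text \<open>The mean of \<open>extend (F i)\<close> is the integral of a component of the sphere map
  against the measure with density \<open>extend f\<close>. Hersch's normalisation is therefore
  applied to that measure, moved to the plane; variances then become second moments, which add up to
  the integral of \<open>extend f\<close> squared.\<close>

lemma eigenvalue_1_hersch:
  assumes gc: "g = (SOME g. g \<in> c)" and \<mu>: "sets \<mu> = sets borel_M" "emeasure \<mu> M = 1"
    and atoms: "\<And>x. x \<in> M \<Longrightarrow> emeasure \<mu> {x} = 0"
    and f: "supported f" "\<And>y. 0 \<le> f y" "\<And>y. f y \<le> 1" and r: "0 < r"
  shows "eigenvalue M \<A> c 1 \<mu> * ennreal (\<integral>x. (extend f x)\<^sup>2 \<partial>\<mu>) \<le>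
    ennreal ((1 + \<epsilon>) / (1 - \<epsilon>)) *
      ((\<integral>\<^sup>+y. ennreal ((norm (euclidean_gradient f y))\<^sup>2) \<partial>lborel) + ennreal (8 * pi))"
proof -
  have sp: "space \<mu> = M"
    using sets_eq_imp_space_eq[OF \<mu>(1)] by (simp add: space_restrict_space)
  have int: "integrable \<mu> u" if "continuous_on M u" for u :: "'a \<Rightarrow> real"
    by (rule integrable_continuous_on_compact[OF compact \<mu>(1) _ that]) (simp add: \<mu>(2))
  have ext0: "0 \<le> extend f x" for x by (simp add: extend_def f(2))
  have cont: "continuous_on M (extend f)" by (rule continuous_on_extend[OF f(1)])
  show ?thesis
  \<comment> \<open>A barycentre requires positive mass. Without it \<open>extend f\<close> vanishes
    almost everywhere and the left-hand side is 0.\<close>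
  proof (cases "(\<integral>x. extend f x \<partial>\<mu>) = 0")
    case True
    then have "AE x in \<mu>. extend f x = 0"
      using integral_nonneg_eq_0_iff_AE[OF int[OF cont]] ext0 by simp
    then have "AE x in \<mu>. (extend f x)\<^sup>2 = 0" by eventually_elim simp
    then have "(\<integral>x. (extend f x)\<^sup>2 \<partial>\<mu>) = 0"
      using integral_nonneg_eq_0_iff_AE[OF int[OF continuous_on_power[OF cont]]] by simp
    then show ?thesis by simp
  next
    case False
    let ?d = "density \<mu> (\<lambda>x. ennreal (extend f x))"
    define \<nu> where "\<nu> = distr ?d borel total_coord"
    have ext_meas: "extend f \<in> borel_measurable \<mu>" using int[OF cont] by auto
    have tc: "total_coord \<in> borel_measurable ?d" "total_coord \<in> borel_measurable \<mu>"
      using total_coord_measurable[OF \<mu>(1)] by simp_all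
    have total: "emeasure \<nu> UNIV = ennreal (\<integral>x. extend f x \<partial>\<mu>)"
    proof -
      have "emeasure \<nu> UNIV = emeasure ?d (space ?d)"
        unfolding \<nu>_def by (subst emeasure_distr[OF tc(1)]) auto
      also have "\<dots> = (\<integral>\<^sup>+x\<in>space \<mu>. ennreal (extend f x) \<partial>\<mu>)"
        by (subst emeasure_density) (use ext_meas in auto)
      also have "\<dots> = (\<integral>\<^sup>+x. ennreal (extend f x) \<partial>\<mu>)"
        by (rule nn_integral_cong) simp
      also have "\<dots> = ennreal (\<integral>x. extend f x \<partial>\<mu>)"
        by (rule nn_integral_eq_integral[OF int[OF cont]]) (simp add: ext0)
      finally show ?thesis .
    qed
    have "0 < (\<integral>x. extend f x \<partial>\<mu>)"
      using False Bochner_Integration.integral_nonneg[of \<mu> "extend f"] ext0 by (simp add: less_le)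
    then have pos: "0 < measure \<nu> UNIV" by (simp add: measure_def total)
    have fin: "finite_measure \<nu>" by (rule finite_measureI) (simp add: \<nu>_def total[unfolded \<nu>_def])
    have supp: "AE y in \<nu>. norm y \<le> r"
    proof -
      have "AE x in ?d. norm (total_coord x) \<le> r"
      proof (subst AE_density)
        show "AE x in \<mu>. 0 < ennreal (extend f x) \<longrightarrow> norm (total_coord x) \<le> r"
        proof (rule AE_I2, rule impI)
          fix x assume "0 < ennreal (extend f x)"
          then have "x \<in> fst \<kappa>" "f (coord x) \<noteq> 0" by (auto simp: extend_def split: if_splits)
          then show "norm (total_coord x) \<le> r"
            using f(1) unfolding supported_def total_coord_def by (auto simp: not_less[symmetric])
        qed
      qed (use ext_meas in simp)
      then show ?thesis
        unfolding \<nu>_def by (subst AE_distr_iff[OF tc(1)]) simp_all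
    qed
    \<comment> \<open>The coordinates are injective on the chart, so at most one of its points lies
      over \<open>y\<close>. The rest of the preimage is outside the chart, where the density is
      0.\<close>
    have at: "emeasure \<nu> {y} = 0" for y
    proof -
      have vim: "total_coord -` {y} \<inter> space \<mu> \<in> sets \<mu>" by (rule measurable_sets[OF tc(2)]) simp
      have "emeasure \<nu> {y} = emeasure ?d (total_coord -` {y} \<inter> space \<mu>)"
        unfolding \<nu>_def by (subst emeasure_distr[OF tc(1)]) auto
      also have "\<dots> = (\<integral>\<^sup>+x. ennreal (extend f x) * indicator (total_coord -` {y} \<inter> space \<mu>) x \<partial>\<mu>)"
        by (rule emeasure_density) (use ext_meas vim in auto)
      also have "\<dots> = (\<integral>\<^sup>+x. 0 \<partial>\<mu>)"
      proof (rule nn_integral_cong_AE)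
        have z: "ennreal (extend f x) * indicator (total_coord -` {y} \<inter> space \<mu>) x = 0"
          if "x \<notin> fst \<kappa> \<or> coord x \<noteq> y" for x
          using that by (auto simp: extend_def total_coord_def indicator_def)
        show "AE x in \<mu>. ennreal (extend f x) * indicator (total_coord -` {y} \<inter> space \<mu>) x = 0"
        proof (cases "\<exists>x\<in>fst \<kappa>. coord x = y")
          case True
          then obtain x1 where x1: "x1 \<in> fst \<kappa>" "coord x1 = y" by blast
          have "x1 \<in> M" using x1(1) chart_subset[OF chart] by blast
          then have "{x1} \<in> null_sets \<mu>"
            using atoms compact_sets_borel_M[of "{x1}"] \<mu>(1) by (auto simp: null_sets_def)
          then show ?thesis
          proof (rule AE_I')
            show "{x \<in> space \<mu>. \<not> ennreal (extend f x) * indicator (total_coord -` {y} \<inter> space \<mu>) x = 0} \<subseteq> {x1}"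
            proof
              fix x assume "x \<in> {x \<in> space \<mu>. \<not> ennreal (extend f x) * indicator (total_coord -` {y} \<inter> space \<mu>) x = 0}"
              then have "x \<in> fst \<kappa>" "coord x = y" using z[of x] by auto
              then show "x \<in> {x1}" using inj_onD[OF inj_on_coord, of x x1] x1 by simp
            qed
          qed
        next
          case False
          then show ?thesis using z by (intro AE_I2) blast
        qed
      qed
      finally show ?thesis by simp
    qed
    obtain b t where bt: "0 < t" "\<And>i. i < 3 \<Longrightarrow> (\<integral>y. sphere_map b t i y \<partial>\<nu>) = 0"
      using conformal_barycentre_exists[OF fin _ supp _ at pos] r unfolding \<nu>_def by (metis less_imp_le sets_distr)
    define F where "F = (\<lambda>i y. f y * sphere_map b t i y)"
    have F: "supported (F i)" for i
      unfolding F_def by (rule supported_mult[OF f(1) sphere_map_smooth[OF bt(1)]])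
    have mean: "(\<integral>x. extend (F i) x \<partial>\<mu>) = 0" if "i < 3" for i
    proof -
      have "sphere_map b t i \<in> borel_measurable borel"
        using sphere_map_smooth[OF bt(1), of 0] by (intro borel_measurable_continuous_onI) simp
      then have sm: "sphere_map b t i \<in> borel_measurable borel"
        "(\<lambda>x. sphere_map b t i (total_coord x)) \<in> borel_measurable \<mu>"
        using measurable_compose[OF tc(2)] by auto
      have "0 = (\<integral>y. sphere_map b t i y \<partial>\<nu>)" using bt(2)[OF that] by simp
      also have "\<dots> = (\<integral>x. sphere_map b t i (total_coord x) \<partial>?d)"
        unfolding \<nu>_def by (rule integral_distr[OF tc(1) sm(1)])
      also have "\<dots> = (\<integral>x. extend f x *\<^sub>R sphere_map b t i (total_coord x) \<partial>\<mu>)"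
        by (rule integral_density[OF sm(2) ext_meas]) (simp add: ext0)
      also have "\<dots> = (\<integral>x. extend (F i) x \<partial>\<mu>)"
        unfolding F_def extend_mult by simp
      finally show ?thesis by simp
    qed
    have intF: "integrable \<mu> (\<lambda>x. (extend (F i) x)\<^sup>2)" for i
      by (rule int[OF continuous_on_power[OF continuous_on_extend[OF F]]])
    have "(\<integral>x. (extend f x)\<^sup>2 \<partial>\<mu>) = (\<integral>x. (\<Sum>i<3. (extend (F i) x)\<^sup>2) \<partial>\<mu>)"
    proof (rule Bochner_Integration.integral_cong)
      fix x
      show "(extend f x)\<^sup>2 = (\<Sum>i<3. (extend (F i) x)\<^sup>2)"
        unfolding F_def extend_mult power_mult_distrib sum_distrib_left[symmetric]
        using sphere_map_norm[OF bt(1)] by simp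
    qed simp
    also have "\<dots> = (\<Sum>i<3. \<integral>x. (extend (F i) x)\<^sup>2 \<partial>\<mu>)"
      by (rule Bochner_Integration.integral_sum) (rule intF)
    finally have "ennreal (\<integral>x. (extend f x)\<^sup>2 \<partial>\<mu>) = (\<Sum>i<3. ennreal (\<integral>x. (extend (F i) x)\<^sup>2 \<partial>\<mu>))"
      by (simp add: sum_ennreal)
    then have "eigenvalue M \<A> c 1 \<mu> * ennreal (\<integral>x. (extend f x)\<^sup>2 \<partial>\<mu>) =
        (\<Sum>i<3. eigenvalue M \<A> c 1 \<mu> * ennreal (\<integral>x. (extend (F i) x)\<^sup>2 \<partial>\<mu>))"
      by (simp only: sum_distrib_left)
    also have "\<dots> \<le> (\<Sum>i<3. ennreal ((1 + \<epsilon>) / (1 - \<epsilon>)) *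
        (\<integral>\<^sup>+y. ennreal ((norm (euclidean_gradient (F i) y))\<^sup>2) \<partial>lborel))"
    proof (rule sum_mono)
      fix i :: nat assume "i \<in> {..<3}"
      then show "eigenvalue M \<A> c 1 \<mu> * ennreal (\<integral>x. (extend (F i) x)\<^sup>2 \<partial>\<mu>) \<le> ennreal ((1 + \<epsilon>) / (1 - \<epsilon>)) *
          (\<integral>\<^sup>+y. ennreal ((norm (euclidean_gradient (F i) y))\<^sup>2) \<partial>lborel)"
        using eigenvalue_1_extend_variance_le[OF gc \<mu> F, of i] mean[of i] by simp
    qed
    also have "\<dots> \<le> ennreal ((1 + \<epsilon>) / (1 - \<epsilon>)) *
      ((\<integral>\<^sup>+y. ennreal ((norm (euclidean_gradient f y))\<^sup>2) \<partial>lborel) + ennreal (8 * pi))"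
      unfolding sum_distrib_left[symmetric] F_def
      by (intro mult_left_mono sum_energy_mult_sphere_map_le[OF bt(1)] supported_smooth f) auto
    finally show ?thesis .
  qed
qed

end

text \<open>Bounds from below the variance of a function that is 1 on a set of mass \<open>a\<close>
  and 0 on a set of mass at least \<open>z\<close>, whatever its mean \<open>m\<close> is.\<close>

lemma indicator_variance_lower_bound:
  fixes a z m :: real
  assumes "0 < a" "0 < z"
  shows "min a z / 2 \<le> a * (1 - m)\<^sup>2 + z * m\<^sup>2"
proof -
  have "1 / 2 \<le> (1 - m)\<^sup>2 + m\<^sup>2"
    using zero_le_power2[of "2 * m - 1"] by (simp add: power2_eq_square algebra_simps)
  then have "min a z * (1 / 2) \<le> min a z * ((1 - m)\<^sup>2 + m\<^sup>2)"
    using assms by (intro mult_left_mono) auto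
  also have "\<dots> \<le> a * (1 - m)\<^sup>2 + z * m\<^sup>2"
    unfolding distrib_left by (intro add_mono mult_right_mono) auto
  finally show ?thesis by simp
qed

context riemannian_surface
begin

text \<open>The variance of a fixed cutoff is continuous along the weak convergence, so the index
  tends to infinity first and L afterwards. The support of the cutoff, and with it the lower bound
  for the variance, does not depend on L.\<close>

lemma limit_has_no_partial_atom:
  assumes gc: "g = (SOME g. g \<in> c)"
    and \<nu>: "\<And>n. sets (\<nu> n) = sets borel_M" "\<And>n. emeasure (\<nu> n) M = 1"
    and \<nu>': "sets \<nu>' = sets borel_M" "emeasure \<nu>' M = 1"
    and weak: "weakly_converges M \<nu> \<nu>'"
    and s: "0 < s" "\<forall>\<^sub>F n in sequentially. ennreal s \<le> eigenvalue M \<A> c 1 (\<nu> n)"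
    and x0: "x0 \<in> M"
  shows "measure \<nu>' {x0} = 0 \<or> measure \<nu>' {x0} = 1"
proof (rule ccontr)
  have sp: "space (\<nu> n) = M" "space \<nu>' = M" for n
    using sets_eq_imp_space_eq[OF \<nu>(1)] sets_eq_imp_space_eq[OF \<nu>'(1)] by (simp_all add: space_restrict_space)
  interpret prob_space \<nu>' by (rule prob_spaceI) (simp add: sp \<nu>'(2))
  assume "\<not> (measure \<nu>' {x0} = 0 \<or> measure \<nu>' {x0} = 1)"
  moreover define a where "a = measure \<nu>' {x0}"
  ultimately have a: "0 < a" "a < 1"
    using measure_nonneg[of \<nu>' "{x0}"] prob_le_1[of "{x0}"] by (auto simp: less_le)
  \<comment> \<open>Any fixed distortion would do, because the energy tends to 0. The value 1 / 2
    produces the factor 3 in \<open>upper\<close>.\<close>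
  obtain \<kappa> B r where ch: "almost_euclidean_chart M \<A> g \<kappa> B (snd \<kappa> x0) r (1 / 2)" "x0 \<in> fst \<kappa>" "0 < r"
    by (rule almost_euclidean_chart_exists[OF x0, of "1 / 2"]) auto
  interpret almost_euclidean_chart M \<A> g \<kappa> B "snd \<kappa> x0" r "1 / 2" by (rule ch(1))
  have c0: "coord x0 = 0" by (simp add: coord_def)
  define N where "N = (\<lambda>n. {x \<in> fst \<kappa>. norm (coord x) < r / real (Suc n)})"
  have N_sets: "N n \<in> sets \<nu>'" for n
  proof -
    have "openin (top_of_set (fst \<kappa>)) (fst \<kappa> \<inter> coord -` ball 0 (r / real (Suc n)))"
      by (rule continuous_openin_preimage_gen[OF continuous_on_coord open_ball])
    then have "openin (top_of_set M) (fst \<kappa> \<inter> coord -` ball 0 (r / real (Suc n)))"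
      by (rule openin_trans[OF _ chart_openin[OF chart]])
    then have "fst \<kappa> \<inter> coord -` ball 0 (r / real (Suc n)) \<in> sets borel_M" by (rule sets_borel_M_openin)
    moreover have "fst \<kappa> \<inter> coord -` ball 0 (r / real (Suc n)) = N n" by (auto simp: N_def)
    ultimately show ?thesis by (simp add: \<nu>'(1))
  qed
  have "(\<lambda>n. measure \<nu>' (N n)) \<longlonglongrightarrow> measure \<nu>' (\<Inter>n. N n)"
  proof (rule finite_Lim_measure_decseq)
    show "decseq N"
    proof (rule decseq_SucI, rule subsetI)
      fix n x assume "x \<in> N (Suc n)"
      moreover have "r / real (Suc (Suc n)) \<le> r / real (Suc n)" using ch(3) by (intro divide_left_mono) auto
      ultimately show "x \<in> N n" unfolding N_def by auto
    qed
  qed (use N_sets in auto)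
  moreover have "(\<Inter>n. N n) = {x0}"
  proof
    show "(\<Inter>n. N n) \<subseteq> {x0}"
    proof
      fix x assume x: "x \<in> (\<Inter>n. N n)"
      then have xk: "x \<in> fst \<kappa>" unfolding N_def by blast
      have "norm (coord x) \<le> 0"
      proof (rule tendsto_lowerbound[OF LIMSEQ_Suc[OF lim_const_over_n[of r]]])
        show "\<forall>\<^sub>F n in sequentially. norm (coord x) \<le> r / real (Suc n)"
          using x unfolding N_def by (intro always_eventually allI) (auto intro: less_imp_le)
      qed simp
      then have "coord x = coord x0" by (simp add: c0)
      then show "x \<in> {x0}" using inj_onD[OF inj_on_coord _ xk ch(2)] by simp
    qed
    show "{x0} \<subseteq> (\<Inter>n. N n)" using ch(2,3) by (simp add: N_def c0)
  qed
  ultimately have "(\<lambda>n. measure \<nu>' (N n)) \<longlonglongrightarrow> a" by (simp add: a_def)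
  \<comment> \<open>Midway between a and 1, so that mass at least (1 - a) / 2 remains outside the
    neighbourhood.\<close>
  then have "\<forall>\<^sub>F n in sequentially. measure \<nu>' (N n) < (1 + a) / 2"
    by (rule order_tendstoD) (use a in simp)
  then obtain n where n: "measure \<nu>' (N n) < (1 + a) / 2"
    using eventually_happens'[OF sequentially_bot] by blast
  \<comment> \<open>With this \<delta> the cutoff vanishes outside \<open>N n\<close>.\<close>
  define \<delta> where "\<delta> = (r / real (Suc n))\<^sup>2"
  have rn: "0 < r / real (Suc n)" "r / real (Suc n) \<le> r" using ch(3) by (simp_all add: field_simps)
  have \<delta>: "0 < \<delta>" "\<delta> \<le> r\<^sup>2" unfolding \<delta>_def using rn by (auto intro: power_mono)
  obtain K :: real where K: "0 < K"
    "\<And>\<delta> L. 0 < \<delta> \<Longrightarrow> 1 \<le> L \<Longrightarrow>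
      (\<integral>\<^sup>+y. ennreal ((norm (euclidean_gradient (log_cutoff \<delta> L) y))\<^sup>2) \<partial>lborel) \<le> ennreal (K / L)"
    by (rule log_cutoff_energy_le) blast
  have upper: "s * (min a ((1 - a) / 2) / 2) \<le> 3 * (K / L)" if L: "1 \<le> L" for L
  proof -
    define u where "u = extend (log_cutoff \<delta> L)"
    have supp: "supported (log_cutoff \<delta> L)" by (rule supported_log_cutoff[OF \<delta> _ ch(3)]) (use L in simp)
    have cont: "continuous_on M u" unfolding u_def by (rule continuous_on_extend[OF supp])
    have int: "integrable \<mu> h" if "sets \<mu> = sets borel_M" "emeasure \<mu> M = 1" "continuous_on M h"
      for \<mu> and h :: "'a \<Rightarrow> real"
      by (rule integrable_continuous_on_compact[OF compact that(1) _ that(3)]) (simp add: that(2))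
    define var where "var = (\<lambda>\<mu>. \<integral>x. (u x - (\<integral>x. u x \<partial>\<mu>))\<^sup>2 \<partial>\<mu>)"
    have var: "var \<mu> = (\<integral>x. (u x)\<^sup>2 \<partial>\<mu>) - (\<integral>x. u x \<partial>\<mu>)\<^sup>2"
      if \<mu>: "sets \<mu> = sets borel_M" "emeasure \<mu> M = 1" for \<mu>
    proof -
      have "space \<mu> = M" using sets_eq_imp_space_eq[OF \<mu>(1)] by (simp add: space_restrict_space)
      then have "prob_space \<mu>" using \<mu>(2) by (intro prob_spaceI) simp
      then show ?thesis
        unfolding var_def
        by (rule prob_space.variance_eq[OF _ int[OF \<mu> cont] int[OF \<mu> continuous_on_power[OF cont]]])
    qed
    have "(\<lambda>k. var (\<nu> k)) \<longlonglongrightarrow> var \<nu>'"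
      unfolding var[OF \<nu>] var[OF \<nu>']
      using weak cont continuous_on_power[OF cont, of 2] unfolding weakly_converges_def
      by (intro tendsto_diff tendsto_power) auto
    then have "(\<lambda>k. s * var (\<nu> k)) \<longlonglongrightarrow> s * var \<nu>'" by (intro tendsto_intros)
    moreover have "\<forall>\<^sub>F k in sequentially. s * var (\<nu> k) \<le> 3 * (K / L)"
      using s(2)
    proof eventually_elim
      case (elim k)
      have v0: "0 \<le> var (\<nu> k)" unfolding var_def by simp
      have "ennreal (s * var (\<nu> k)) = ennreal s * ennreal (var (\<nu> k))"
        using s(1) v0 by (simp add: ennreal_mult)
      also have "\<dots> \<le> eigenvalue M \<A> c 1 (\<nu> k) * ennreal (var (\<nu> k))"
        by (intro mult_right_mono elim) simp
      also have "\<dots> \<le> ennreal ((1 + 1 / 2) / (1 - 1 / 2)) *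
          (\<integral>\<^sup>+y. ennreal ((norm (euclidean_gradient (log_cutoff \<delta> L) y))\<^sup>2) \<partial>lborel)"
        unfolding var_def u_def by (rule eigenvalue_1_extend_variance_le[OF gc \<nu> supp])
      also have "\<dots> \<le> ennreal 3 * ennreal (K / L)"
        by (rule mult_mono) (use K(2)[OF \<delta>(1) L] in auto)
      also have "\<dots> = ennreal (3 * (K / L))"
        by (rule ennreal_mult[symmetric]) (use K(1) L in auto)
      finally show ?case using K(1) L by (subst (asm) ennreal_le_iff) auto
    qed
    ultimately have "s * var \<nu>' \<le> 3 * (K / L)"
      by (rule tendsto_upperbound) simp
    moreover have "min a ((1 - a) / 2) / 2 \<le> var \<nu>'"
    proof -
      define m where "m = (\<integral>x. u x \<partial>\<nu>')"
      have x0_sets: "{x0} \<in> sets \<nu>'" using compact_sets_borel_M[of "{x0}"] x0 \<nu>'(1) by simp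
      have Z_sets: "space \<nu>' - N n \<in> sets \<nu>'" using N_sets by blast
      have Z: "(1 - a) / 2 \<le> measure \<nu>' (space \<nu>' - N n)"
        using prob_compl[OF N_sets, of n] n by (simp add: field_simps)
      have "M - N n \<inter> M = M - N n" by blast
      have i: "integrable \<nu>' (\<lambda>x. k * indicator X x :: real)" if "X \<in> sets \<nu>'" for k X
        using that emeasure_finite[of X]
        by (intro integrable_mult_right integrable_real_indicator) (simp_all add: less_top[symmetric])
      have "min a ((1 - a) / 2) / 2 \<le> a * (1 - m)\<^sup>2 + (1 - a) / 2 * m\<^sup>2"
        by (rule indicator_variance_lower_bound) (use a in auto)
      also have "\<dots> \<le> (1 - m)\<^sup>2 * a + m\<^sup>2 * measure \<nu>' (space \<nu>' - N n)"
        using mult_left_mono[OF Z, of "m\<^sup>2"] by (simp add: mult.commute)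
      also have "\<dots> = (\<integral>x. (1 - m)\<^sup>2 * indicator {x0} x + m\<^sup>2 * indicator (space \<nu>' - N n) x \<partial>\<nu>')"
        using Bochner_Integration.integral_add[OF i[OF x0_sets] i[OF Z_sets], of "(1 - m)\<^sup>2" "m\<^sup>2"]
          x0_sets Z_sets x0 \<open>M - N n \<inter> M = M - N n\<close> by (simp add: a_def sp Int_absorb1 Diff_Int_distrib2)
      also have "\<dots> \<le> (\<integral>x. (u x - m)\<^sup>2 \<partial>\<nu>')"
      proof (rule integral_mono[OF Bochner_Integration.integrable_add[OF i[OF x0_sets] i[OF Z_sets]]])
        show "integrable \<nu>' (\<lambda>x. (u x - m)\<^sup>2)" by (intro int[OF \<nu>'] continuous_intros cont)
        fix x
        have ux0: "u x0 = 1"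
          using ch(2) \<delta>(1) L by (simp add: u_def extend_def c0 log_cutoff_0)
        have x0N: "x0 \<in> N n" using ch(2) rn by (simp add: N_def c0)
        have uN: "u x = 0" if "x \<notin> N n"
        proof (cases "x \<in> fst \<kappa>")
          case True
          then have "r / real (Suc n) \<le> norm (coord x)" using that by (simp add: N_def)
          then have "\<delta> \<le> (norm (coord x))\<^sup>2" unfolding \<delta>_def using rn by (intro power_mono) auto
          then show ?thesis using \<delta>(1) L by (simp add: u_def extend_def log_cutoff_eq_0)
        qed (simp add: u_def extend_def)
        show "(1 - m)\<^sup>2 * indicator {x0} x + m\<^sup>2 * indicator (space \<nu>' - N n) x \<le> (u x - m)\<^sup>2"
          using ux0 x0N uN by (cases "x = x0"; cases "x \<in> N n") (auto simp: indicator_def)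
      qed
      finally show ?thesis unfolding var_def m_def .
    qed
    ultimately show ?thesis using mult_left_mono[of _ "var \<nu>'" s] s(1) by (meson less_imp_le order_trans)
  qed
  have "((\<lambda>L. 3 * (K / L)) \<longlongrightarrow> 0) at_top"
    by real_asymp
  then have "s * (min a ((1 - a) / 2) / 2) \<le> 0"
    by (rule tendsto_lowerbound) (use upper in \<open>auto intro: eventually_at_top_linorderI[of 1]\<close>)
  moreover have "0 < s * (min a ((1 - a) / 2) / 2)" using s(1) a by simp
  ultimately show False by simp
qed

text \<open>Three limits are taken in turn: the index, L and \<epsilon>. The integrals of the
  squared cutoff tend to 1, its value at \<open>x0\<close>. The radius \<open>r\<close> depends on
  \<epsilon>, but the energy bound \<open>K / L\<close> does not depend on \<open>r\<close>.\<close>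

lemma limit_Dirac_imp_le_8_pi:
  assumes gc: "g = (SOME g. g \<in> c)"
    and \<nu>: "\<And>n. sets (\<nu> n) = sets borel_M" "\<And>n. emeasure (\<nu> n) M = 1"
      "\<And>n x. x \<in> M \<Longrightarrow> emeasure (\<nu> n) {x} = 0"
    and \<nu>': "sets \<nu>' = sets borel_M" "emeasure \<nu>' M = 1"
    and weak: "weakly_converges M \<nu> \<nu>'"
    and s: "0 < s" "\<forall>\<^sub>F n in sequentially. ennreal s \<le> eigenvalue M \<A> c 1 (\<nu> n)"
    and x0: "x0 \<in> M" "measure \<nu>' {x0} = 1"
  shows "s \<le> 8 * pi"
proof -
  have sp: "space \<nu>' = M"
    using sets_eq_imp_space_eq[OF \<nu>'(1)] by (simp add: space_restrict_space)
  interpret prob_space \<nu>' by (rule prob_spaceI) (simp add: sp \<nu>'(2))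
  have x0_sets: "{x0} \<in> sets \<nu>'" using compact_sets_borel_M[of "{x0}"] x0 \<nu>'(1) by simp
  have AE_x0: "AE x in \<nu>'. x = x0"
    using prob_eq_1[OF x0_sets] x0(2) by simp
  obtain K :: real where K: "0 < K"
    "\<And>\<delta> L. 0 < \<delta> \<Longrightarrow> 1 \<le> L \<Longrightarrow>
      (\<integral>\<^sup>+y. ennreal ((norm (euclidean_gradient (log_cutoff \<delta> L) y))\<^sup>2) \<partial>lborel) \<le> ennreal (K / L)"
    by (rule log_cutoff_energy_le) blast
  have upper: "s \<le> (1 + \<epsilon>) / (1 - \<epsilon>) * (8 * pi)" if \<epsilon>: "0 < \<epsilon>" "\<epsilon> < 1" for \<epsilon> :: real
  proof -
    obtain \<kappa> B r where ch: "almost_euclidean_chart M \<A> g \<kappa> B (snd \<kappa> x0) r \<epsilon>" "x0 \<in> fst \<kappa>" "0 < r"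
      by (rule almost_euclidean_chart_exists[OF x0(1) \<epsilon>]) auto
    interpret almost_euclidean_chart M \<A> g \<kappa> B "snd \<kappa> x0" r \<epsilon> by (rule ch(1))
    have bound: "s \<le> (1 + \<epsilon>) / (1 - \<epsilon>) * (K / L + 8 * pi)" if L: "1 \<le> L" for L
    proof -
      have L0: "0 < L" and r2: "0 < r\<^sup>2" using L ch(3) by auto
      define u where "u = extend (log_cutoff (r\<^sup>2) L)"
      have supp: "supported (log_cutoff (r\<^sup>2) L)"
        by (rule supported_log_cutoff[OF r2 order_refl L0 ch(3)])
      have cont: "continuous_on M (\<lambda>x. (u x)\<^sup>2)"
        unfolding u_def by (intro continuous_on_power continuous_on_extend[OF supp])
      have C0: "0 \<le> (1 + \<epsilon>) / (1 - \<epsilon>)" "0 \<le> K / L + 8 * pi" using \<epsilon> K(1) L0 by auto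
      have "(\<integral>x. (u x)\<^sup>2 \<partial>\<nu>') = (\<integral>x. 1 \<partial>\<nu>')"
      proof (rule integral_cong_AE)
        show "AE x in \<nu>'. (u x)\<^sup>2 = 1"
          using AE_x0 by eventually_elim (simp add: u_def extend_def coord_def ch(2) log_cutoff_0[OF r2 L0])
        show "(\<lambda>x. (u x)\<^sup>2) \<in> borel_measurable \<nu>'"
          using borel_measurable_continuous_on_restrict[OF cont] by (simp cong: measurable_cong_sets add: \<nu>'(1))
      qed simp
      then have "(\<integral>x. (u x)\<^sup>2 \<partial>\<nu>') = 1" by (simp add: prob_space)
      then have "(\<lambda>k. s * (\<integral>x. (u x)\<^sup>2 \<partial>\<nu> k)) \<longlonglongrightarrow> s * 1"
        using weak cont unfolding weakly_converges_def by (intro tendsto_mult tendsto_const) metis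
      moreover have "\<forall>\<^sub>F k in sequentially. s * (\<integral>x. (u x)\<^sup>2 \<partial>\<nu> k) \<le> (1 + \<epsilon>) / (1 - \<epsilon>) * (K / L + 8 * pi)"
        using s(2)
      proof eventually_elim
        case (elim k)
        have "ennreal (s * (\<integral>x. (u x)\<^sup>2 \<partial>\<nu> k)) = ennreal s * ennreal (\<integral>x. (u x)\<^sup>2 \<partial>\<nu> k)"
          using s(1) by (simp add: ennreal_mult)
        also have "\<dots> \<le> eigenvalue M \<A> c 1 (\<nu> k) * ennreal (\<integral>x. (u x)\<^sup>2 \<partial>\<nu> k)"
          by (intro mult_right_mono elim) simp
        also have "\<dots> \<le> ennreal ((1 + \<epsilon>) / (1 - \<epsilon>)) *
            ((\<integral>\<^sup>+y. ennreal ((norm (euclidean_gradient (log_cutoff (r\<^sup>2) L) y))\<^sup>2) \<partial>lborel) + ennreal (8 * pi))"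
          unfolding u_def
          by (rule eigenvalue_1_hersch[OF gc \<nu> supp log_cutoff_nonneg[OF r2 L0] log_cutoff_le_1[OF r2 L0] ch(3)])
        also have "\<dots> \<le> ennreal ((1 + \<epsilon>) / (1 - \<epsilon>)) * (ennreal (K / L) + ennreal (8 * pi))"
          by (intro mult_left_mono add_right_mono K(2) r2 L) simp
        also have "\<dots> = ennreal ((1 + \<epsilon>) / (1 - \<epsilon>) * (K / L + 8 * pi))"
        proof -
          have p: "0 \<le> K / L" "0 \<le> 8 * pi" using K(1) L0 by auto
          show ?thesis by (simp only: ennreal_mult[OF C0] ennreal_plus[OF p])
        qed
        finally show ?case by (simp only: ennreal_le_iff[OF mult_nonneg_nonneg[OF C0]])
      qed
      ultimately have "s * 1 \<le> (1 + \<epsilon>) / (1 - \<epsilon>) * (K / L + 8 * pi)"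
        by (rule tendsto_upperbound) simp
      then show ?thesis by simp
    qed
    have "((\<lambda>L. (1 + \<epsilon>) / (1 - \<epsilon>) * (K / L + 8 * pi)) \<longlongrightarrow> (1 + \<epsilon>) / (1 - \<epsilon>) * (0 + 8 * pi)) at_top"
      by (intro tendsto_intros real_tendsto_divide_at_top[OF tendsto_const] filterlim_ident)
    then have "s \<le> (1 + \<epsilon>) / (1 - \<epsilon>) * (0 + 8 * pi)"
      by (rule tendsto_lowerbound) (use bound in \<open>auto intro: eventually_at_top_linorderI[of 1]\<close>)
    then show ?thesis by simp
  qed
  have "((\<lambda>\<epsilon>::real. (1 + \<epsilon>) / (1 - \<epsilon>) * (8 * pi)) \<longlongrightarrow> (1 + 0) / (1 - 0) * (8 * pi)) (at_right 0)"
    by (intro tendsto_intros) auto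
  then have "s \<le> (1 + 0) / (1 - 0) * (8 * pi)"
  proof (rule tendsto_lowerbound)
    show "\<forall>\<^sub>F \<epsilon> in at_right (0::real). s \<le> (1 + \<epsilon>) / (1 - \<epsilon>) * (8 * pi)"
      using upper by (intro eventually_mono[OF eventually_at_right_real[of 0 1]]) auto
  qed simp
  then show ?thesis by simp
qed

end

section \<open>From the concentration estimates to the maximising sequence\<close>

lemma conformal_class_representative:
  assumes "conformal_class \<A> c"
  shows "riemannian_metric \<A> (SOME g. g \<in> c)"
proof -
  obtain g where g: "riemannian_metric \<A> g" "c = {h. riemannian_metric \<A> h \<and> conformal_to \<A> g h}"
    using assms unfolding conformal_class_def by blast
  have "conformal_to \<A> g g"
    unfolding conformal_to_def
  proof (intro exI conjI ballI)
    show "smooth_function \<A> (\<lambda>x. 1)"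
      unfolding smooth_function_def smooth_on_def
      by (intro ballI exI[of _ UNIV] exI[of _ "\<lambda>p. 1"]) (simp add: Ck_on_const)
  qed auto
  then have "g \<in> c" using g by simp
  then have "(SOME g. g \<in> c) \<in> c" by (rule someI[of "\<lambda>g. g \<in> c"])
  then show ?thesis using g(2) by blast
qed

theorem mainTheorem3:
  fixes M :: "'a::topological_space set"
    and \<A> :: "'a chart set"
    and c :: "'a metric_comps set"
    and \<mu> :: "nat \<Rightarrow> 'a measure"
  assumes "smooth_surface M \<A>"
    and "compact M"
    and "conformal_class \<A> c"
    and "sup_first_eigenvalue M \<A> c > ennreal (8 * pi)"
    and "\<And>n. continuous_radon_measure M (\<mu> n)"
    and "\<And>n. emeasure (\<mu> n) M = 1"
    and "(\<lambda>n. eigenvalue M \<A> c 1 (\<mu> n)) \<longlonglongrightarrow> sup_first_eigenvalue M \<A> c"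
  shows "\<exists>r \<mu>'. strict_mono r \<and>
           continuous_radon_measure M \<mu>' \<and>
           weakly_converges M (\<lambda>n. \<mu> (r n)) \<mu>' \<and>
           eigenvalue M \<A> c 1 \<mu>' * emeasure \<mu>' M = sup_first_eigenvalue M \<A> c"
proof -
  \<comment> \<open>The same choice as in \<open>rayleigh_quotient\<close>, so that estimates for
    the metric \<open>g\<close> become estimates for the eigenvalue.\<close>
  define g where "g = (SOME g. g \<in> c)"
  interpret riemannian_surface M \<A> g
    by unfold_locales (use assms conformal_class_representative in \<open>auto simp: g_def\<close>)
  have sets: "sets (\<mu> n) = sets borel_M" and atoms: "\<And>x. x \<in> M \<Longrightarrow> emeasure (\<mu> n) {x} = 0" for n
    using assms(5)[of n] unfolding continuous_radon_measure_def radon_measure_def by auto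
  obtain r \<mu>' where r: "strict_mono r" and radon: "radon_measure M \<mu>'" and mass: "emeasure \<mu>' M = 1"
    and weak: "weakly_converges M (\<lambda>n. \<mu> (r n)) \<mu>'"
    by (rule weakly_convergent_subsequence[OF sets assms(6)])
  have sets': "sets \<mu>' = sets borel_M" using radon unfolding radon_measure_def by (rule conjunct1)
  have lim: "(\<lambda>n. eigenvalue M \<A> c 1 (\<mu> (r n))) \<longlonglongrightarrow> sup_first_eigenvalue M \<A> c"
    using LIMSEQ_subseq_LIMSEQ[OF assms(7) r] by (simp add: comp_def)
  \<comment> \<open>The supremum might be infinite; a finite number below it bounds the eigenvalues
    eventually and still contradicts concentration.\<close>
  obtain S where S: "ennreal (8 * pi) < S" "S < sup_first_eigenvalue M \<A> c"
    using dense[OF assms(4)] by blast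
  define s where "s = enn2real S"
  have "S < top" using S(2) by (rule order_less_le_trans) simp
  then have Ss: "S = ennreal s" by (simp add: s_def)
  have s: "8 * pi < s" "0 < s"
  proof -
    have "0 \<le> s" by (simp add: s_def)
    then show "8 * pi < s" using S(1) unfolding Ss by (simp add: ennreal_less_iff)
    then show "0 < s" using pi_gt_zero by linarith
  qed
  have ev: "\<forall>\<^sub>F n in sequentially. ennreal s \<le> eigenvalue M \<A> c 1 (\<mu> (r n))"
    using order_tendstoD(1)[OF lim S(2)] unfolding Ss by eventually_elim simp
  have "emeasure \<mu>' {x} = 0" if x: "x \<in> M" for x
  proof -
    have "measure \<mu>' {x} = 0 \<or> measure \<mu>' {x} = 1"
      by (rule limit_has_no_partial_atom[OF g_def sets assms(6) sets' mass weak s(2) ev x])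
    moreover have "measure \<mu>' {x} \<noteq> 1"
      using limit_Dirac_imp_le_8_pi[OF g_def sets assms(6) atoms sets' mass weak s(2) ev x] s(1) by auto
    \<comment> \<open>\<open>measure\<close> is 0 also on sets of infinite measure, so finiteness is
      needed to return to \<open>emeasure\<close>.\<close>
    moreover have "emeasure \<mu>' {x} < \<infinity>"
      using radon x unfolding radon_measure_def by (meson compact_insert compact_empty empty_subsetI insert_subset)
    ultimately show ?thesis by (auto simp: measure_def enn2real_eq_0_iff)
  qed
  then have cont: "continuous_radon_measure M \<mu>'"
    unfolding continuous_radon_measure_def using radon by simp
  have "sup_first_eigenvalue M \<A> c \<le> eigenvalue M \<A> c 1 \<mu>'"
    by (rule eigenvalue_1_upper_semicontinuous[OF sets assms(6) sets' mass weak lim])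
  moreover have "eigenvalue M \<A> c 1 \<mu>' * emeasure \<mu>' M \<le> sup_first_eigenvalue M \<A> c"
    unfolding sup_first_eigenvalue_def by (rule SUP_upper) (use cont in simp)
  ultimately have "eigenvalue M \<A> c 1 \<mu>' * emeasure \<mu>' M = sup_first_eigenvalue M \<A> c"
    using mass by simp
  then show ?thesis using r cont weak by (intro exI conjI)
qed

end
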